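(* Let $q$ be a prime power, let $1<k<q$, and let $h_0,h_1\in\mathbf{F}_{q^2}[x]$ be relatively prime polynomials with $h_1\neq 0$, $\deg(h_0)<q+\deg(h_1)$, such that $$x^q h_1(x)-h_0(x)=f(x)\prod_{i=1}^{l} f_i(x)^{a_i}$$ where $l\ge 0$, $a_i\ge 1$, the polynomials $f,f_1,\dots,f_l$ are irreducible over $\mathbf{F}_{q^2}$ and pairwise relatively prime, $\deg f=k$, and $k_i:=\deg f_i\geq 2$ for all $1\le i\le l$. If $\deg(h_1)\leq 2$, then there is a group isomorphism $$\mathbf{Z}^{q^2+1}/\mathcal{L}_2^*\;\cong\;\mathbf{Z}/(q^{2k}-1)\mathbf{Z}\;\oplus\;\bigoplus_{1\le i\le l}\mathbf{Z}/(q^{2\gcd(k,k_i)}-1)\mathbf{Z}.$$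
   Context: Let $\lambda$ be a generator of $\mathbf{F}_{q^2}^*$, and let $\alpha_1=0,\alpha_2,\dots,\alpha_{q^2}$ be an enumeration of all elements of $\mathbf{F}_{q^2}$. Since $x^qh_1(x)-h_0(x)$ has no linear factor over $\mathbf{F}_{q^2}$, every $x+\alpha_i$ is invertible modulo $x^qh_1(x)-h_0(x)$. Define the lattice $$\mathcal{L}_2=\Big\{(e_0,\dots,e_{q^2})\in\mathbf{Z}^{q^2+1} : \lambda^{e_0}\prod_{i=1}^{q^2}(x+\alpha_i)^{e_i}=1 \pmod{x^qh_1(x)-h_0(x)}\Big\}.$$ $\mathcal{L}_2^*$ is the lattice in $\mathbf{Z}^{q^2+1}$ generated by $\mathcal{L}_2$ and the $q^2$ vectors $(0,q^{2k}-1,0,\dots,0),\dots,(0,0,\dots,0,q^{2k}-1)$ (that is, $(q^{2k}-1)$ times each standard basis vector other than the one in the coordinate of $e_0$). *)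

theory Defs
  imports
    "HOL-Algebra.Algebra"
    "HOL-Algebra.Algebraic_Closure_Type"
    "HOL-Number_Theory.Prime_Powers"
begin

abbreviation type_ring :: "'b::comm_ring_1 ring" where
  "type_ring \<equiv> ring_of_type_algebra"

definition poly_quot :: "'a::field poly \<Rightarrow> 'a poly set ring" where
  "poly_quot m = type_ring Quot (PIdl\<^bsub>type_ring\<^esub> m)"

definition poly_class :: "'a::field poly \<Rightarrow> 'a poly \<Rightarrow> 'a poly set" where
  "poly_class m p = (PIdl\<^bsub>type_ring\<^esub> m) +>\<^bsub>type_ring\<^esub> p"

text \<open>
  Free abelian group of rank \<open>N + 1\<close>, with coordinates numbered \<open>0, \<dots>, N\<close>.  The HOL-Algebra
  group constructions are multiplicative, so its operation is written as a product although it
  is coordinatewise addition of integers.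
\<close>

definition Zpow :: "nat \<Rightarrow> (nat \<Rightarrow> int) monoid" where
  "Zpow N = product_group {0..N} (\<lambda>_. integer_group)"

text \<open>
  Exponents may be negative, so the product is formed in the unit group of the quotient ring.
  It has the intended meaning when \<open>lam\<close> is nonzero and no \<open>x + al i\<close> has a common factor
  with \<open>m\<close>.
\<close>

definition rel_lattice ::
    "nat \<Rightarrow> 'a::field \<Rightarrow> (nat \<Rightarrow> 'a) \<Rightarrow> 'a poly \<Rightarrow> (nat \<Rightarrow> int) set" where
  "rel_lattice N lam al m =
     {e \<in> carrier (Zpow N).
        poly_class m [:lam:] [^]\<^bsub>units_of (poly_quot m)\<^esub> e 0
          \<otimes>\<^bsub>units_of (poly_quot m)\<^esub>
        (\<Otimes>\<^bsub>units_of (poly_quot m)\<^esub> i\<in>{1..N}.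
            poly_class m [:al i, 1:] [^]\<^bsub>units_of (poly_quot m)\<^esub> e i)
        = \<one>\<^bsub>units_of (poly_quot m)\<^esub>}"

definition scaled_unit :: "nat \<Rightarrow> int \<Rightarrow> nat \<Rightarrow> (nat \<Rightarrow> int)" where
  "scaled_unit N c i = (\<lambda>j\<in>{0..N}. if j = i then c else 0)"

text \<open>No multiple of the basis vector of coordinate \<open>0\<close>, the exponent of \<open>lam\<close>, is added.\<close>

definition rel_lattice_star ::
    "nat \<Rightarrow> int \<Rightarrow> 'a::field \<Rightarrow> (nat \<Rightarrow> 'a) \<Rightarrow> 'a poly \<Rightarrow> (nat \<Rightarrow> int) set" where
  "rel_lattice_star N c lam al m =
     generate (Zpow N) (rel_lattice N lam al m \<union> scaled_unit N c ` {1..N})"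

end

(*
  Evaluating at one root beta_i of each irreducible factor sends an exponent vector e to the values
  lam^(e_0) * prod_j (beta_i + alpha_j)^(e_j), one in the unit group of F_{q^(2 k_i)} for each i. The discrete
  logarithms of these values modulo q^(2 gcd(k, k_i)) - 1 give a homomorphism to the target group. The
  multiplicities a_i only contribute p-groups, on which raising to the power q^(2k) - 1 is invertible. So the
  statement reduces to this: lam and the elements beta_i + alpha generate the product of the unit groups.

  If they do not, some character chi of prime order d is trivial on constants and on all linear polynomials. Its
  L-function is a polynomial of degree n - 1, where n <= deg(m) <= q + 2, and it vanishes at 1. The sum of its
  inverse roots is -q^2, so the remaining n - 2 inverse roots have sum -(q^2 + 1). If all of them have absolute
  value at most q, then q^2 + 1 <= (n - 2) q <= q^2, a contradiction.

  This bound on the inverse roots is the Riemann hypothesis for the L-function. Over F_{q^(2r)} with r divisible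
  by all k_i, the character becomes a power residue symbol of one fixed polynomial U. The Stepanov-Bombieri
  argument gives an upper bound for every residue class of U, with an error O(q^r). The classes together cover
  the field, so lower bounds follow. Hence the power sums of the inverse roots are O(q^r) for infinitely many r,
  and Dirichlet approximation of their arguments bounds each of them.
*)
theory Submission
  imports
    Defs
    "HOL-Computational_Algebra.Computational_Algebra"
    "HOL-Analysis.Kronecker_Approximation_Theorem"
    "HOL-Number_Theory.Cong"
begin

hide_const (open) Coset.order Divisibility.prime Divisibility.irreducible

section \<open>Counting values of polynomials by the Stepanov-Bombieri method\<close>

text \<open>With Q = q^2, every finite field that occurs is realised as the fixed set
  \<open>FL i\<close> of a power of Frobenius in one algebraic closure, so all extensions share a
  type. The counting argument lives on the square in Q^r = (q^r)^2: raising to the power M = q^r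
  twice is the identity on that field. It also wants a single, totally ramified point at infinity,
  that is, a degree coprime to d. A character trivial on constants is unramified at infinity, so its
  polynomial has degree divisible by d, and one of its roots must be moved there; with d prime, any
  root whose multiplicity is not divisible by d will do. On the lattice side, the number q^(2k) - 1
  explains the gcds: in the cyclic group of order q^(2 k_i) - 1, the powers with this exponent form
  the subgroup of index q^(2 gcd(k, k_i)) - 1. Coordinate 0 gets no extra generator because q^2 - 1
  divides q^(2k) - 1: lam to this power is 1, and the vector is in the lattice already.\<close>

lemma linear_dependence_of_low_degree:
  fixes T :: "'i \<Rightarrow> 'a::field poly"
  assumes "finite J" "\<And>j i. j \<in> J \<Longrightarrow> m \<le> i \<Longrightarrow> coeff (T j) i = 0" "m < card J"
  shows "\<exists>c. (\<exists>j\<in>J. c j \<noteq> 0) \<and> (\<Sum>j\<in>J. smult (c j) (T j)) = 0"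
  using assms
proof (induction m arbitrary: J T)
  case 0
  then have "T j = 0" if "j \<in> J" for j
    using that by (intro poly_eqI) auto
  moreover obtain j where "j \<in> J" using 0 by (metis card.empty ex_in_conv less_irrefl)
  ultimately show ?case by (intro exI[of _ "\<lambda>_. 1"]) (auto intro!: sum.neutral)
next
  case (Suc m)
  show ?case
  proof (cases "\<exists>j0\<in>J. coeff (T j0) m \<noteq> 0")
    case False
    then have "coeff (T j) i = 0" if "j \<in> J" "m \<le> i" for j i
      using that Suc.prems(2)[of j i] by (cases "i = m") auto
    then show ?thesis using Suc.IH[of J T] Suc.prems by auto
  next
    case True
    then obtain j0 where j0: "j0 \<in> J" "coeff (T j0) m \<noteq> 0" by auto
    define b where "b j = coeff (T j) m / coeff (T j0) m" for j
    define T' where "T' j = T j - smult (b j) (T j0)" for j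
    have "coeff (T' j) i = 0" if "j \<in> J - {j0}" "m \<le> i" for j i
      using that Suc.prems(2)[of j i] Suc.prems(2)[of j0 i] j0
      by (cases "i = m") (auto simp: T'_def b_def)
    moreover have "m < card (J - {j0})" using Suc.prems j0 by (simp add: card_Diff_singleton)
    ultimately obtain c where c: "\<exists>j\<in>J-{j0}. c j \<noteq> 0" "(\<Sum>j\<in>J-{j0}. smult (c j) (T' j)) = 0"
      using Suc.IH[of "J - {j0}" T'] Suc.prems(1) by auto
    define c' where "c' j = (if j = j0 then - (\<Sum>j\<in>J-{j0}. c j * b j) else c j)" for j
    have "(\<Sum>j\<in>J. smult (c' j) (T j)) = smult (c' j0) (T j0) + (\<Sum>j\<in>J-{j0}. smult (c j) (T j))"
      using Suc.prems(1) j0 by (subst sum.remove[of _ j0]) (auto simp: c'_def intro!: sum.cong)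
    also have "(\<Sum>j\<in>J-{j0}. smult (c j) (T j)) = (\<Sum>j\<in>J-{j0}. smult (c j) (T' j) + smult (c j * b j) (T j0))"
      by (intro sum.cong) (auto simp: T'_def smult_diff_right)
    also have "\<dots> = smult (\<Sum>j\<in>J-{j0}. c j * b j) (T j0)"
      using c(2) by (simp add: sum.distrib smult_sum)
    finally have "(\<Sum>j\<in>J. smult (c' j) (T j)) = 0" by (simp add: c'_def flip: smult_add_left)
    moreover have "\<exists>j\<in>J. c' j \<noteq> 0" using c(1) by (auto simp: c'_def)
    ultimately show ?thesis by blast
  qed
qed

text \<open>Among the terms with nonzero coefficient exactly one has the largest degree, so nothing
  cancels its leading term.\<close>

lemma sum_smult_distinct_degree_nonzero:
  fixes P :: "'i \<Rightarrow> 'a::field poly"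
  assumes "finite J" "inj_on (\<lambda>j. degree (P j)) J" "\<And>j. j \<in> J \<Longrightarrow> P j \<noteq> 0" "\<exists>j\<in>J. c j \<noteq> 0"
  shows "(\<Sum>j\<in>J. smult (c j) (P j)) \<noteq> 0"
proof -
  define J' where "J' = {j\<in>J. c j \<noteq> 0}"
  have J': "finite J'" "J' \<noteq> {}" "J' \<subseteq> J" using assms by (auto simp: J'_def)
  obtain j0 where j0: "j0 \<in> J'" "\<And>j. j \<in> J' \<Longrightarrow> degree (P j) \<le> degree (P j0)"
  proof -
    have "Max ((\<lambda>j. degree (P j)) ` J') \<in> (\<lambda>j. degree (P j)) ` J'" using J' by (intro Max_in) auto
    then obtain j0 where "j0 \<in> J'" "degree (P j0) = Max ((\<lambda>j. degree (P j)) ` J')" by auto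
    then show ?thesis using J' by (intro that[of j0]) auto
  qed
  have "coeff (\<Sum>j\<in>J. smult (c j) (P j)) (degree (P j0)) = (\<Sum>j\<in>J. c j * coeff (P j) (degree (P j0)))"
    by (simp add: coeff_sum)
  also have "\<dots> = (\<Sum>j\<in>{j0}. c j * coeff (P j) (degree (P j0)))"
  proof (intro sum.mono_neutral_right)
    show "\<forall>i\<in>J - {j0}. c i * coeff (P i) (degree (P j0)) = 0"
    proof
      fix i assume i: "i \<in> J - {j0}"
      show "c i * coeff (P i) (degree (P j0)) = 0"
      proof (cases "i \<in> J'")
        case True
        then have "degree (P i) \<noteq> degree (P j0)" using assms(2) i j0 J' by (auto dest: inj_onD)
        then have "degree (P i) < degree (P j0)" using j0(2)[OF True] by simp
        then show ?thesis by (simp add: coeff_eq_0)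
      qed (use i in \<open>auto simp: J'_def\<close>)
    qed
  qed (use assms j0 J' in auto)
  also have "\<dots> \<noteq> 0" using j0 assms(3)[of j0] J' by (auto simp: J'_def)
  finally show ?thesis by auto
qed

text \<open>On the curve \<open>y ^ d = g\<close> the monomial \<open>x ^ i * y ^ j\<close> has pole order \<open>d * i + D * j\<close> at infinity.
  As \<open>D\<close> is coprime to \<open>d\<close>, every large \<open>w\<close> is such an order; its exponents are \<open>al w\<close> and \<open>io w\<close>.
  The polynomial \<open>Theta\<close> is built from products of an \<open>M\<close>-th power and a function of small order.
  On \<open>A\<close>, raising to the power \<open>M\<close> exchanges the two roles, and the coefficients are chosen such
  that the exchanged sum vanishes identically. So \<open>Theta\<close> vanishes on \<open>A\<close>, but it is not zero because
  its terms have distinct degrees.\<close>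
lemma kummer_count_upper_bound:
  fixes g :: "'e::alg_closed_field poly"
  assumes char: "prime CHAR('e)" and M: "M = CHAR('e) ^ s" and d: "d > 0" "d dvd M - 1"
    and D: "degree g = D" "coprime D d" "g \<noteq> 0"
    and large: "M > d + d * (d * D + 2) * (d * D + 1) + d * D"
    and A: "\<And>x. x \<in> A \<Longrightarrow> x ^ (M * M) = x" "\<And>x. x \<in> A \<Longrightarrow> poly g x ^ ((M * M - 1) div d) = 1"
  shows "d * card A \<le> M * M + (d * D + d * (d * D + 2)) * M"
proof -
  define c where "c = d * D"
  obtain m where m: "M = 1 + d * m"
    using d(2) large by (metis add.commute dvd_def le_add_diff_inverse2 less_imp_le_nat linorder_not_less nat_less_le One_nat_def Suc_leI less_nat_zero_code neq0_conv)
  \<comment> \<open>There are (M - c) * T unknown coefficients against about (d * T + M^2) / d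
    linear conditions. As d * m = M - 1, the surplus c + 2 makes the unknowns win for large
    \<open>M\<close>, while d * T stays M + O(1), which the final bound on the degree of
    \<open>Theta\<close> needs.\<close>
  define T where "T = m + (c + 2)"
  obtain b where b: "[D * b = 1] (mod d)"
    using cong_solve_coprime_nat[OF D(2)] by auto
  \<comment> \<open>\<open>b\<close> inverts \<open>D\<close> modulo \<open>d\<close>, so
    \<open>io w\<close> is the exponent of y below \<open>d\<close> with D * io w congruent to
    \<open>w\<close>. The exponent \<open>al w\<close> of x makes up the rest, which is nonnegative
    once \<open>w\<close> is at least c = d * D.\<close>
  define io where "io w = (w * b) mod d" for w
  have io_less: "io w < d" for w using d by (simp add: io_def)
  have cong_io: "[D * io w = w] (mod d)" for w
  proof -
    have "[D * io w = D * (w * b)] (mod d)" by (simp add: io_def cong_def mod_simps)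
    also have "D * (w * b) = (D * b) * w" by (simp add: mult_ac)
    also have "[(D * b) * w = 1 * w] (mod d)" using b by (intro cong_mult cong_refl)
    finally show ?thesis by simp
  qed
  define al where "al w = (w - D * io w) div d" for w
  have al: "d * al w + D * io w = w" if "c \<le> w" for w
  proof -
    have "D * io w \<le> D * d" using io_less[of w] by (simp add: less_imp_le_nat)
    also have "\<dots> \<le> w" using that by (simp add: c_def mult.commute)
    finally have le: "D * io w \<le> w" .
    moreover have "d dvd w - D * io w"
      using cong_io[of w] le by (metis cong_altdef_nat cong_sym)
    ultimately show ?thesis by (simp add: al_def)
  qed
  \<comment> \<open>For a pair \<open>j\<close>, \<open>fst j\<close> is the pole order of the small
    factor and \<open>wt j\<close> that of the factor to be raised to the power \<open>M\<close>.
    The correction \<open>r\<close> makes their sum divisible by \<open>d\<close>. As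
    \<open>M\<close> is 1 modulo \<open>d\<close>, the exponents of y then add up to a multiple of
    \<open>d\<close>, and the product is a polynomial in x alone.\<close>
  define r where "r w' = (d - (w' + c) mod d) mod d" for w' :: nat
  define wt where "wt j = c + snd j * d + r (fst j)" for j :: "nat \<times> nat"
  define J where "J = {c..<M} \<times> {..<T}"
  have "finite J" by (simp add: J_def)
  have wt_dvd: "d dvd wt j + fst j" for j
  proof -
    have "(wt j + fst j) mod d = (snd j * d + ((fst j + c) + r (fst j))) mod d"
      by (simp add: wt_def algebra_simps)
    also have "\<dots> = ((fst j + c) + r (fst j)) mod d" by simp
    also have "\<dots> = ((fst j + c) mod d + (d - (fst j + c) mod d)) mod d"
      by (simp add: r_def mod_simps)
    also have "\<dots> = 0" using d by simp
    finally show ?thesis by auto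
  qed
  have wt_bounds: "c \<le> wt j" "wt j < c + T * d" if "j \<in> J" for j
  proof -
    have "r (fst j) < d" using d by (simp add: r_def)
    moreover have "(snd j + 1) * d \<le> T * d" using that by (intro mult_right_mono) (auto simp: J_def)
    ultimately show "c \<le> wt j" "wt j < c + T * d" by (simp_all add: wt_def)
  qed
  define ex where "ex j = (io (wt j) + io (fst j)) div d" for j
  have ex: "d * ex j = io (wt j) + io (fst j)" if "j \<in> J" for j
  proof -
    have "[D * (io (wt j) + io (fst j)) = wt j + fst j] (mod d)"
      unfolding distrib_left by (intro cong_add cong_io)
    then have "d dvd D * (io (wt j) + io (fst j))" using wt_dvd[of j] by (simp add: cong_dvd_iff)
    then have "d dvd io (wt j) + io (fst j)" using D(2) by (simp add: coprime_commute coprime_dvd_mult_right_iff)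
    then show ?thesis by (simp add: ex_def)
  qed
  \<comment> \<open>By y^d = g and M = 1 + d * m, \<open>Th j\<close> is the M-th power of the
    monomial of order \<open>wt j\<close> times the monomial of order \<open>fst j\<close>; in
    \<open>Tt j\<close> the M-th power is on the other factor.\<close>
  define Th where "Th j = Polynomial.monom 1 (al (wt j) * M + al (fst j)) * g ^ (ex j + io (wt j) * m)" for j
  define Tt where "Tt j = Polynomial.monom 1 (al (wt j) + al (fst j) * M) * g ^ (ex j + io (fst j) * m)" for j
  have degTh: "d * degree (Th j) = wt j * M + fst j" if "j \<in> J" for j
  proof -
    have f: "c \<le> fst j" using that by (auto simp: J_def)
    have "d * degree (Th j) = d * (al (wt j) * M + al (fst j)) + D * (d * ex j + d * m * io (wt j))"
      using D by (simp add: Th_def degree_mult_eq degree_power_eq degree_monom_eq algebra_simps)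
    also have "\<dots> = (d * al (wt j) + D * io (wt j)) * M + (d * al (fst j) + D * io (fst j))"
      by (simp add: ex[OF that] m algebra_simps)
    finally show ?thesis using al[OF f] al[OF wt_bounds(1)[OF that]] by simp
  qed
  have degTt: "d * degree (Tt j) = wt j + fst j * M" if "j \<in> J" for j
  proof -
    have f: "c \<le> fst j" using that by (auto simp: J_def)
    have "d * degree (Tt j) = d * (al (wt j) + al (fst j) * M) + D * (d * ex j + d * m * io (fst j))"
      using D by (simp add: Tt_def degree_mult_eq degree_power_eq degree_monom_eq algebra_simps)
    also have "\<dots> = (d * al (wt j) + D * io (wt j)) + (d * al (fst j) + D * io (fst j)) * M"
      by (simp add: ex[OF that] m algebra_simps)
    finally show ?thesis using al[OF f] al[OF wt_bounds(1)[OF that]] by simp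
  qed
  define B where "B = (c + T * d + (M - 1) * M) div d + 1"
  have dTt: "degree (Tt j) < B" if "j \<in> J" for j
  proof -
    have "fst j * M \<le> (M - 1) * M" using that by (intro mult_right_mono) (auto simp: J_def)
    then have "d * degree (Tt j) \<le> c + T * d + (M - 1) * M" 
      using degTt[OF that] wt_bounds(2)[OF that] by linarith
    then have "degree (Tt j) \<le> (c + T * d + (M - 1) * M) div d"
      using d by (simp add: less_eq_div_iff_mult_less_eq mult.commute)
    then show ?thesis by (simp add: B_def)
  qed
  have cardJ: "B < card J"
  proof -
    \<comment> \<open>Writing M = x + c + 1 removes the truncated subtractions; \<open>large\<close>
      then pays for the terms that do not grow with x.\<close>
    define x where "x = M - c - 1"
    have x: "M = x + c + 1" using large by (simp add: x_def c_def)
    have xl: "x + 1 > d + d * (c + 2) * (c + 1)" using large x by (simp add: c_def)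
    have dT: "d * T = M - 1 + d * (c + 2)" by (simp add: T_def m algebra_simps)
    have "c + d * T + (M - 1) * M + d < (M - c) * (d * T)"
    proof -
      have e1: "c + d * T + (M - 1) * M + d = c + (x + c + d * (c + 2)) + (x + c) * (x + c + 1) + d"
        using dT x by simp
      have e2: "(M - c) * (d * T) = (x + 1) * (x + c + d * (c + 2))" using dT x by simp
      have "x + 1 \<le> (x + 1) * d" using mult_le_mono2[of 1 d "x + 1"] d by simp
      moreover have "c * (x + 1) \<le> d * c * (x + 1)" using mult_le_mono1[of 1 d "c * (x + 1)"] d by (metis One_nat_def Suc_leI mult.assoc mult_1)
      moreover have "(x + 1) * (x + c + d * (c + 2)) = (x + 1) * x + (x + 1) * c + d * c * (x + 1) + 2 * ((x + 1) * d)"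
        by (simp add: algebra_simps)
      moreover have "c + (x + c + d * (c + 2)) + (x + c) * (x + c + 1) + d
         = (x + 1) * x + 2 * c * (x + 1) + c * c + c + d * (c + 2) + x + d" by (simp add: algebra_simps)
      moreover have "d * (c + 2) * (c + 1) \<ge> c * c + c + d * (c + 2)"
      proof -
        have "c * c + c \<le> d * (c * c + c)" using d by simp
        then show ?thesis by (simp add: algebra_simps)
      qed
      ultimately show ?thesis unfolding e1 e2 using xl by (simp add: algebra_simps)
    qed
    also have "(M - c) * (d * T) = d * card J" by (simp add: J_def mult_ac)
    finally have "c + d * T + (M - 1) * M + d < d * card J" .
    moreover have "d * B \<le> c + T * d + (M - 1) * M + d"
      unfolding B_def distrib_left using times_div_less_eq_dividend[of d "c + T * d + (M - 1) * M"] by linarith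
    moreover have "T * d = d * T" by simp
    ultimately have "d * B < d * card J" by linarith
    then show ?thesis by (simp only: nat_mult_less_cancel1[OF d(1)])
  qed
  obtain lam where lam: "\<exists>j\<in>J. lam j \<noteq> 0" "(\<Sum>j\<in>J. smult (lam j) (Tt j)) = 0"
    using linear_dependence_of_low_degree[of J B Tt] \<open>finite J\<close> dTt cardJ
    by (metis coeff_eq_0 dual_order.strict_trans1)
  have "M > 0" using large by simp
  \<comment> \<open>\<open>M\<close> is a power of the characteristic, so the M-th power of
    \<open>Theta\<close> is additive and turns the coefficients \<open>mu\<close> into
    \<open>lam\<close>.\<close>
  obtain mu where mu: "\<And>j. mu j ^ M = lam j"
    using choice[of "\<lambda>j y. y ^ M = lam j"] nth_root_exists[OF \<open>M > 0\<close>] by auto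
  define Theta where "Theta = (\<Sum>j\<in>J. smult (mu j) (Th j))"
  have "Theta \<noteq> 0" unfolding Theta_def
  proof (rule sum_smult_distinct_degree_nonzero[OF \<open>finite J\<close>])
    show "inj_on (\<lambda>j. degree (Th j)) J"
    proof (rule inj_onI)
      fix i j assume ij: "i \<in> J" "j \<in> J" "degree (Th i) = degree (Th j)"
      then have e: "wt i * M + fst i = wt j * M + fst j" using degTh by metis
      \<comment> \<open>As \<open>fst\<close> is below \<open>M\<close>, it is the last digit in
        base \<open>M\<close>, so equal degrees force equal pairs.\<close>
      have lt: "fst i < M" "fst j < M" using ij by (auto simp: J_def)
      have f: "fst i = fst j" using arg_cong[OF e, of "\<lambda>x. x mod M"] lt by simp
      then have "wt i = wt j" using e \<open>M > 0\<close> by simp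
      then have "snd i = snd j" using f d by (simp add: wt_def)
      then show "i = j" using f by (simp add: prod_eq_iff)
    qed
    show "Th j \<noteq> 0" for j using D by (simp add: Th_def)
    show "\<exists>j\<in>J. mu j \<noteq> 0" using lam(1) mu \<open>M > 0\<close> by (metis power_0_left neq0_conv)
  qed
  have zero: "poly Theta x = 0" if "x \<in> A" for x
  proof -
    have "poly Theta x ^ M = (\<Sum>j\<in>J. (mu j * poly (Th j) x) ^ M)"
      unfolding Theta_def by (simp add: poly_sum freshmans_dream_sum'[OF char M])
    also have "\<dots> = (\<Sum>j\<in>J. lam j * poly (Tt j) x)"
    proof (intro sum.cong refl)
      fix j assume j: "j \<in> J"
      have u: "(M * M - 1) div d = m * (M + 1)"
      proof -
        have "M * M - 1 = d * (m * (M + 1))" by (simp add: m algebra_simps)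
        then show ?thesis using d by simp
      qed
      \<comment> \<open>The exponent splits into a multiple of (M^2 - 1) / d, which acts trivially
        on the values of \<open>g\<close> on \<open>A\<close>, and the exponent of \<open>g\<close>
        in \<open>Tt j\<close>.\<close>
      have e: "(ex j + io (wt j) * m) * M = ((M * M - 1) div d) * io (wt j) + (ex j + io (fst j) * m)"
      proof -
        have "(ex j + io (wt j) * m) * M = io (wt j) * m * M + ex j + m * (d * ex j)"
          by (simp add: m algebra_simps)
        then show ?thesis unfolding u ex[OF j] by (simp add: algebra_simps)
      qed
      have "poly (Th j) x ^ M = x ^ ((al (wt j) * M + al (fst j)) * M) * poly g x ^ ((ex j + io (wt j) * m) * M)"
        by (simp add: Th_def poly_monom power_mult_distrib power_mult)
      also have "x ^ ((al (wt j) * M + al (fst j)) * M) = (x ^ (M * M)) ^ al (wt j) * x ^ (al (fst j) * M)"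
        by (simp add: algebra_simps flip: power_mult power_add)
      also have "\<dots> = x ^ (al (wt j) + al (fst j) * M)" using A(1)[OF that] by (simp add: power_add)
      also have "poly g x ^ ((ex j + io (wt j) * m) * M) = poly g x ^ (ex j + io (fst j) * m)"
        unfolding e power_add power_mult A(2)[OF that] by simp
      finally show "(mu j * poly (Th j) x) ^ M = lam j * poly (Tt j) x"
        by (simp add: power_mult_distrib mu Tt_def poly_monom)
    qed
    also have "\<dots> = poly (\<Sum>j\<in>J. smult (lam j) (Tt j)) x" by (simp add: poly_sum)
    also have "\<dots> = 0" using lam by simp
    finally show ?thesis using \<open>M > 0\<close> by simp
  qed
  have "card A \<le> card {x. poly Theta x = 0}"
    using zero \<open>Theta \<noteq> 0\<close> by (intro card_mono poly_roots_finite) auto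
  also have "\<dots> \<le> degree Theta" using \<open>Theta \<noteq> 0\<close> by (rule card_poly_roots_bound)
  finally have cA: "card A \<le> degree Theta" .
  have "d * degree Theta \<le> (c + T * d) * M + M"
  proof -
    have "degree (smult (mu j) (Th j)) \<le> ((c + T * d) * M + M) div d" if "j \<in> J" for j
    proof -
      have "wt j * M \<le> (c + T * d) * M" using wt_bounds(2)[OF that] by simp
      moreover have "fst j \<le> M" using that by (auto simp: J_def)
      ultimately have "d * degree (Th j) \<le> (c + T * d) * M + M" using degTh[OF that] by linarith
      then have "degree (Th j) \<le> ((c + T * d) * M + M) div d"
        using d by (simp add: less_eq_div_iff_mult_less_eq mult.commute)
      then show ?thesis using degree_smult_le[of "mu j" "Th j"] by linarith
    qed
    then have "degree Theta \<le> ((c + T * d) * M + M) div d"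
      unfolding Theta_def by (intro degree_sum_le \<open>finite J\<close>) auto
    then show ?thesis using d by (simp add: less_eq_div_iff_mult_less_eq mult.commute)
  qed
  moreover have "c + T * d + 1 = M + (c + d * (c + 2))" by (simp add: T_def m algebra_simps)
  then have "(c + T * d) * M + M = M * M + (c + d * (c + 2)) * M"
    by (metis add_mult_distrib mult_1)
  ultimately show ?thesis using cA
    by (metis c_def le_trans mult_le_mono2)
qed

section \<open>Power sums of complex numbers\<close>

text \<open>If all \<open>w j ^ r\<close> point roughly along the positive real axis, they cannot
  cancel, so a single \<open>w i\<close> larger than \<open>B\<close> would make the power sum
  outgrow C * B ^ r. Simultaneous approximation finds such an \<open>r\<close> among the multiples
  of any given number.\<close>

lemma power_sums_bound_imp_norm_bound:
  fixes w :: "nat \<Rightarrow> complex" and B C :: real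
  assumes B: "B > 0" and r0: "r0 > (0::nat)"
    and bound: "\<And>r. r0 dvd r \<Longrightarrow> r1 \<le> r \<Longrightarrow> cmod (\<Sum>i<n. w i ^ r) \<le> C * B ^ r"
    and i: "i < n"
  shows "cmod (w i) \<le> B"
proof (rule ccontr)
  assume "\<not> cmod (w i) \<le> B"
  then have gt: "cmod (w i) / B > 1" using B by simp
  obtain K0 where K0: "\<And>k. k \<ge> K0 \<Longrightarrow> 2 * C < (cmod (w i) / B) ^ k"
  proof -
    obtain K0 where "2 * C < (cmod (w i) / B) ^ K0" using real_arch_pow[OF gt] by auto
    then have "2 * C < (cmod (w i) / B) ^ k" if "k \<ge> K0" for k
      using power_increasing[OF that, of "cmod (w i) / B"] gt by linarith
    then show ?thesis using that by blast
  qed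
  \<comment> \<open>The exponent will be \<open>K\<close> times the common denominator
    \<open>q\<close> of the approximations, so it is divisible by \<open>r0\<close> and large enough
    however small \<open>q\<close> turns out. The tolerance 1/6 of a turn is pi/3, where the cosine
    is 1/2.\<close>
  define K where "K = r0 * (K0 + r1 + 1)"
  define \<theta> where "\<theta> i = real K * (Arg (w i) / (2 * pi))" for i
  obtain q p where qp: "0 < q" "q \<le> int (6 ^ n)" "\<And>i. i < n \<Longrightarrow> \<bar>of_int q * \<theta> i - of_int (p i)\<bar> < 1 / real 6"
    by (rule Dirichlet_approx_simult[of 6 n \<theta>]) auto
  define r where "r = K * nat q"
  have r: "real r = real K * of_int q" using qp(1) by (simp add: r_def)
  have "K \<le> r" using mult_le_mono2[of 1 "nat q" K] qp(1) unfolding r_def by linarith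
  moreover have "K0 + r1 + 1 \<le> K" using mult_le_mono1[of 1 r0 "K0 + r1 + 1"] r0 by (simp add: K_def)
  ultimately have rge: "K0 \<le> r" "r1 \<le> r" by linarith+
  have "r0 dvd r" by (simp add: r_def K_def)
  have Re: "Re (w j ^ r) \<ge> cmod (w j) ^ r / 2" if "j < n" for j
  proof -
    have "w j = rcis (cmod (w j)) (Arg (w j))" by (simp add: rcis_cmod_Arg)
    then have "w j ^ r = rcis (cmod (w j) ^ r) (real r * Arg (w j))" by (metis DeMoivre2)
    then have "Re (w j ^ r) = cmod (w j) ^ r * cos (real r * Arg (w j))" by simp
    moreover have "real r * Arg (w j) = 2 * pi * (of_int q * \<theta> j)"
      by (simp add: r \<theta>_def)
    moreover have "cos (2 * pi * (of_int q * \<theta> j)) \<ge> 1 / 2"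
    proof -
      define t where "t = of_int q * \<theta> j - of_int (p j)"
      have "cos (2 * pi * (of_int q * \<theta> j)) = cos (2 * pi * t + 2 * pi * of_int (p j))"
        by (simp add: t_def algebra_simps)
      also have "\<dots> = cos (2 * pi * t)" by (simp only: cos_add cos_int_2pin sin_int_2pin mult_1_right mult_zero_right diff_0_right)
      also have "\<dots> = cos \<bar>2 * pi * t\<bar>" by simp
      also have "\<dots> \<ge> cos (pi / 3)"
      proof (rule cos_monotone_0_pi_le)
        have "\<bar>t\<bar> \<le> 1 / 6" using qp(3)[OF that] by (simp add: t_def)
        then show "\<bar>2 * pi * t\<bar> \<le> pi / 3" by (simp add: abs_mult)
      qed auto
      finally show ?thesis by (simp add: cos_60)
    qed
    ultimately show ?thesis
      using mult_left_mono[of "1/2" "cos (2 * pi * (of_int q * \<theta> j))" "cmod (w j) ^ r"] by simp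
  qed
  have "cmod (w i) ^ r / 2 \<le> (\<Sum>j<n. cmod (w j) ^ r / 2)"
    using i by (intro member_le_sum) auto
  also have "\<dots> \<le> (\<Sum>j<n. Re (w j ^ r))" by (intro sum_mono Re) auto
  also have "\<dots> = Re (\<Sum>j<n. w j ^ r)" by simp
  also have "\<dots> \<le> C * B ^ r" using bound[OF \<open>r0 dvd r\<close> rge(2)] complex_Re_le_cmod order_trans by blast
  finally have "(cmod (w i) / B) ^ r \<le> 2 * C" using B by (simp add: power_divide field_simps)
  with K0[OF rge(1)] show False by simp
qed

text \<open>\<open>a\<close> lists the coefficients of the product of the 1 - w_i T, where some
  \<open>w i\<close> are 0 if the degree drops below n - 1. Because \<open>a 0 = 1\<close>, the
  recursion determines \<open>S\<close> from \<open>a\<close>, and the negated power sums of the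
  \<open>w i\<close> satisfy the same recursion.\<close>

lemma newton_power_sums:
  fixes a :: "nat \<Rightarrow> complex"
  assumes a0: "a 0 = 1" and a_high: "\<And>j. j \<ge> n \<Longrightarrow> a j = 0" and n: "n > 0"
    and newton: "\<And>j. j > 0 \<Longrightarrow> of_nat j * a j = (\<Sum>i=1..j. S i * a (j - i))"
  shows "\<exists>w. (\<forall>r>0. S r = - (\<Sum>i<n-1. w i ^ r)) \<and>
    (\<forall>z. (\<Sum>j<n. a j * z ^ (n - 1 - j)) = (\<Prod>i<n-1. (z - w i)))"
proof -
  define A where "A = (\<Sum>j<n. Polynomial.monom (a j) (n - 1 - j))"
  have coeffA: "coeff A (n - 1 - j) = a j" if "j < n" for j
  proof -
    have "coeff A (n - 1 - j) = (\<Sum>i<n. if n - 1 - i = n - 1 - j then a i else 0)"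
      by (simp add: A_def coeff_sum)
    also have "\<dots> = (\<Sum>i<n. if i = j then a i else 0)"
      using that by (intro sum.cong) auto
    finally show ?thesis using that by simp
  qed
  have "coeff A k = 0" if "k > n - 1" for k
    using that by (auto simp: A_def coeff_sum intro!: sum.neutral)
  then have degA: "degree A = n - 1" using coeffA[of 0] a0 n
    by (intro antisym degree_le le_degree) auto
  then have lead: "lead_coeff A = 1" using coeffA[of 0] a0 n by simp
  then have "A \<noteq> 0" by auto
  then obtain R where R: "size R = degree A" "A = smult (lead_coeff A) (\<Prod>x\<in>#R. [:-x, 1:])"
    using alg_closed_imp_factorization[of A] by auto
  obtain ws where ws: "R = mset ws" by (metis ex_mset)
  define w where "w i = ws ! i" for i
  have len: "length ws = n - 1" using R(1) degA ws by (metis size_mset)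
  have "(\<Prod>x\<in>#R. [:-x, 1:]) = (\<Prod>i<n-1. [:- w i, 1:])"
    unfolding ws by (simp add: len prod_mset_prod_list prod.list_conv_set_nth w_def atLeast0LessThan flip: mset_map)
  then have A: "A = (\<Prod>i<n-1. [:- w i, 1:])" using R(2) lead by simp
  define L where "L = (\<Prod>i<n-1. (1 - fps_const (w i) * fps_X :: complex fps))"
  have L_nth: "fps_nth L j = a j" for j
  proof -
    have "reflect_poly A = (\<Prod>i<n-1. [:1, - w i:])"
      unfolding A reflect_poly_prod by (intro prod.cong refl) (auto simp: reflect_poly_def )
    then have "fps_of_poly (reflect_poly A) = L"
      unfolding L_def by (simp add: fps_of_poly_prod fps_of_poly_pCons mult.commute flip: fps_const_neg)
    then have "fps_nth L j = coeff (reflect_poly A) j" by (metis fps_of_poly_nth)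
    also have "\<dots> = a j" using coeffA[of j] a_high[of j] n
      by (auto simp: coeff_reflect_poly degA)
    finally show ?thesis .
  qed
  define W where "W = (\<lambda>r. - (\<Sum>i<n-1. w i ^ r))"
  \<comment> \<open>The logarithmic derivative, multiplied out to avoid quotients; each new factor
    contributes the geometric series in \<open>geo\<close>.\<close>
  have der: "fps_X * fps_deriv (\<Prod>i\<in>I. (1 - fps_const (w i) * fps_X))
      = (\<Prod>i\<in>I. (1 - fps_const (w i) * fps_X)) * Abs_fps (\<lambda>r. if r = 0 then 0 else - (\<Sum>i\<in>I. w i ^ r))"
    if "finite I" for I
    using that
  proof (induction I rule: finite_induct)
    case empty
    then show ?case by (simp add: fps_eq_iff)
  next
    case (insert i I)
    let ?P = "\<Prod>i\<in>I. (1 - fps_const (w i) * fps_X)"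
    have geo: "(1 - fps_const (w i) * fps_X) * Abs_fps (\<lambda>r. if r = 0 then 0 else - (w i ^ r)) = - fps_const (w i) * fps_X"
    proof (rule fps_ext)
      fix r
      show "fps_nth ((1 - fps_const (w i) * fps_X) * Abs_fps (\<lambda>r. if r = 0 then 0 else - (w i ^ r))) r
          = fps_nth (- fps_const (w i) * fps_X) r"
        by (cases r; cases "r - 1") (auto simp: left_diff_distrib mult.assoc)
    qed
    have split: "Abs_fps (\<lambda>r. if r = 0 then 0 else - (\<Sum>i\<in>insert i I. w i ^ r))
        = Abs_fps (\<lambda>r. if r = 0 then 0 else - (w i ^ r)) + Abs_fps (\<lambda>r. if r = 0 then 0 else - (\<Sum>i\<in>I. w i ^ r))"
      using insert by (simp add: fps_eq_iff)
    have "fps_X * fps_deriv (\<Prod>i\<in>insert i I. (1 - fps_const (w i) * fps_X))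
       = (1 - fps_const (w i) * fps_X) * (fps_X * fps_deriv ?P) + ?P * (- fps_const (w i) * fps_X)"
      using insert by (simp add: algebra_simps del: fps_const_neg flip: fps_const_neg)
    also have "\<dots> = ?P * ((1 - fps_const (w i) * fps_X) * Abs_fps (\<lambda>r. if r = 0 then 0 else - (w i ^ r)))
        + (1 - fps_const (w i) * fps_X) * (?P * Abs_fps (\<lambda>r. if r = 0 then 0 else - (\<Sum>i\<in>I. w i ^ r)))"
      unfolding insert.IH geo by (simp add: add.commute)
    also have "\<dots> = (1 - fps_const (w i) * fps_X) * ?P * Abs_fps (\<lambda>r. if r = 0 then 0 else - (\<Sum>i\<in>insert i I. w i ^ r))"
      unfolding split by (simp add: algebra_simps)
    finally show ?case using insert by simp
  qed
  have newtonW: "of_nat j * a j = (\<Sum>i=1..j. W i * a (j - i))" if "j > 0" for j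
  proof -
    have "of_nat j * a j = fps_nth (fps_X * fps_deriv L) j"
      using that by (cases j) (auto simp: L_nth)
    also have "\<dots> = fps_nth (Abs_fps (\<lambda>r. if r = 0 then 0 else W r) * L) j"
      unfolding L_def W_def by (subst der) (simp_all add: mult.commute)
    also have "\<dots> = (\<Sum>i=0..j. (if i = 0 then 0 else W i) * a (j - i))"
      by (simp add: fps_mult_nth L_nth)
    also have "\<dots> = (\<Sum>i=1..j. W i * a (j - i))"
      by (subst sum.atLeast_Suc_atMost) auto
    finally show ?thesis .
  qed
  have "S r = W r" if "r > 0" for r
    using that
  proof (induction r rule: less_induct)
    case (less r)
    have "(\<Sum>i=1..r. S i * a (r - i)) = (\<Sum>i=1..r. W i * a (r - i))"
      using newton[OF less.prems] newtonW[OF less.prems] by simp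
    moreover have "(\<Sum>i=1..r. f i * a (r - i)) = f r + (\<Sum>i=1..<r. f i * a (r - i))" for f :: "nat \<Rightarrow> complex"
      using less.prems by (subst sum.last_plus) (auto simp: a0)
    moreover have "(\<Sum>i=1..<r. S i * a (r - i)) = (\<Sum>i=1..<r. W i * a (r - i))"
      using less.IH by (intro sum.cong) auto
    ultimately show ?case by simp
  qed
  moreover have "(\<Sum>j<n. a j * z ^ (n - 1 - j)) = (\<Prod>i<n-1. (z - w i))" for z
  proof -
    have "poly A z = (\<Sum>j<n. a j * z ^ (n - 1 - j))" by (simp add: A_def poly_sum poly_monom)
    moreover have "poly A z = (\<Prod>i<n-1. (z - w i))" unfolding A by (simp add: poly_prod)
    ultimately show ?thesis by simp
  qed
  ultimately show ?thesis by (intro exI[of _ w]) (auto simp: W_def)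
qed

section \<open>Polynomials fixed by the Frobenius map\<close>

lemma alg_closed_proots:
  fixes p :: "'e::alg_closed_field poly"
  assumes "p \<noteq> 0"
  shows "p = smult (lead_coeff p) (\<Prod>x\<in>#proots p. [:-x, 1:])" "size (proots p) = degree p"
proof -
  obtain A where A: "size A = degree p" "p = smult (lead_coeff p) (\<Prod>x\<in>#A. [:-x, 1:])"
    using alg_closed_imp_factorization[OF assms] by auto
  have "proots p = proots (\<Prod>x\<in>#A. [:-x, 1:])" using A(2) assms
    by (metis leading_coeff_0_iff proots_smult)
  also have "\<dots> = A"
    by (induction A) (simp_all add: proots_mult prod_mset_zero_iff image_iff del: mult_pCons_left)
  finally have "proots p = A" .
  then show "p = smult (lead_coeff p) (\<Prod>x\<in>#proots p. [:-x, 1:])" "size (proots p) = degree p"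
    using A by auto
qed

lemma dvd_if_proots_subset:
  fixes p g :: "'e::alg_closed_field poly"
  assumes "p \<noteq> 0" "g \<noteq> 0" "proots p \<subseteq># proots g"
  shows "p dvd g"
proof -
  obtain A where A: "proots g = proots p + A" using assms(3) by (metis subset_mset.le_iff_add)
  have "(\<Prod>x\<in>#proots p. [:-x, 1:]) dvd (\<Prod>x\<in>#proots g. [:-x, 1:])"
    by (simp add: A)
  then have "smult (lead_coeff p) (\<Prod>x\<in>#proots p. [:-x, 1:]) dvd smult (lead_coeff g) (\<Prod>x\<in>#proots g. [:-x, 1:])"
    using assms(1) by (simp add: smult_dvd_iff dvd_smult)
  then show ?thesis
    by (simp only: alg_closed_proots(1)[OF assms(1), symmetric] alg_closed_proots(1)[OF assms(2), symmetric])
qed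

lemma card_roots_separable:
  fixes p :: "'e::alg_closed_field poly"
  assumes "p \<noteq> 0" "\<And>x. poly p x = 0 \<Longrightarrow> poly (pderiv p) x \<noteq> 0"
  shows "card {x. poly p x = 0} = degree p"
proof -
  have "order x p = 1" if x: "poly p x = 0" for x
  proof -
    have "\<not> [:-x, 1:] ^ 2 dvd p"
    proof
      assume "[:-x, 1:] ^ 2 dvd p"
      then obtain u where "p = [:-x, 1:] * ([:-x, 1:] * u)" by (auto simp only: power2_eq_square mult.assoc elim!: dvdE)
      then have "poly (pderiv p) x = 0"
        by (simp only: pderiv_mult[of "[:-x, 1:]"] poly_add poly_mult) simp
      then show False using assms(2) x by blast
    qed
    then have "\<not> 2 \<le> order x p" using order_divides[of x 2 p] by blast
    moreover have "order x p \<noteq> 0" using x assms(1) by (simp add: order_root)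
    ultimately show ?thesis by simp
  qed
  then have "(\<Sum>x\<in>set_mset (proots p). count (proots p) x) = card {x. poly p x = 0}"
    using assms(1) by simp
  then show ?thesis using alg_closed_proots(2)[OF assms(1)] by (simp add: size_multiset_overloaded_eq)
qed

locale frobenius =
  fixes Q :: nat and ty :: "'e::alg_closed_field itself"
  assumes char: "prime CHAR('e)" and Q_power: "\<exists>s>0. Q = CHAR('e) ^ s"
begin

lemma Q_gt_1: "Q > 1"
  using Q_power char prime_gt_1_nat by (metis one_less_power)

lemma Q_pow_gt_1: "i > 0 \<Longrightarrow> Q ^ i > 1"
  using Q_gt_1 by (rule one_less_power)

lemma Q_pow_pos [simp]: "Q ^ i > 0"
  using Q_gt_1 by simp

lemma Q_pow_char: "\<exists>s. Q ^ i = CHAR('e) ^ s"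
  using Q_power by (metis power_mult)

lemma frob_add: "(x + y :: 'e) ^ (Q ^ i) = x ^ (Q ^ i) + y ^ (Q ^ i)"
  using Q_pow_char[of i] freshmans_dream'[OF char] by blast

lemma frob_sum: "(sum f A :: 'e) ^ (Q ^ i) = (\<Sum>x\<in>A. f x ^ (Q ^ i))"
  using Q_pow_char[of i] freshmans_dream_sum'[OF char] by blast

lemma frob_uminus: "(- x :: 'e) ^ (Q ^ i) = - (x ^ (Q ^ i))"
  using frob_add[of x "- x" i] Q_pow_pos[of i]
  by (metis add.right_inverse add_eq_0_iff power_0_left less_irrefl)

lemma frob_diff: "(x - y :: 'e) ^ (Q ^ i) = x ^ (Q ^ i) - y ^ (Q ^ i)"
  using frob_add[of x "- y" i] by (simp add: frob_uminus)

lemma frob_inj: "(x :: 'e) ^ (Q ^ i) = y ^ (Q ^ i) \<longleftrightarrow> x = y"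
proof
  assume "x ^ (Q ^ i) = y ^ (Q ^ i)"
  then have "(x - y) ^ (Q ^ i) = 0" by (simp add: frob_diff)
  then show "x = y" by simp
qed simp

lemma frob_frob: "((x :: 'e) ^ (Q ^ i)) ^ (Q ^ j) = x ^ (Q ^ (i + j))"
  by (simp add: power_add flip: power_mult)

text \<open>For i > 0 this is the subfield with Q^i elements; \<open>FL 0\<close> is the whole
  field.\<close>

definition FL :: "nat \<Rightarrow> 'e set" where "FL i = {x. x ^ (Q ^ i) = x}"

lemma FL_iff: "x \<in> FL i \<longleftrightarrow> x ^ (Q ^ i) = x" by (simp add: FL_def)

lemma FL_power: "x \<in> FL i \<Longrightarrow> x ^ n \<in> FL i"
  unfolding FL_iff by (metis power_mult mult.commute)

lemma FL_closed:
  "0 \<in> FL i" "1 \<in> FL i" "x \<in> FL i \<Longrightarrow> y \<in> FL i \<Longrightarrow> x + y \<in> FL i"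
  "x \<in> FL i \<Longrightarrow> y \<in> FL i \<Longrightarrow> x - y \<in> FL i" "x \<in> FL i \<Longrightarrow> - x \<in> FL i"
  "x \<in> FL i \<Longrightarrow> y \<in> FL i \<Longrightarrow> x * y \<in> FL i" "x \<in> FL i \<Longrightarrow> inverse x \<in> FL i"
  using Q_pow_pos[of i]
  by (simp_all add: FL_iff frob_add frob_diff frob_uminus power_mult_distrib power_inverse power_0_left)

lemma card_FL: "i > 0 \<Longrightarrow> card (FL i) = Q ^ i"
proof -
  assume i: "i > 0"
  define p :: "'e poly" where "p = Polynomial.monom 1 (Q ^ i) - Polynomial.monom 1 1"
  have d: "degree p = Q ^ i"
    using Q_pow_gt_1[OF i] unfolding p_def diff_conv_add_uminus
    by (subst degree_add_eq_left) (simp_all add: degree_monom_eq)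
  have "of_nat (Q ^ i) = (0 :: 'e)"
  proof -
    obtain s where "s > 0" "Q ^ i = CHAR('e) ^ s" using Q_power i by (metis power_mult nat_0_less_mult_iff)
    then show ?thesis by (simp add: of_nat_eq_0_iff_char_dvd dvd_power)
  qed
  then have "pderiv p = - 1" by (simp add: p_def pderiv_diff pderiv_monom monom_0 one_pCons power_0_left)
  then have "card {x. poly p x = 0} = degree p"
    using d Q_pow_pos[of i] by (intro card_roots_separable) auto
  then show ?thesis using d by (simp add: p_def FL_def poly_monom)
qed

lemma finite_FL: "i > 0 \<Longrightarrow> finite (FL i)"
  using card_FL[of i] Q_pow_pos[of i] by (metis card.infinite less_irrefl)

lemma FL_mono: "i dvd j \<Longrightarrow> FL i \<subseteq> FL j"
proof
  fix x assume "i dvd j" "x \<in> FL i"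
  then obtain m where m: "j = i * m" by auto
  have "x ^ (Q ^ (i * m)) = x" for m
  proof (induction m)
    case (Suc m)
    have "x ^ (Q ^ (i * Suc m)) = (x ^ (Q ^ i)) ^ (Q ^ (i * m))" by (simp add: frob_frob)
    then show ?case using \<open>x \<in> FL i\<close> Suc by (simp add: FL_iff)
  qed auto
  then show "x \<in> FL j" by (simp add: m FL_iff)
qed

lemma FL_primitive:
  assumes "i > 0"
  obtains \<gamma> where "\<gamma> \<in> FL i" "\<gamma> \<noteq> 0" "\<And>x. x \<in> FL i \<Longrightarrow> x \<noteq> 0 \<Longrightarrow> \<exists>n. x = \<gamma> ^ n"
proof -
  define R :: "'e ring" where "R = \<lparr>carrier = FL i, monoid.mult = (*), one = 1, ring.zero = 0, add = (+)\<rparr>"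
  have "field R"
  proof -
    have "\<exists>y\<in>FL i. x + y = 0" if "x \<in> FL i" for x
      using that FL_closed(5) by (metis add.right_inverse)
    moreover have "\<exists>y\<in>FL i. x * y = 1" if "x \<in> FL i" "x \<noteq> 0" for x
      using that FL_closed(7) by (metis right_inverse)
    ultimately show ?thesis
      unfolding R_def by unfold_locales (auto simp: algebra_simps Units_def FL_closed)
  qed
  have pow: "a [^]\<^bsub>R\<^esub> (n::nat) = a ^ n" for a n
    by (induction n) (auto simp: R_def nat_pow_def mult.commute)
  have "finite (carrier R)" using finite_FL[OF assms] by (simp add: R_def)
  then obtain a where "a \<in> carrier (mult_of R)" "carrier (mult_of R) = {a[^]\<^bsub>R\<^esub>i | i::nat . i \<in> UNIV}"
    using field.finite_field_mult_group_has_gen[OF \<open>field R\<close>] by auto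
  then show ?thesis using that[of a] by (auto simp: pow) (auto simp: R_def)
qed

lemma FL_power_order: "x \<in> FL i \<Longrightarrow> x \<noteq> 0 \<Longrightarrow> x ^ (Q ^ i - 1) = 1"
proof -
  assume x: "x \<in> FL i" "x \<noteq> 0"
  have "x * x ^ (Q ^ i - 1) = x ^ (Q ^ i)" using Q_pow_pos[of i] by (metis power_Suc Suc_pred')
  then show ?thesis using x by (simp add: FL_iff)
qed

text \<open>If \<open>\<gamma> ^ n\<close> is 1, so is the power with exponent gcd(n, Q^i - 1). Then
  \<open>\<gamma>\<close> has at most that many powers, although they exhaust the Q^i - 1 nonzero
  elements.\<close>

lemma primitive_power_eq_1:
  assumes "i > 0" "\<gamma> \<in> FL i" "\<gamma> \<noteq> 0" "\<And>x. x \<in> FL i \<Longrightarrow> x \<noteq> 0 \<Longrightarrow> \<exists>n. x = \<gamma> ^ n"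
  shows "\<gamma> ^ n = 1 \<longleftrightarrow> (Q ^ i - 1) dvd n"
proof
  assume n: "\<gamma> ^ n = 1"
  define m where "m = gcd n (Q ^ i - 1)"
  have m0: "m > 0" using Q_pow_gt_1[OF assms(1)] by (simp add: m_def)
  have gm: "\<gamma> ^ m = 1"
  proof -
    define N where "N = Q ^ i - 1"
    obtain u v where "u * int n + v * int N = int m"
      using bezout_int[of "int n" "int N"] by (auto simp: m_def N_def gcd_int_int_eq)
    then have "\<gamma> powi (int m) = \<gamma> powi (int n * u + int N * v)" by (simp add: mult.commute)
    also have "\<dots> = (\<gamma> powi int n) powi u * (\<gamma> powi int N) powi v"
      using assms(3) by (simp add: power_int_add power_int_mult)
    also have "\<dots> = 1" using n FL_power_order[OF assms(2,3)] by (simp add: N_def)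
    finally show ?thesis by simp
  qed
  have "FL i - {0} \<subseteq> (\<lambda>n. \<gamma> ^ n) ` {..<m}"
  proof
    fix x assume "x \<in> FL i - {0}"
    then obtain n where "x = \<gamma> ^ n" using assms(4) by auto
    also have "\<gamma> ^ n = (\<gamma> ^ m) ^ (n div m) * \<gamma> ^ (n mod m)" by (simp flip: power_mult power_add)
    finally show "x \<in> (\<lambda>n. \<gamma> ^ n) ` {..<m}" using gm m0 by auto
  qed
  then have "card (FL i - {0}) \<le> m" by (metis card_lessThan finite_lessThan surj_card_le)
  then have "Q ^ i - 1 \<le> m" using finite_FL[OF assms(1)] card_FL[OF assms(1)] FL_closed(1)[of i] by simp
  moreover have "m dvd Q ^ i - 1" by (simp add: m_def)
  then have "m \<le> Q ^ i - 1" using Q_pow_gt_1[OF assms(1)] by (intro dvd_imp_le) auto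
  ultimately have "Q ^ i - 1 = m" by simp
  then show "(Q ^ i - 1) dvd n" unfolding m_def by (metis gcd_dvd1)
next
  assume "(Q ^ i - 1) dvd n"
  then show "\<gamma> ^ n = 1" using FL_power_order[OF assms(2,3)] by (auto simp: power_mult elim!: dvdE)
qed

text \<open>The polynomials with coefficients in \<open>FL 1\<close>, the field with \<open>Q\<close> elements.\<close>
definition KX :: "'e poly set" where "KX = {g. \<forall>i. coeff g i \<in> FL 1}"

definition frobp :: "'e poly \<Rightarrow> 'e poly" where "frobp = map_poly (\<lambda>c. c ^ Q)"

lemma coeff_frobp [simp]: "coeff (frobp g) i = coeff g i ^ Q"
  using Q_gt_1 by (simp add: frobp_def coeff_map_poly power_0_left)

lemma KX_iff: "g \<in> KX \<longleftrightarrow> frobp g = g"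
  by (auto simp: KX_def FL_def poly_eq_iff)

lemma frobp_add: "frobp (g + h) = frobp g + frobp h"
  using frob_add[of _ _ 1] by (simp add: poly_eq_iff)

lemma frobp_diff: "frobp (g - h) = frobp g - frobp h"
  using frob_diff[of _ _ 1] by (simp add: poly_eq_iff)

lemma frobp_mult: "frobp (g * h) = frobp g * frobp h"
  using frob_sum[of _ "{..(_::nat)}" 1] by (simp add: poly_eq_iff coeff_mult power_mult_distrib)

lemma frobp_1 [simp]: "frobp 1 = 1"
  by (simp add: poly_eq_iff) (use Q_gt_1 in \<open>auto simp: coeff_1 power_0_left\<close>)

lemma frobp_prod: "frobp (prod f A) = (\<Prod>x\<in>A. frobp (f x))"
  by (induction A rule: infinite_finite_induct) (auto simp: frobp_mult)

lemma frobp_power: "frobp (f ^ n) = frobp f ^ n"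
  by (induction n) (auto simp: frobp_mult)

lemma frobp_linear: "frobp [:- a, 1:] = [:- (a ^ Q), 1:]"
  using frob_uminus[of a 1] Q_gt_1 by (simp add: poly_eq_iff coeff_pCons split: nat.split)

lemma degree_frobp [simp]: "degree (frobp g) = degree g"
  unfolding frobp_def by (rule degree_map_poly) (use Q_gt_1 in auto)

lemma poly_frobp: "poly (frobp g) (x ^ Q) = poly g x ^ Q"
proof -
  have "poly g x ^ Q = (\<Sum>i\<le>degree g. (coeff g i * x ^ i) ^ Q)"
    using frob_sum[of _ _ 1] by (simp add: poly_altdef)
  then show ?thesis by (simp add: poly_altdef power_mult_distrib mult.commute flip: power_mult)
qed

lemma KX_closed:
  "0 \<in> KX" "1 \<in> KX" "g \<in> KX \<Longrightarrow> h \<in> KX \<Longrightarrow> g + h \<in> KX" "g \<in> KX \<Longrightarrow> h \<in> KX \<Longrightarrow> g - h \<in> KX"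
  "g \<in> KX \<Longrightarrow> h \<in> KX \<Longrightarrow> g * h \<in> KX" "g \<in> KX \<Longrightarrow> g ^ n \<in> KX"
  using Q_gt_1 by (simp_all add: KX_iff frobp_add frobp_diff frobp_mult frobp_power) (simp add: poly_eq_iff power_0_left)

lemma KX_prod: "(\<And>x. x \<in> A \<Longrightarrow> f x \<in> KX) \<Longrightarrow> prod f A \<in> KX"
  by (simp add: KX_iff frobp_prod)

lemma KX_smult: "c \<in> FL 1 \<Longrightarrow> g \<in> KX \<Longrightarrow> smult c g \<in> KX"
  by (simp add: KX_def FL_closed)

lemma KX_cancel: "h * u \<in> KX \<Longrightarrow> h \<in> KX \<Longrightarrow> h \<noteq> 0 \<Longrightarrow> u \<in> KX"
  by (simp add: KX_iff frobp_mult)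

text \<open>Quotient and remainder are unique, and applying \<open>frobp\<close> to a division with
  remainder by \<open>R\<close> gives another one.\<close>

lemma KX_divmod:
  assumes "g \<in> KX" "R \<in> KX" "R \<noteq> 0"
  shows "g div R \<in> KX" "g mod R \<in> KX"
proof -
  have "g = R * (g div R) + g mod R" by simp
  then have e: "frobp g = frobp R * frobp (g div R) + frobp (g mod R)" by (metis frobp_add frobp_mult)
  have "frobp (g mod R) div R = 0"
  proof (cases "g mod R = 0")
    case True
    then show ?thesis by (metis KX_closed(1) KX_iff div_0)
  next
    case False
    then have "degree (g mod R) < degree R" using degree_mod_less[of R g] assms(3) by auto
    then show ?thesis by (simp add: div_poly_less)
  qed
  moreover have e': "g = R * frobp (g div R) + frobp (g mod R)" using e assms by (simp add: KX_iff)
  ultimately have d: "g div R = frobp (g div R)" using assms(3)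
    by (metis add.right_neutral add.commute div_mult_self2)
  then have "g mod R = frobp (g mod R)"
    using e' by (metis add_left_cancel mult_div_mod_eq)
  then show "g div R \<in> KX" "g mod R \<in> KX" using d by (simp_all add: KX_iff)
qed

lemma poly_frob: "g \<in> KX \<Longrightarrow> poly g (x ^ (Q ^ t)) = poly g x ^ (Q ^ t)"
proof (induction t)
  case (Suc t)
  have "poly g ((x ^ (Q ^ t)) ^ Q) = poly g (x ^ (Q ^ t)) ^ Q"
    using poly_frobp[of g "x ^ (Q ^ t)"] Suc by (simp add: KX_iff)
  then show ?case using Suc by (simp add: mult.commute flip: power_mult)
qed simp

lemma poly_in_FL: "g \<in> KX \<Longrightarrow> x \<in> FL i \<Longrightarrow> poly g x \<in> FL i"
  by (metis FL_iff poly_frob)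

text \<open>Applying \<open>frobp\<close> moves a root to its conjugate and keeps its
  multiplicity.\<close>

lemma linear_power_dvd_frob: "g \<in> KX \<Longrightarrow> [:- a, 1:] ^ e dvd g \<Longrightarrow> [:- (a ^ (Q ^ t)), 1:] ^ e dvd g"
proof (induction t)
  case (Suc t)
  then obtain u where u: "g = [:- (a ^ (Q ^ t)), 1:] ^ e * u" by (auto elim: dvdE)
  have "g = frobp g" using Suc by (simp add: KX_iff)
  also have "\<dots> = [:- ((a ^ (Q ^ t)) ^ Q), 1:] ^ e * frobp u"
    by (subst u) (simp add: frobp_mult frobp_power frobp_linear)
  finally have "[:- ((a ^ (Q ^ t)) ^ Q), 1:] ^ e dvd g" by (metis dvd_triv_left)
  then show ?case by (simp add: mult.commute flip: power_mult)
qed simp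

text \<open>For \<open>a\<close> in \<open>FL i\<close> with i > 0, this is the characteristic
  polynomial of \<open>a\<close> in the extension of degree \<open>i\<close>. Its repetitions of
  conjugates encode how often the minimal polynomial is repeated.\<close>

definition CP :: "'e \<Rightarrow> nat \<Rightarrow> 'e poly" where "CP a i = (\<Prod>t<i. [:- (a ^ (Q ^ t)), 1:])"

lemma CP_KX: "a \<in> FL i \<Longrightarrow> CP a i \<in> KX"
proof -
  assume a: "a \<in> FL i"
  show ?thesis
  proof (cases i)
    case (Suc m)
    have "frobp (CP a i) = (\<Prod>t<Suc m. [:- (a ^ (Q ^ Suc t)), 1:])"
      unfolding CP_def frobp_prod Suc
      by (intro prod.cong refl) (simp add: frobp_linear mult.commute flip: power_mult)
    also have "\<dots> = (\<Prod>t<m. [:- (a ^ (Q ^ Suc t)), 1:]) * [:- (a ^ (Q ^ 0)), 1:]"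
      using a by (simp add: Suc FL_iff)
    also have "\<dots> = CP a i" by (simp only: CP_def Suc prod.lessThan_Suc_shift o_def mult.commute)
    finally show ?thesis by (simp add: KX_iff)
  qed (simp add: CP_def KX_closed)
qed

lemma CP_nz [simp]: "CP a i \<noteq> 0" by (simp add: CP_def)

lemma degree_CP [simp]: "degree (CP a i) = i"
  by (simp add: CP_def degree_prod_sum_eq)

lemma lead_coeff_CP: "lead_coeff (CP a i) = 1"
  by (simp add: CP_def lead_coeff_prod)

end

section \<open>L-functions of characters\<close>

lemma prod_linear_powers_dvd:
  fixes g :: "'e::alg_closed_field poly"
  assumes "finite I" "inj_on b I" "g \<noteq> 0" "\<And>t. t \<in> I \<Longrightarrow> [:- b t, 1:] ^ e dvd g"
  shows "(\<Prod>t\<in>I. [:- b t, 1:] ^ e) dvd g"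
proof (rule dvd_if_proots_subset)
  show "proots (\<Prod>t\<in>I. [:- b t, 1:] ^ e) \<subseteq># proots g"
  proof (rule mset_subset_eqI)
    fix x
    have "count (proots (\<Prod>t\<in>I. [:- b t, 1:] ^ e)) x = (\<Sum>t\<in>I. if b t = x then e else 0)"
      by (subst proots_prod) (auto simp: proots_power count_sum intro!: sum.cong)
    also have "\<dots> \<le> count (proots g) x"
    proof (cases "\<exists>t\<in>I. b t = x")
      case True
      then obtain t where t: "t \<in> I" "b t = x" by auto
      have "(\<Sum>t\<in>I. if b t = x then e else 0) = (\<Sum>s\<in>I. if s = t then e else 0)"
        using t assms(2) by (intro sum.cong) (auto dest: inj_onD)
      also have "\<dots> \<le> order x g" using t(1) assms(1,3) assms(4)[OF t(1)] by (simp add: order_divides flip: t(2))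
      finally show ?thesis using assms(3) by simp
    next
      case False
      then have "(\<Sum>t\<in>I. if b t = x then e else 0) = 0" by (intro sum.neutral) auto
      then show ?thesis by simp
    qed
    finally show "count (proots (\<Prod>t\<in>I. [:- b t, 1:] ^ e)) x \<le> count (proots g) x" .
  qed
qed (use assms in auto)

context frobenius begin

lemma frob_eq_imp_FL: "s \<le> t \<Longrightarrow> a ^ (Q ^ s) = a ^ (Q ^ t) \<Longrightarrow> a \<in> FL (t - s)"
proof -
  assume "s \<le> t" "a ^ (Q ^ s) = a ^ (Q ^ t)"
  then have "(a ^ (Q ^ (t - s))) ^ (Q ^ s) = a ^ (Q ^ s)" by (simp add: frob_frob)
  then show ?thesis by (simp only: frob_inj FL_iff)
qed

lemma root_in_FL:
  assumes "g \<in> KX" "g \<noteq> 0" "poly g a = 0"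
  shows "\<exists>i>0. a \<in> FL i"
proof -
  have "range (\<lambda>t. a ^ (Q ^ t)) \<subseteq> {x. poly g x = 0}"
    using assms Q_pow_pos by (auto simp: poly_frob power_0_left)
  then have "finite (range (\<lambda>t. a ^ (Q ^ t)))"
    using poly_roots_finite[OF assms(2)] finite_subset by blast
  then have "\<not> inj (\<lambda>t::nat. a ^ (Q ^ t))" using finite_imageD infinite_UNIV_nat by blast
  then obtain s t :: nat where "s \<noteq> t" "a ^ (Q ^ s) = a ^ (Q ^ t)" by (auto simp: inj_def)
  then obtain s t :: nat where "s < t" "a ^ (Q ^ s) = a ^ (Q ^ t)" by (metis linorder_neqE_nat)
  then show ?thesis using frob_eq_imp_FL[of s t a] by (intro exI[of _ "t - s"]) auto
qed

text \<open>If \<open>a\<close> lies in some \<open>FL i\<close> with i > 0, this is its degree over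
  \<open>FL 1\<close>.\<close>

definition period :: "'e \<Rightarrow> nat" where "period a = (LEAST i. i > 0 \<and> a \<in> FL i)"

lemma
  assumes "\<exists>i>0. a \<in> FL i"
  shows period_pos: "period a > 0" and period_FL: "a \<in> FL (period a)"
    and period_dvd: "a \<in> FL i \<longleftrightarrow> period a dvd i"
    and period_inj: "inj_on (\<lambda>t. a ^ (Q ^ t)) {..<period a}"
proof -
  show p: "period a > 0" "a \<in> FL (period a)"
    using LeastI_ex[OF assms] by (auto simp: period_def)
  have least: "period a \<le> i" if "i > 0" "a \<in> FL i" for i
    using that by (simp add: period_def Least_le)
  show "a \<in> FL i \<longleftrightarrow> period a dvd i"
  proof
    assume i: "a \<in> FL i"
    have "a \<in> FL (period a * (i div period a))" using p FL_mono[of "period a" "period a * (i div period a)"] by auto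
    then have "(a ^ (Q ^ (period a * (i div period a)))) ^ (Q ^ (i mod period a)) = a ^ (Q ^ (i mod period a))"
      by (simp add: FL_iff)
    then have "a \<in> FL (i mod period a)" using i by (simp add: frob_frob FL_iff)
    then show "period a dvd i" using least[of "i mod period a"] p
      by (metis mod_less_divisor dvd_eq_mod_eq_0 linorder_not_less neq0_conv)
  qed (use FL_mono p in auto)
  show "inj_on (\<lambda>t. a ^ (Q ^ t)) {..<period a}"
  proof (rule linorder_inj_onI)
    fix s t assume st: "s < t" "t \<in> {..<period a}"
    show "a ^ (Q ^ s) \<noteq> a ^ (Q ^ t)"
      using frob_eq_imp_FL[of s t a] least[of "t - s"] st by auto
  qed auto
qed

lemma CP_add: "CP a (m + n) = CP a m * CP (a ^ (Q ^ m)) n"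
  unfolding CP_def by (induction n) (auto simp: frob_frob mult_ac simp del: mult_pCons_right mult_pCons_left)

lemma CP_0 [simp]: "CP a 0 = 1" by (simp add: CP_def)

lemma CP_mult: "a \<in> FL m \<Longrightarrow> CP a (m * e) = CP a m ^ e"
  by (induction e) (auto simp: CP_add FL_iff)

lemma poly_CP: "i > 0 \<Longrightarrow> poly (CP a i) a = 0"
  by (auto simp: CP_def poly_prod intro!: bexI[of _ 0])

text \<open>The admissible \<open>i\<close> are multiples e * \<open>period a\<close>, for which
  \<open>CP a i\<close> is the e-th power of the minimal polynomial of \<open>a\<close>. Such a
  power divides \<open>g\<close> exactly when \<open>e\<close> is at most the multiplicity of the
  root, and \<open>j\<close> is large enough to include all of them.\<close>

lemma card_CP_dvd:
  assumes g: "g \<in> KX" "g \<noteq> 0" and "degree g \<le> j"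
  shows "card {i\<in>{1..j}. a \<in> FL i \<and> CP a i dvd g} = order a g"
proof (cases "poly g a = 0")
  case False
  have "\<not> CP a i dvd g" if "i \<in> {1..j}" for i
    using False poly_CP[of i a] that by (auto elim!: dvdE)
  then have e: "{i\<in>{1..j}. a \<in> FL i \<and> CP a i dvd g} = {}" by blast
  show ?thesis unfolding e using False by (simp add: order_0I)
next
  case True
  note ex = root_in_FL[OF g True]
  define \<delta> where "\<delta> = period a"
  note \<delta> = period_pos[OF ex, folded \<delta>_def] period_FL[OF ex, folded \<delta>_def] period_dvd[OF ex, folded \<delta>_def]
    period_inj[OF ex, folded \<delta>_def]
  have iff: "CP a \<delta> ^ e dvd g \<longleftrightarrow> e \<le> order a g" for e
  proof
    assume "CP a \<delta> ^ e dvd g"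
    moreover have "[:- (a ^ (Q ^ 0)), 1:] dvd CP a \<delta>"
      unfolding CP_def using \<delta>(1) by (intro dvd_prodI) auto
    then have "[:- a, 1:] ^ e dvd CP a \<delta> ^ e" by (intro dvd_power_same) simp
    ultimately have "[:- a, 1:] ^ e dvd g" by (rule dvd_trans[rotated])
    then show "e \<le> order a g" using g(2) by (simp add: order_divides)
  next
    assume "e \<le> order a g"
    then have "[:- a, 1:] ^ e dvd g" by (simp add: order_divides)
    then have "(\<Prod>t<\<delta>. [:- (a ^ (Q ^ t)), 1:] ^ e) dvd g"
      using g \<delta>(4) by (intro prod_linear_powers_dvd linear_power_dvd_frob) auto
    then show "CP a \<delta> ^ e dvd g" by (simp add: CP_def prod_power_distrib)
  qed
  have "{i\<in>{1..j}. a \<in> FL i \<and> CP a i dvd g} = (\<lambda>e. \<delta> * e) ` {1..order a g}"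
  proof (intro equalityI subsetI)
    fix i assume i: "i \<in> {i\<in>{1..j}. a \<in> FL i \<and> CP a i dvd g}"
    then obtain e where e: "i = \<delta> * e" using \<delta>(3) by (auto elim: dvdE)
    then have "e \<le> order a g" using i iff[of e] CP_mult[OF \<delta>(2), of e] by auto
    moreover have "1 \<le> e" using i e by (cases e) auto
    ultimately show "i \<in> (\<lambda>e. \<delta> * e) ` {1..order a g}" using e by (intro image_eqI[of _ _ e]) auto
  next
    fix i assume "i \<in> (\<lambda>e. \<delta> * e) ` {1..order a g}"
    then obtain e where "i = \<delta> * e" "e \<in> {1..order a g}" by (elim imageE)
    then have e: "i = \<delta> * e" "1 \<le> e" "e \<le> order a g" by auto
    have d: "CP a i dvd g" using iff[of e] e CP_mult[OF \<delta>(2), of e] by simp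
    then have "i \<le> degree g" using dvd_imp_degree_le[OF d g(2)] by simp
    then show "i \<in> {i\<in>{1..j}. a \<in> FL i \<and> CP a i dvd g}"
      using e d assms(3) \<delta> by auto
  qed
  moreover have "card ((\<lambda>e. \<delta> * e) ` {1..order a g}) = order a g"
    using \<delta>(1) by (subst card_image) (auto simp: inj_on_def)
  ultimately show ?thesis by simp
qed

definition KL :: "nat \<Rightarrow> 'e poly set" where "KL n = {g \<in> KX. \<forall>i\<ge>n. coeff g i = 0}"
definition MF :: "nat \<Rightarrow> 'e poly set" where "MF j = {g \<in> KX. degree g = j \<and> lead_coeff g = 1}"

lemma KL_card: "finite (KL n)" "card (KL n) = Q ^ n"
proof -
  have "bij_betw (\<lambda>g. \<lambda>i\<in>{..<n}. coeff g i) (KL n) ({..<n} \<rightarrow>\<^sub>E FL 1)"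
  proof (rule bij_betw_byWitness[where f' = "\<lambda>f. \<Sum>i<n. Polynomial.monom (f i) i"])
    have c: "coeff (\<Sum>i<n. Polynomial.monom (f i) i) k = (if k < n then f k else 0)" for f :: "nat \<Rightarrow> 'e" and k
      by (simp add: coeff_sum sum.delta')
    show "\<forall>g\<in>KL n. (\<Sum>i<n. Polynomial.monom ((\<lambda>i\<in>{..<n}. coeff g i) i) i) = g"
      by (auto simp: poly_eq_iff c KL_def)
    show "\<forall>f\<in>{..<n} \<rightarrow>\<^sub>E FL 1. (\<lambda>i\<in>{..<n}. coeff (\<Sum>i<n. Polynomial.monom (f i) i) i) = f"
      by (auto simp: c fun_eq_iff PiE_def extensional_def)
    show "(\<lambda>g. \<lambda>i\<in>{..<n}. coeff g i) ` KL n \<subseteq> {..<n} \<rightarrow>\<^sub>E FL 1"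
    proof (rule image_subsetI)
      fix g assume "g \<in> KL n"
      then have "coeff g i \<in> FL 1" for i by (simp add: KL_def KX_def)
      then show "(\<lambda>i\<in>{..<n}. coeff g i) \<in> {..<n} \<rightarrow>\<^sub>E FL 1" by (intro PiE_I) (simp_all add: restrict_def)
    qed
    show "(\<lambda>f. \<Sum>i<n. Polynomial.monom (f i) i) ` ({..<n} \<rightarrow>\<^sub>E FL 1) \<subseteq> KL n"
    proof (rule image_subsetI)
      fix f assume f: "f \<in> {..<n} \<rightarrow>\<^sub>E FL 1"
      have "(if k < n then f k else 0) \<in> FL 1" for k using PiE_mem[OF f, of k] FL_closed(1)[of 1] by simp
      then show "(\<Sum>i<n. Polynomial.monom (f i) i) \<in> KL n" unfolding KL_def KX_def mem_Collect_eq c by simp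
    qed
  qed
  moreover have "finite ({..<n} \<rightarrow>\<^sub>E FL 1)" using finite_FL[of 1] by (intro finite_PiE) auto
  moreover have "card ({..<n} \<rightarrow>\<^sub>E FL 1) = Q ^ n" using card_FL[of 1] by (simp add: card_PiE)
  ultimately show "finite (KL n)" "card (KL n) = Q ^ n"
    by (auto dest: bij_betw_same_card bij_betw_finite)
qed

lemma MF_I: "g \<in> KX \<Longrightarrow> degree g = j \<Longrightarrow> lead_coeff g = 1 \<Longrightarrow> g \<in> MF j"
  and MF_D: "g \<in> MF j \<Longrightarrow> g \<in> KX" "g \<in> MF j \<Longrightarrow> degree g = j" "g \<in> MF j \<Longrightarrow> lead_coeff g = 1"
  by (auto simp only: MF_def mem_Collect_eq)

lemma lead_coeff_CP_mult: "lead_coeff (CP a i * h) = lead_coeff h"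
  by (simp only: lead_coeff_mult lead_coeff_CP mult_1)

lemma MF_subset: "MF j \<subseteq> KL (Suc j)"
  by (auto simp: MF_def KL_def coeff_eq_0)

lemma finite_MF [simp]: "finite (MF j)"
  using MF_subset KL_card(1) finite_subset by blast

lemma MF_nz: "g \<in> MF j \<Longrightarrow> g \<noteq> 0" by (auto simp: MF_def)

lemma KL_iff: "g \<in> KL n \<longleftrightarrow> g \<in> KX \<and> (g = 0 \<or> degree g < n)"
proof -
  have "(\<forall>i\<ge>n. coeff g i = 0) \<longleftrightarrow> g = 0 \<or> degree g < n"
  proof
    assume "\<forall>i\<ge>n. coeff g i = 0"
    then show "g = 0 \<or> degree g < n" using leading_coeff_neq_0[of g] by (cases "degree g < n") (auto simp: not_less)
  qed (auto simp: coeff_eq_0)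
  then show ?thesis by (auto simp: KL_def)
qed

text \<open>The analogue for polynomials of summing the von Mangoldt function over the divisors of n
  to get log n: every root of \<open>g\<close> contributes its multiplicity.\<close>

lemma sum_card_CP_dvd:
  assumes "g \<in> MF j"
  shows "(\<Sum>i=1..j. card {a \<in> FL i. CP a i dvd g}) = j"
proof -
  have g: "g \<in> KX" "g \<noteq> 0" "degree g = j" using assms by (auto simp: MF_def)
  let ?P = "\<lambda>i a. a \<in> FL i \<and> CP a i dvd g"
  let ?Z = "{x. poly g x = 0}"
  have fin: "finite ?Z" using g poly_roots_finite by auto
  have "card {a \<in> FL i. CP a i dvd g} = (\<Sum>a\<in>?Z. if ?P i a then 1 else 0)" if "i \<in> {1..j}" for i
  proof -
    have "{a \<in> FL i. CP a i dvd g} = {a \<in> ?Z. ?P i a}"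
      using poly_CP[of i] that by (auto elim!: dvdE)
    then show ?thesis by (simp only: card_eq_sum sum.inter_filter[OF fin])
  qed
  then have "(\<Sum>i=1..j. card {a \<in> FL i. CP a i dvd g}) = (\<Sum>i=1..j. \<Sum>a\<in>?Z. if ?P i a then 1 else 0)"
    by (intro sum.cong) auto
  also have "\<dots> = (\<Sum>a\<in>?Z. \<Sum>i=1..j. if ?P i a then 1 else 0)" by (rule sum.swap)
  also have "\<dots> = (\<Sum>a\<in>?Z. card {i\<in>{1..j}. ?P i a})"
    by (simp only: card_eq_sum sum.inter_filter[OF finite_atLeastAtMost])
  also have "\<dots> = (\<Sum>a\<in>?Z. order a g)" using card_CP_dvd[OF g(1,2)] g(3) by (intro sum.cong) auto
  also have "\<dots> = size (proots g)" using g by (simp add: size_multiset_overloaded_eq)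
  finally show ?thesis using alg_closed_proots(2)[OF g(2)] g(3) by simp
qed

lemma MF_multiples:
  assumes "a \<in> FL i" "i \<le> j"
  shows "bij_betw (\<lambda>h. CP a i * h) (MF (j - i)) {g \<in> MF j. CP a i dvd g}"
  unfolding bij_betw_def
proof (intro conjI equalityI subsetI)
  show "inj_on (\<lambda>h. CP a i * h) (MF (j - i))" by (auto simp: inj_on_def)
next
  fix g assume "g \<in> (\<lambda>h. CP a i * h) ` MF (j - i)"
  then obtain h where h: "h \<in> MF (j - i)" "g = CP a i * h" by auto
  have "lead_coeff g = 1" unfolding h(2) lead_coeff_CP_mult by (rule MF_D[OF h(1)])
  moreover have "degree g = j" using assms MF_nz[OF h(1)] MF_D[OF h(1)] by (simp add: h(2) degree_mult_eq)
  moreover have "g \<in> KX" unfolding h(2) using assms MF_D[OF h(1)] by (intro KX_closed CP_KX)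
  ultimately show "g \<in> {g \<in> MF j. CP a i dvd g}" by (simp add: MF_I h(2))
next
  fix g assume g: "g \<in> {g \<in> MF j. CP a i dvd g}"
  then obtain h where h: "g = CP a i * h" by (auto elim: dvdE)
  have gj: "g \<in> MF j" using g by simp
  have "h \<noteq> 0" using MF_nz[OF gj] h by auto
  then have "degree h = j - i" using MF_D(2)[OF gj] assms by (simp add: h degree_mult_eq)
  moreover have "h \<in> KX" using KX_cancel[of "CP a i" h] MF_D(1)[OF gj] CP_KX[OF assms(1)] by (simp add: h)
  moreover have "lead_coeff h = 1" using MF_D(3)[OF gj] unfolding h lead_coeff_CP_mult .
  ultimately show "g \<in> (\<lambda>h. CP a i * h) ` MF (j - i)" using h by (intro image_eqI MF_I)
qed

text \<open>Here \<open>CP a i\<close> is a power of the minimal polynomial of \<open>a\<close>; counting its multiples replaces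
  the Euler product.\<close>
lemma newton_identity:
  fixes \<psi> :: "'e poly \<Rightarrow> 'c::comm_ring_1"
  assumes mult: "\<And>g h. g \<in> KX \<Longrightarrow> h \<in> KX \<Longrightarrow> \<psi> (g * h) = \<psi> g * \<psi> h"
  shows "of_nat j * (\<Sum>g\<in>MF j. \<psi> g) = (\<Sum>i=1..j. (\<Sum>a\<in>FL i. \<psi> (CP a i)) * (\<Sum>g\<in>MF (j - i). \<psi> g))"
proof -
  have "of_nat j * (\<Sum>g\<in>MF j. \<psi> g) = (\<Sum>g\<in>MF j. of_nat (\<Sum>i=1..j. card {a \<in> FL i. CP a i dvd g}) * \<psi> g)"
    unfolding sum_distrib_left by (intro sum.cong refl) (simp only: sum_card_CP_dvd)
  also have "\<dots> = (\<Sum>g\<in>MF j. \<Sum>i=1..j. \<Sum>a\<in>FL i. if CP a i dvd g then \<psi> g else 0)"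
  proof (intro sum.cong refl)
    fix g
    have "of_nat (card {a \<in> FL i. CP a i dvd g}) * \<psi> g = (\<Sum>a\<in>FL i. if CP a i dvd g then \<psi> g else 0)" if "i > 0" for i
      using finite_FL[OF that] by (simp flip: sum.inter_filter)
    then show "of_nat (\<Sum>i=1..j. card {a \<in> FL i. CP a i dvd g}) * \<psi> g = (\<Sum>i=1..j. \<Sum>a\<in>FL i. if CP a i dvd g then \<psi> g else 0)"
      by (simp add: sum_distrib_right)
  qed
  also have "\<dots> = (\<Sum>i=1..j. \<Sum>g\<in>MF j. \<Sum>a\<in>FL i. if CP a i dvd g then \<psi> g else 0)" by (rule sum.swap)
  also have "\<dots> = (\<Sum>i=1..j. \<Sum>a\<in>FL i. \<Sum>g\<in>MF j. if CP a i dvd g then \<psi> g else 0)"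
    by (intro sum.cong refl sum.swap)
  also have "\<dots> = (\<Sum>i=1..j. \<Sum>a\<in>FL i. \<psi> (CP a i) * (\<Sum>g\<in>MF (j - i). \<psi> g))"
  proof (intro sum.cong refl)
    fix i a assume i: "i \<in> {1..j}" and a: "a \<in> FL i"
    have "(\<Sum>g\<in>MF j. if CP a i dvd g then \<psi> g else 0) = (\<Sum>g\<in>{g \<in> MF j. CP a i dvd g}. \<psi> g)"
      by (simp add: sum.inter_filter)
    also have "\<dots> = (\<Sum>h\<in>MF (j - i). \<psi> (CP a i * h))"
      using sum.reindex_bij_betw[OF MF_multiples[OF a], of j \<psi>] i by simp
    also have "\<dots> = \<psi> (CP a i) * (\<Sum>g\<in>MF (j - i). \<psi> g)"
      unfolding sum_distrib_left using CP_KX[OF a] by (intro sum.cong mult) (auto simp: MF_def)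
    finally show "(\<Sum>g\<in>MF j. if CP a i dvd g then \<psi> g else 0) = \<psi> (CP a i) * (\<Sum>g\<in>MF (j - i). \<psi> g)" .
  qed
  finally show ?thesis by (simp add: sum_distrib_right)
qed

end

text \<open>A Dirichlet character modulo \<open>R\<close> on polynomials over \<open>FL 1\<close>,
  trivial on nonzero constants. The last assumption says that \<open>g0\<close> can be cancelled
  modulo \<open>R\<close>; together with \<open>\<psi> g0 \<noteq> 1\<close> it expresses that the
  character is nontrivial.\<close>

locale frobenius_character = frobenius Q ty for Q and ty :: "'e::alg_closed_field itself" +
  fixes \<psi> :: "'e poly \<Rightarrow> complex" and R g0 :: "'e poly"
  assumes R: "R \<in> KX" "lead_coeff R = 1" "degree R > 0"
    and mult: "\<And>g h. g \<in> KX \<Longrightarrow> h \<in> KX \<Longrightarrow> \<psi> (g * h) = \<psi> g * \<psi> h"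
    and modR: "\<And>g h. g \<in> KX \<Longrightarrow> h \<in> KX \<Longrightarrow> R dvd g - h \<Longrightarrow> \<psi> g = \<psi> h"
    and \<psi>0: "\<psi> 0 = 0" and \<psi>1: "\<psi> 1 = 1"
    and const: "\<And>c. c \<in> FL 1 \<Longrightarrow> c \<noteq> 0 \<Longrightarrow> \<psi> [:c:] = 1"
    and g0: "g0 \<in> KX" "\<psi> g0 \<noteq> 1" "\<And>r. r \<in> KX \<Longrightarrow> R dvd g0 * r \<Longrightarrow> R dvd r"
begin

text \<open>Multiplication by \<open>g0\<close> permutes the residues modulo \<open>R\<close> and
  multiplies the sum by \<open>\<psi> g0\<close>, which is not 1.\<close>

lemma sum_residues: "(\<Sum>r\<in>KL (degree R). \<psi> r) = 0"
proof -
  let ?N = "degree R"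
  have Rnz: "R \<noteq> 0" using R by auto
  let ?f = "\<lambda>r. (g0 * r) mod R"
  have fKX: "?f r \<in> KX" if "r \<in> KX" for r using that g0 R Rnz by (intro KX_divmod KX_closed)
  have into: "?f ` KL ?N \<subseteq> KL ?N"
    using fKX degree_mod_less[OF Rnz] by (auto simp: KL_iff)
  have inj: "inj_on ?f (KL ?N)"
  proof (rule inj_onI)
    fix r s assume rs: "r \<in> KL ?N" "s \<in> KL ?N" "?f r = ?f s"
    then have "R dvd g0 * (r - s)" by (simp add: mod_eq_dvd_iff right_diff_distrib)
    then have "R dvd r - s" using g0(3)[of "r - s"] rs by (simp add: KL_def KX_closed)
    moreover have "r - s \<in> KL ?N" using rs by (auto simp: KL_def KX_closed)
    ultimately have "r - s = 0" using dvd_imp_degree_le[of R "r - s"] by (fastforce simp only: KL_iff not_le[symmetric])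
    then show "r = s" by simp
  qed
  have "bij_betw ?f (KL ?N) (KL ?N)"
    using inj endo_inj_surj[OF KL_card(1) into inj] by (simp add: bij_betw_def)
  then have "(\<Sum>r\<in>KL ?N. \<psi> r) = (\<Sum>r\<in>KL ?N. \<psi> (?f r))" by (rule sum.reindex_bij_betw[symmetric])
  also have "\<dots> = (\<Sum>r\<in>KL ?N. \<psi> g0 * \<psi> r)"
  proof (intro sum.cong refl)
    fix r assume "r \<in> KL ?N"
    then have r: "r \<in> KX" by (simp add: KL_def)
    have "\<psi> (?f r) = \<psi> (g0 * r)"
      using fKX[OF r] g0(1) r by (intro modR) (auto simp: KX_closed mod_eq_dvd_iff[symmetric])
    then show "\<psi> (?f r) = \<psi> g0 * \<psi> r" using mult[OF g0(1) r] by simp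
  qed
  also have "\<dots> = \<psi> g0 * (\<Sum>r\<in>KL ?N. \<psi> r)" by (rule sum_distrib_left[symmetric])
  finally have "(\<Sum>r\<in>KL ?N. \<psi> r) = \<psi> g0 * (\<Sum>r\<in>KL ?N. \<psi> r)" .
  then have "(\<psi> g0 - 1) * (\<Sum>r\<in>KL ?N. \<psi> r) = 0" by (simp only: left_diff_distrib mult_1) simp
  then show ?thesis using g0(2) by simp
qed

text \<open>Division by \<open>R\<close> runs through a full residue system once for each monic
  quotient. This is why the L-function is a polynomial of degree below
  \<open>degree R\<close>.\<close>

lemma sum_MF_high:
  assumes "j \<ge> degree R"
  shows "(\<Sum>g\<in>MF j. \<psi> g) = 0"
proof -
  let ?N = "degree R"
  have Rnz: "R \<noteq> 0" using R by auto
  let ?f = "\<lambda>(h, r). R * h + r"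
  have degf: "degree (R * h + r) = j \<and> lead_coeff (R * h + r) = 1" if "h \<in> MF (j - ?N)" "r \<in> KL ?N" for h r
  proof -
    have d: "degree (R * h) = j" using assms MF_nz[OF that(1)] MF_D(2)[OF that(1)] Rnz by (simp add: degree_mult_eq)
    have "lead_coeff (R * h) = 1" by (simp only: lead_coeff_mult R(2) MF_D(3)[OF that(1)] mult_1)
    then have c: "coeff (R * h) j = 1" unfolding d .
    have dr: "degree r < j" using that R(3) assms by (auto simp: KL_iff)
    then have "degree (R * h + r) = j" using degree_add_eq_left[of r "R * h"] d by simp
    then show ?thesis using c dr by (simp add: coeff_eq_0)
  qed
  have "bij_betw ?f (MF (j - ?N) \<times> KL ?N) (MF j)"
    unfolding bij_betw_def
  proof (intro conjI equalityI subsetI)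
    show "inj_on ?f (MF (j - ?N) \<times> KL ?N)"
    proof (rule inj_onI, clarify)
      fix h r h' r' assume a: "h \<in> MF (j - ?N)" "r \<in> KL ?N" "h' \<in> MF (j - ?N)" "r' \<in> KL ?N" "R * h + r = R * h' + r'"
      have m: "(R * h + r) mod R = r" if "r \<in> KL ?N" for h r
        using that by (auto simp: KL_iff mod_poly_less)
      have "r = r'" using a m by metis
      then show "h = h' \<and> r = r'" using a Rnz by simp
    qed
  next
    fix g assume "g \<in> ?f ` (MF (j - ?N) \<times> KL ?N)"
    then obtain h r where hr: "g = R * h + r" "h \<in> MF (j - ?N)" "r \<in> KL ?N" by auto
    have "r \<in> KX" using hr(3) by (simp add: KL_def)
    then show "g \<in> MF j" using degf[OF hr(2,3)] R(1) MF_D(1)[OF hr(2)] unfolding hr(1)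
      by (intro MF_I KX_closed) auto
  next
    fix g assume g: "g \<in> MF j"
    define h r where "h = g div R" and "r = g mod R"
    have gr: "g = R * h + r" by (simp add: h_def r_def)
    have K: "h \<in> KX" "r \<in> KX" using KX_divmod[OF MF_D(1)[OF g] R(1) Rnz] by (simp_all add: h_def r_def)
    have r: "r \<in> KL ?N" using degree_mod_less[OF Rnz, of g] K by (auto simp: KL_iff r_def)
    then have dr: "degree r < ?N" using R(3) by (auto simp: KL_iff)
    have "h \<noteq> 0"
    proof
      assume "h = 0"
      then have "degree g < ?N" using gr dr by simp
      then show False using MF_D(2)[OF g] assms by simp
    qed
    then have dRh: "degree (R * h) = ?N + degree h" using Rnz by (simp add: degree_mult_eq)
    then have dg: "degree g = ?N + degree h" using gr dr degree_add_eq_left[of r "R * h"] by simp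
    have "lead_coeff (R * h) = lead_coeff h" by (simp only: lead_coeff_mult R(2) mult_1)
    moreover have "lead_coeff g = coeff (R * h) (degree (R * h))"
      unfolding dg dRh using dr by (subst gr) (simp add: coeff_eq_0)
    ultimately have "lead_coeff h = 1" using MF_D(3)[OF g] by (simp only:)
    then have "h \<in> MF (j - ?N)" using K dg MF_D(2)[OF g] by (intro MF_I) auto
    then show "g \<in> ?f ` (MF (j - ?N) \<times> KL ?N)" using gr r by (intro image_eqI[of _ _ "(h, r)"]) auto
  qed
  then have "(\<Sum>g\<in>MF j. \<psi> g) = (\<Sum>x\<in>MF (j - ?N) \<times> KL ?N. \<psi> (?f x))" by (rule sum.reindex_bij_betw[symmetric])
  also have "\<dots> = (\<Sum>x\<in>MF (j - ?N) \<times> KL ?N. \<psi> (snd x))"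
    by (intro sum.cong refl) (auto intro!: modR simp: R KL_def MF_def KX_closed)
  also have "\<dots> = (\<Sum>h\<in>MF (j - ?N). \<Sum>r\<in>KL ?N. \<psi> r)"
    by (subst sum.cartesian_product) (simp add: case_prod_beta)
  finally show ?thesis by (simp add: sum_residues)
qed

text \<open>Every nonzero residue is a constant times a monic polynomial, and constants do not
  change the character, so the vanishing sum over residues is Q - 1 times the value of the
  L-function at 1. The zero belongs to the place at infinity, where the character is
  unramified.\<close>

lemma trivial_zero: "(\<Sum>j<degree R. \<Sum>g\<in>MF j. \<psi> g) = 0"
proof -
  let ?N = "degree R"
  let ?S = "SIGMA j:{..<?N}. MF j"
  let ?f = "\<lambda>(c, (j :: nat, g)). smult c g"
  have "bij_betw ?f ((FL 1 - {0}) \<times> ?S) (KL ?N - {0})"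
    unfolding bij_betw_def
  proof (intro conjI equalityI subsetI)
    show "inj_on ?f ((FL 1 - {0}) \<times> ?S)"
    proof (rule inj_onI)
      fix x y assume xy: "x \<in> (FL 1 - {0}) \<times> ?S" "y \<in> (FL 1 - {0}) \<times> ?S" "?f x = ?f y"
      obtain c j g c' j' g' where e: "x = (c, j, g)" "y = (c', j', g')" by (metis prod_cases3)
      then have a: "g \<in> MF j" "g' \<in> MF j'" "smult c g = smult c' g'" "c \<noteq> 0" "c' \<noteq> 0" using xy by auto
      have d: "degree g = degree g'" using a by (metis degree_smult_eq)
      have "lead_coeff (smult c g) = c" "lead_coeff (smult c' g') = c'"
        using MF_D(3)[OF a(1)] MF_D(3)[OF a(2)] by (simp_all only: lead_coeff_smult mult_1_right)
      then have "c = c'" using a(3) by simp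
      moreover have "j = j'" using d MF_D(2)[OF a(1)] MF_D(2)[OF a(2)] by simp
      moreover have "smult (inverse c) (smult c g) = smult (inverse c) (smult c' g')" using a(3) by simp
      ultimately show "x = y" using a(4) unfolding e by simp
    qed
  next
    fix x assume "x \<in> ?f ` ((FL 1 - {0}) \<times> ?S)"
    then show "x \<in> KL ?N - {0}" by (auto simp: KL_iff KX_smult MF_def)
  next
    fix x assume x: "x \<in> KL ?N - {0}"
    define c where "c = lead_coeff x"
    define g where "g = smult (inverse c) x"
    have c: "c \<in> FL 1" "c \<noteq> 0" using x by (auto simp: KL_def KX_def c_def)
    have "g \<in> KX" using x c by (simp add: g_def KX_smult FL_closed KL_def)
    moreover have "lead_coeff g = 1" using c(2) by (simp add: g_def c_def)
    ultimately have "g \<in> MF (degree x)" using c(2) by (intro MF_I) (auto simp: g_def)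
    moreover have "degree x < ?N" using x by (auto simp: KL_iff)
    moreover have "x = smult c g" using c by (simp add: g_def)
    ultimately show "x \<in> ?f ` ((FL 1 - {0}) \<times> ?S)" using c by (intro image_eqI[of _ _ "(c, degree x, g)"]) auto
  qed
  then have "(\<Sum>r\<in>KL ?N - {0}. \<psi> r) = (\<Sum>x\<in>(FL 1 - {0}) \<times> ?S. \<psi> (?f x))" by (rule sum.reindex_bij_betw[symmetric])
  also have "\<dots> = (\<Sum>x\<in>(FL 1 - {0}) \<times> ?S. \<psi> (snd (snd x)))"
  proof (intro sum.cong refl)
    fix x assume "x \<in> (FL 1 - {0}) \<times> ?S"
    then obtain c j g where x: "x = (c, j, g)" "c \<in> FL 1" "c \<noteq> 0" "g \<in> KX" by (cases x) (auto simp: MF_def)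
    have K: "[:c:] \<in> KX" using KX_smult[OF x(2) KX_closed(2)] by simp
    have "\<psi> ([:c:] * g) = \<psi> g" using mult[OF K x(4)] const[OF x(2,3)] by simp
    then show "\<psi> (?f x) = \<psi> (snd (snd x))" by (simp add: x(1))
  qed
  also have "\<dots> = (\<Sum>c\<in>FL 1 - {0}. \<Sum>y\<in>?S. \<psi> (snd y))"
    by (subst sum.cartesian_product) (simp add: case_prod_beta)
  also have "(\<Sum>y\<in>?S. \<psi> (snd y)) = (\<Sum>j<?N. \<Sum>g\<in>MF j. \<psi> g)"
    by (subst sum.Sigma) (auto simp: case_prod_beta)
  also have "(\<Sum>c\<in>FL 1 - {0}. (\<Sum>j<?N. \<Sum>g\<in>MF j. \<psi> g)) = of_nat (Q - 1) * (\<Sum>j<?N. \<Sum>g\<in>MF j. \<psi> g)"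
    using card_FL[of 1] finite_FL[of 1] FL_closed(1)[of 1] by simp
  finally have "(\<Sum>r\<in>KL ?N - {0}. \<psi> r) = of_nat (Q - 1) * (\<Sum>j<?N. \<Sum>g\<in>MF j. \<psi> g)" .
  moreover have "(\<Sum>r\<in>KL ?N - {0}. \<psi> r) = 0"
    using sum_residues KL_card(1) by (simp add: sum_diff1 \<psi>0)
  ultimately show ?thesis using Q_gt_1 by simp
qed

lemma MF_0: "MF 0 = {1}"
  by (auto simp: MF_def KX_closed elim!: degree_eq_zeroE)

text \<open>The trivial zero at \<open>1\<close> saves one of the \<open>degree R - 1\<close> inverse roots. Without this saving
  the bound would be too weak for \<open>degree R = q + 2\<close>.\<close>
lemma character_sum_bound:
  assumes B: "B > 0" and r0: "r0 > (0::nat)"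
    and bound: "\<And>r. r0 dvd r \<Longrightarrow> r1 \<le> r \<Longrightarrow> cmod (\<Sum>a\<in>FL r. \<psi> (CP a r)) \<le> C * B ^ r"
  shows "cmod ((\<Sum>a\<in>FL 1. \<psi> (CP a 1)) + 1) \<le> (real (degree R) - 2) * B"
proof -
  let ?n = "degree R"
  define S where "S r = (\<Sum>a\<in>FL r. \<psi> (CP a r))" for r
  define A where "A j = (\<Sum>g\<in>MF j. \<psi> g)" for j
  have A0: "A 0 = 1" by (simp add: A_def MF_0 \<psi>1)
  have Ahigh: "A j = 0" if "j \<ge> ?n" for j using sum_MF_high[OF that] by (simp add: A_def)
  have newton: "of_nat j * A j = (\<Sum>i=1..j. S i * A (j - i))" for j
    unfolding A_def S_def by (rule newton_identity) (rule mult)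
  obtain w where w: "\<And>r. r > 0 \<Longrightarrow> S r = - (\<Sum>i<?n-1. w i ^ r)"
    "\<And>z. (\<Sum>j<?n. A j * z ^ (?n - 1 - j)) = (\<Prod>i<?n-1. (z - w i))"
    using newton_power_sums[OF A0 Ahigh R(3) newton] by auto
  have "(\<Sum>j<?n. A j * 1 ^ (?n - 1 - j)) = 0" using trivial_zero by (simp add: A_def)
  then have "(\<Prod>i<?n-1. (1 - w i)) = 0" using w(2)[of 1] by simp
  then obtain i0 where i0: "i0 < ?n - 1" "w i0 = 1" by auto
  \<comment> \<open>The maximum with 1 is there because the formula for \<open>S r\<close> holds for
    r > 0 only.\<close>
  have wB: "cmod (w i) \<le> B" if "i < ?n - 1" for i
  proof (rule power_sums_bound_imp_norm_bound[OF B r0 _ that, of "max r1 1"])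
    fix r assume r: "r0 dvd r" "max r1 1 \<le> r"
    then have "cmod (S r) \<le> C * B ^ r" using bound[of r] by (simp add: S_def)
    then show "cmod (\<Sum>i<?n-1. w i ^ r) \<le> C * B ^ r" using w(1)[of r] r by simp
  qed
  have "(\<Sum>i<?n-1. w i) = w i0 + (\<Sum>i\<in>{..<?n-1} - {i0}. w i)" using i0 by (intro sum.remove) auto
  then have "S 1 + 1 = - (\<Sum>i\<in>{..<?n-1} - {i0}. w i)" using w(1)[of 1] i0 by simp
  then have "cmod (S 1 + 1) = cmod (\<Sum>i\<in>{..<?n-1} - {i0}. w i)" by simp
  also have "\<dots> \<le> (\<Sum>i\<in>{..<?n-1} - {i0}. B)"
    by (intro sum_norm_le) (use wB in auto)
  also have "\<dots> = real (?n - 1 - 1) * B" using i0 by simp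
  also have "real (?n - 1 - 1) = real ?n - 2" using i0 by linarith
  finally show ?thesis by (simp add: S_def)
qed

end

section \<open>Equidistribution of Kummer classes\<close>

lemma card_roots_of_unity_le:
  assumes "d > 0"
  shows "finite {y::'a::idom. y ^ d = 1}" "card {y::'a::idom. y ^ d = 1} \<le> d"
proof -
  define p :: "'a poly" where "p = Polynomial.monom 1 d - 1"
  have "degree (Polynomial.monom (1::'a) d + - 1) = degree (Polynomial.monom (1::'a) d)"
    using assms by (intro degree_add_eq_left) (simp add: degree_monom_eq)
  then have deg: "degree p = d" by (simp add: p_def degree_monom_eq)
  then have "p \<noteq> 0" using assms by auto
  moreover have "{y. y ^ d = 1} = {y. poly p y = 0}" by (auto simp: p_def poly_monom)
  ultimately show "finite {y::'a. y ^ d = 1}" "card {y::'a. y ^ d = 1} \<le> d"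
    using poly_roots_finite[of p] card_poly_roots_bound[of p] deg by auto
qed

text \<open>The substitution \<open>a = c x0 + 1 / z\<close> moves the root \<open>c x0\<close> to infinity, which makes the degree
  coprime to \<open>d\<close>.\<close>
lemma kummer_class_upper_bound:
  fixes c :: "'x \<Rightarrow> 'e::alg_closed_field"
  assumes char: "prime CHAR('e)" and d: "prime d"
    and J: "finite J" "x0 \<in> J" "\<forall>x\<in>J. x \<noteq> x0 \<longrightarrow> c x \<noteq> c x0"
    and m: "\<not> d dvd m x0" "d dvd (\<Sum>x\<in>J. m x)"
  defines "D \<equiv> (\<Sum>x\<in>J - {x0}. m x)"
  assumes M: "M = CHAR('e) ^ s" "d dvd M - 1" "M > d + d * (d * D + 2) * (d * D + 1) + d * D"
    and c0: "c x0 ^ (M * M) = c x0" and y: "y \<noteq> 0"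
  shows "d * card {a. a ^ (M * M) = a \<and> (\<Prod>x\<in>J. (c x - a) ^ m x) ^ ((M * M - 1) div d) = y}
    \<le> M * M + (d * D + d * (d * D + 2)) * M"
proof -
  define u where "u = (M * M - 1) div d"
  define U where "U a = (\<Prod>x\<in>J. (c x - a) ^ m x)" for a
  define A where "A = {a. a ^ (M * M) = a \<and> U a ^ u = y}"
  have d0: "d > 0" using d prime_gt_0_nat by blast
  have M1: "M > 1" using M(3) d0 by simp
  have "M * M - 1 = (M - 1) * (M + 1)" by (simp add: algebra_simps)
  then have "d dvd M * M - 1" using M(2) by (simp only: dvd_mult2)
  then have ud: "M * M - 1 = d * u" unfolding u_def by (rule dvd_mult_div_cancel[symmetric])
  have MM1: "M * M > 1" using M1 by (rule less_1_mult) (rule M1)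
  have u0: "u > 0" using MM1 ud by (cases "u = 0") auto
  have sum: "(\<Sum>x\<in>J. m x) = m x0 + D" using J by (simp add: D_def sum.remove)
  have cop: "coprime D d"
  proof -
    have "\<not> d dvd D" using m sum by (metis dvd_add_left_iff)
    then show ?thesis using d by (metis prime_imp_coprime coprime_commute)
  qed
  \<comment> \<open>\<open>\<kappa>\<close> rescales the polynomial so that the class of
    \<open>y\<close> becomes the class of 1, the one treated by
    \<open>kummer_count_upper_bound\<close>.\<close>
  obtain \<kappa> where \<kappa>: "\<kappa> ^ u = inverse y" using nth_root_exists[OF u0] by auto
  have \<kappa>0: "\<kappa> \<noteq> 0" using \<kappa> y u0 by (auto simp: power_0_left)
  \<comment> \<open>With z = 1 / (a - c x0) one has z * (c x - a) = z * (c x - c x0) - 1. The factor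
    of \<open>x0\<close> becomes -1, and the others stay linear in z because \<open>c x\<close>
    differs from \<open>c x0\<close>.\<close>
  define g where "g = smult (\<kappa> * (-1) ^ m x0) (\<Prod>x\<in>J - {x0}. [:-1, c x - c x0:] ^ m x)"
  have degg: "degree g = D"
  proof -
    have "degree g = (\<Sum>x\<in>J - {x0}. degree ([:-1, c x - c x0:] ^ m x))"
      using \<kappa>0 by (simp add: g_def degree_prod_sum_eq)
    also have "\<dots> = D" unfolding D_def using J(3) by (intro sum.cong) (auto simp: degree_power_eq)
    finally show ?thesis .
  qed
  have g0: "g \<noteq> 0" using \<kappa>0 J(1) by (simp add: g_def)
  define A' where "A' = (\<lambda>a. inverse (a - c x0)) ` A"
  have "inj (\<lambda>a. inverse (a - c x0))" by (auto simp: inj_def)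
  then have card: "card A' = card A" unfolding A'_def by (intro card_image) (auto simp: inj_on_def inj_def)
  have MM: "M * M = CHAR('e) ^ (s + s)" by (simp add: M(1) power_add)
  have *: "z ^ (M * M) = z \<and> poly g z ^ u = 1" if zA: "z \<in> A'" for z
  proof -
    obtain a where a: "a \<in> A" "z = inverse (a - c x0)" using zA by (auto simp: A'_def)
    have ac: "a \<noteq> c x0"
    proof
      assume "a = c x0"
      moreover have "m x0 \<noteq> 0" using m(1) by (intro notI) simp
      ultimately have "U a = 0" using J(1,2) by (auto simp: U_def)
      then show False using a(1) u0 y by (auto simp: A_def power_0_left)
    qed
    have "(a - c x0) ^ (M * M) + c x0 ^ (M * M) = a ^ (M * M)"
      using freshmans_dream'[OF char MM, of "a - c x0" "c x0"] by simp
    then have "(a - c x0) ^ (M * M) = a - c x0" using a(1) c0 by (simp add: A_def algebra_simps)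
    then have zL: "z ^ (M * M) = z" by (simp add: a(2) power_inverse)
    have z0: "z \<noteq> 0" using ac by (simp add: a(2))
    have S: "Suc (M * M - 1) = M * M" using MM1 by simp
    have "z * z ^ (M * M - 1) = z ^ (M * M)" by (simp only: power_Suc[symmetric] S)
    then have "z * z ^ (M * M - 1) = z * 1" by (simp only: zL mult_1_right)
    then have zu: "z ^ (d * u) = 1" unfolding ud by (rule iffD1[OF mult_left_cancel[OF z0]])
    have "poly g z = \<kappa> * (-1) ^ m x0 * (\<Prod>x\<in>J - {x0}. (z * (c x - a)) ^ m x)"
    proof -
      have "poly g z = \<kappa> * (-1) ^ m x0 * (\<Prod>x\<in>J - {x0}. (z * (c x - c x0) - 1) ^ m x)"
        by (simp add: g_def poly_prod)
      moreover have e: "z * (c x - c x0) - 1 = z * (c x - a)" for x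
      proof -
        have "z * (a - c x0) = 1" using ac by (simp add: a(2))
        then show ?thesis by (simp add: algebra_simps)
      qed
      ultimately show ?thesis by (simp only: e)
    qed
    also have "(-1) ^ m x0 = (z * (c x0 - a)) ^ m x0"
    proof -
      have "z * (c x0 - a) = -1" using ac by (simp add: a(2) field_simps)
      then show ?thesis by simp
    qed
    also have "\<kappa> * (z * (c x0 - a)) ^ m x0 * (\<Prod>x\<in>J - {x0}. (z * (c x - a)) ^ m x) = \<kappa> * (\<Prod>x\<in>J. (z * (c x - a)) ^ m x)"
      using prod.remove[OF J(1,2), of "\<lambda>x. (z * (c x - a)) ^ m x"] by (simp only: mult.assoc)
    also have "\<dots> = \<kappa> * (z ^ (\<Sum>x\<in>J. m x) * U a)"
      by (simp add: U_def power_mult_distrib prod.distrib power_sum)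
    finally have "poly g z ^ u = \<kappa> ^ u * (z ^ ((\<Sum>x\<in>J. m x) * u) * U a ^ u)"
      by (simp add: power_mult_distrib power_mult)
    \<comment> \<open>The substitution multiplies the product by z to the total multiplicity. As
      this is divisible by \<open>d\<close>, the residue class is unchanged.\<close>
    also have "z ^ ((\<Sum>x\<in>J. m x) * u) = 1"
    proof -
      obtain b where "(\<Sum>x\<in>J. m x) = d * b" using m(2) by auto
      then have "z ^ ((\<Sum>x\<in>J. m x) * u) = (z ^ (d * u)) ^ b" by (simp add: mult_ac flip: power_mult)
      then show ?thesis by (simp add: zu)
    qed
    finally have "poly g z ^ u = 1" using a(1) y \<kappa> by (simp add: A_def)
    then show ?thesis using zL by simp
  qed
  have "d * card A' \<le> M * M + (d * D + d * (d * D + 2)) * M"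
    using * by (intro kummer_count_upper_bound[OF char M(1) d0 M(2) degg cop g0 M(3)]) (auto simp: u_def)
  then show ?thesis unfolding card by (simp add: A_def U_def u_def)
qed

text \<open>The constants are chosen before \<open>s\<close> and \<open>M\<close>: they depend on
  the roots and multiplicities but not on the field, so the error remains O(M) as the field
  grows.\<close>

lemma kummer_class_equidistribution:
  fixes c :: "'x \<Rightarrow> 'e::alg_closed_field"
  assumes char: "prime CHAR('e)" and d: "prime d"
    and J: "finite J" "x0 \<in> J" "\<forall>x\<in>J. x \<noteq> x0 \<longrightarrow> c x \<noteq> c x0"
    and m: "\<not> d dvd m x0" "d dvd (\<Sum>x\<in>J. m x)"
  shows "\<exists>C M0. \<forall>s M. M = CHAR('e) ^ s \<longrightarrow> M0 \<le> M \<longrightarrow> d dvd M - 1 \<longrightarrow> card {a::'e. a ^ (M * M) = a} = M * M \<longrightarrow>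
     (\<forall>x\<in>J. c x ^ (M * M) = c x) \<longrightarrow> (\<forall>y. y ^ d = 1 \<longrightarrow>
     \<bar>real (card {a. a ^ (M * M) = a \<and> (\<Prod>x\<in>J. (c x - a) ^ m x) ^ ((M * M - 1) div d) = y}) - real (M * M) / real d\<bar> \<le> C * real M)"
proof -
  define D where "D = (\<Sum>x\<in>J - {x0}. m x)"
  define C1 where "C1 = d * D + d * (d * D + 2)"
  define M0 where "M0 = d + d * (d * D + 2) * (d * D + 1) + d * D + 1"
  \<comment> \<open>\<open>C1\<close> comes from the upper bound for one class;
    \<open>card J\<close> accounts for the points \<open>c x\<close>, where the polynomial may
    vanish.\<close>
  define C where "C = real (card J + C1)"
  have d0: "d > 0" using d prime_gt_0_nat by blast
  show ?thesis
  proof (rule exI[of _ C], rule exI[of _ M0], intro allI impI)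
    fix s M y
    assume M: "M = CHAR('e) ^ s" "M0 \<le> M" "d dvd M - 1" and cL: "card {a::'e. a ^ (M * M) = a} = M * M"
      and cJ: "\<forall>x\<in>J. c x ^ (M * M) = c x" and y: "(y::'e) ^ d = 1"
    define u where "u = (M * M - 1) div d"
    define U where "U a = (\<Prod>x\<in>J. (c x - a) ^ m x)" for a
    define F where "F = {a::'e. a ^ (M * M) = a}"
    define N where "N y = card {a \<in> F. U a ^ u = y}" for y
    have M1: "M > 1" using M(2) d0 by (simp add: M0_def)
    then have MM1: "M * M > 1" using less_1_mult by blast
    have finF: "finite F" using cL MM1 unfolding F_def by (metis card.infinite not_one_less_zero)
    have "M * M - 1 = (M - 1) * (M + 1)" by (simp add: algebra_simps)
    then have "d dvd M * M - 1" using M(3) by (simp only: dvd_mult2)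
    then have ud: "M * M - 1 = d * u" unfolding u_def by (rule dvd_mult_div_cancel[symmetric])
    have up: "d * N z \<le> M * M + C1 * M" if "z \<noteq> 0" for z
    proof -
      have large: "M > d + d * (d * (\<Sum>x\<in>J - {x0}. m x) + 2) * (d * (\<Sum>x\<in>J - {x0}. m x) + 1) + d * (\<Sum>x\<in>J - {x0}. m x)"
        using M(2) unfolding M0_def D_def by linarith
      have c0: "c x0 ^ (M * M) = c x0" using cJ J(2) by blast
      show ?thesis
        using kummer_class_upper_bound[where c = c and m = m and s = s, OF char d J m M(1,3) large c0 that]
        unfolding N_def F_def U_def u_def C1_def D_def by simp
    qed
    have up': "real (N z) \<le> real (M * M) / real d + real C1 * real M / real d" if "z \<noteq> 0" for z
    proof -
      have "real (d * N z) \<le> real (M * M + C1 * M)" using up[OF that] of_nat_le_iff by blast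
      then show ?thesis using d0 by (simp add: field_simps)
    qed
    have y0: "y \<noteq> 0" using y d0 by (auto simp: power_0_left)
    let ?\<mu> = "{y::'e. y ^ d = 1}"
    have fin\<mu>: "finite ?\<mu>" "card ?\<mu> \<le> d" using card_roots_of_unity_le[OF d0] by auto
    have "M * M \<le> card J + (\<Sum>z\<in>?\<mu>. N z)"
    proof -
      have "F \<subseteq> c ` J \<union> (\<Union>z\<in>?\<mu>. {a \<in> F. U a ^ u = z})"
      proof
        fix a assume a: "a \<in> F"
        show "a \<in> c ` J \<union> (\<Union>z\<in>?\<mu>. {a \<in> F. U a ^ u = z})"
        proof (cases "a \<in> c ` J")
          case False
          have S: "Suc (M * M - 1) = M * M" using MM1 by simp
          have "(c x - a) ^ (M * M - 1) = 1" if "x \<in> J" for x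
          proof -
            have MMp: "M * M = CHAR('e) ^ (s + s)" by (simp add: M(1) power_add)
            have "(c x - a) ^ (M * M) + a ^ (M * M) = c x ^ (M * M)"
              using freshmans_dream'[OF char MMp, of "c x - a" a] by simp
            then have "(c x - a) ^ (M * M) = c x - a" using a cJ that by (simp add: F_def algebra_simps)
            moreover have "(c x - a) ^ (M * M) = (c x - a) * (c x - a) ^ (M * M - 1)"
              by (simp only: power_Suc[symmetric] S)
            moreover have "c x - a \<noteq> 0" using False that by auto
            ultimately show ?thesis by simp
          qed
          then have "(\<Prod>x\<in>J. ((c x - a) ^ (M * M - 1)) ^ m x) = 1" by (intro prod.neutral) simp
          moreover have "(U a ^ u) ^ d = (\<Prod>x\<in>J. ((c x - a) ^ (M * M - 1)) ^ m x)"
            unfolding ud U_def prod_power_distrib power_mult[symmetric]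
            by (intro prod.cong refl arg_cong[where f = "\<lambda>n. _ ^ n"]) simp
          ultimately have "(U a ^ u) ^ d = 1" by simp
          then show ?thesis using a by auto
        qed auto
      qed
      then have "card F \<le> card (c ` J \<union> (\<Union>z\<in>?\<mu>. {a \<in> F. U a ^ u = z}))"
        using J(1) fin\<mu> finF by (intro card_mono) auto
      also have "\<dots> \<le> card (c ` J) + card (\<Union>z\<in>?\<mu>. {a \<in> F. U a ^ u = z})" by (rule card_Un_le)
      also have "\<dots> \<le> card J + (\<Sum>z\<in>?\<mu>. N z)"
        unfolding N_def using J(1) fin\<mu> by (intro add_mono card_image_le card_UN_le)
      finally show ?thesis using cL by (simp add: F_def)
    qed
    then have "real (M * M) \<le> real (card J + (\<Sum>z\<in>?\<mu>. N z))" using of_nat_le_iff by blast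
    also have "\<dots> = real (card J) + real (N y) + (\<Sum>z\<in>?\<mu> - {y}. real (N z))"
      using fin\<mu>(1) y by (simp add: sum.remove[of _ y "\<lambda>z. real (N z)"])
    also have "(\<Sum>z\<in>?\<mu> - {y}. real (N z)) \<le> real (card (?\<mu> - {y})) * (real (M * M) / real d + real C1 * real M / real d)"
      using d0 by (intro sum_bounded_above up') (auto simp: power_0_left)
    also have "\<dots> \<le> (real d - 1) * (real (M * M) / real d + real C1 * real M / real d)"
    proof (rule mult_right_mono)
      have "card (?\<mu> - {y}) = card ?\<mu> - 1" using y fin\<mu> by simp
      then show "real (card (?\<mu> - {y})) \<le> real d - 1" using fin\<mu>(2) d0 by linarith
    qed simp
    also have "\<dots> = real (M * M) - real (M * M) / real d + real C1 * real M - real C1 * real M / real d"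
      using d0 by (simp add: field_simps)
    finally have low: "real (M * M) / real d - real (card J) - real C1 * real M + real C1 * real M / real d \<le> real (N y)"
      by simp
    have "real C1 * real M / real d \<ge> 0" by simp
    moreover have "real C1 * real M / real d \<le> real C1 * real M" using mult_left_mono[of 1 "real d" "real C1 * real M"] d0 by (simp add: divide_le_eq)
    moreover have "real (card J) \<le> real (card J) * real M" using M1 by (simp add: mult_le_cancel_left1)
    moreover have "real (card J) * real M \<ge> 0" by simp
    ultimately have "\<bar>real (N y) - real (M * M) / real d\<bar> \<le> C * real M"
      unfolding C_def of_nat_add distrib_right abs_le_iff using low up'[OF y0] by linarith
    then show "\<bar>real (card {a. a ^ (M * M) = a \<and> (\<Prod>x\<in>J. (c x - a) ^ m x) ^ ((M * M - 1) div d) = y}) - real (M * M) / real d\<bar> \<le> C * real M"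
      by (simp add: N_def F_def U_def u_def)
  qed
qed

text \<open>Transports character values from characteristic p to the complex numbers. Injectivity on
  roots of unity keeps a nontrivial character nontrivial, and the vanishing sum will cancel the main
  term in the counts of the classes.\<close>

lemma root_of_unity_character:
  fixes \<eta> :: "'e::field"
  assumes d: "d > 1" and \<eta>: "\<And>j::nat. \<eta> ^ j = 1 \<longleftrightarrow> d dvd j"
  shows "\<exists>\<iota> :: 'e \<Rightarrow> complex. \<iota> 0 = 0 \<and> \<iota> 1 = 1 \<and> (\<forall>x y. x ^ d = 1 \<longrightarrow> y ^ d = 1 \<longrightarrow> \<iota> (x * y) = \<iota> x * \<iota> y) \<and>
    (\<forall>x. cmod (\<iota> x) \<le> 1) \<and> (\<forall>x. x ^ d = 1 \<longrightarrow> \<iota> x = 1 \<longrightarrow> x = 1) \<and> (\<Sum>y | y ^ d = 1. \<iota> y) = 0"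
proof -
  let ?\<mu> = "{y::'e. y ^ d = 1}"
  have \<eta>0: "\<eta> \<noteq> 0" using \<eta>[of d] d by (auto simp: power_0_left)
  have d0: "d > 0" using d by simp
  have eq: "\<eta> ^ i = \<eta> ^ j \<longleftrightarrow> [i = j] (mod d)" for i j
  proof -
    have *: "\<eta> ^ i = \<eta> ^ j \<longleftrightarrow> [i = j] (mod d)" if "i \<le> j" for i j
    proof -
      have "\<eta> ^ j = \<eta> ^ i * \<eta> ^ (j - i)" using that by (simp flip: power_add)
      then have "\<eta> ^ i = \<eta> ^ j \<longleftrightarrow> \<eta> ^ (j - i) = 1" using \<eta>0 by auto
      also have "\<dots> \<longleftrightarrow> [i = j] (mod d)" using that by (simp add: \<eta> cong_altdef_nat cong_sym_eq[of i j])
      finally show ?thesis .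
    qed
    show ?thesis using *[of i j] *[of j i] by (cases "i \<le> j") (auto simp: cong_sym_eq)
  qed
  have "card ((\<lambda>j. \<eta> ^ j) ` {..<d}) = d"
    by (subst card_image) (auto simp: inj_on_def eq cong_less_modulus_unique_nat)
  moreover have "(\<lambda>j. \<eta> ^ j) ` {..<d} \<subseteq> ?\<mu>"
    using \<eta>[of d] by (auto simp: mult.commute[of _ d] power_mult simp flip: power_mult)
      (simp add: power_mult)
  ultimately have "(\<lambda>j. \<eta> ^ j) ` {..<d} = ?\<mu>"
    using card_roots_of_unity_le[OF d0] by (intro card_seteq) auto
  then have gen: "\<exists>j. y = \<eta> ^ j" if "y ^ d = 1" for y using that by auto
  define \<zeta> where "\<zeta> = exp (2 * of_real pi * \<i> / of_nat d)"
  have \<zeta>: "\<zeta> ^ j = 1 \<longleftrightarrow> d dvd j" for j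
  proof -
    have "\<zeta> ^ j = exp (2 * of_real pi * \<i> * of_nat j / of_nat d)"
      unfolding \<zeta>_def by (subst exp_of_nat_mult[symmetric]) (simp add: mult_ac)
    then show ?thesis using complex_root_unity_eq_1[of d j] d by simp
  qed
  \<comment> \<open>The choice of the exponent is harmless: two candidates differ by a multiple of
    \<open>d\<close>, the common order of \<open>\<eta>\<close> and \<open>\<zeta>\<close>.\<close>
  define \<iota> where "\<iota> y = (if y ^ d = 1 then \<zeta> ^ (SOME j. y = \<eta> ^ j) else 0)" for y :: 'e
  have pow: "\<iota> (\<eta> ^ j) = \<zeta> ^ j" for j
  proof -
    have "(\<eta> ^ j) ^ d = 1" using \<eta>[of "j * d"] by (simp add: power_mult)
    moreover define l where "l = (SOME l. \<eta> ^ j = \<eta> ^ l)"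
    moreover have "\<eta> ^ j = \<eta> ^ l" unfolding l_def by (rule someI[of _ j]) simp
    then have "[j = l] (mod d)" by (simp add: eq)
    then have "\<zeta> ^ j = \<zeta> ^ l"
    proof -
      have per: "\<zeta> ^ j = \<zeta> ^ (j mod d)" for j
      proof -
        have "\<zeta> ^ j = \<zeta> ^ (d * (j div d)) * \<zeta> ^ (j mod d)" by (simp flip: power_add)
        then show ?thesis using \<zeta>[of "d * (j div d)"] by simp
      qed
      show ?thesis using per[of j] per[of l] \<open>[j = l] (mod d)\<close> by (simp add: cong_def)
    qed
    ultimately show ?thesis by (simp add: \<iota>_def)
  qed
  have mult: "\<iota> (x * y) = \<iota> x * \<iota> y" if "x ^ d = 1" "y ^ d = 1" for x y
    using gen[OF that(1)] gen[OF that(2)] by (auto simp: pow simp flip: power_add)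
  have "\<iota> 0 = 0" using d by (simp add: \<iota>_def power_0_left)
  moreover have "\<iota> 1 = 1" using pow[of 0] by simp
  moreover have "cmod (\<iota> x) \<le> 1" for x
  proof -
    have "cmod \<zeta> = 1" by (simp add: \<zeta>_def)
    then show ?thesis by (simp add: \<iota>_def norm_power)
  qed
  moreover have "x = 1" if "x ^ d = 1" "\<iota> x = 1" for x
    using gen[OF that(1)] that(2) by (auto simp: pow \<zeta> \<eta>)
  moreover have "(\<Sum>y\<in>?\<mu>. \<iota> y) = 0"
  proof -
    have \<eta>\<mu>: "\<eta> ^ d = 1" using \<eta>[of d] by simp
    have "bij_betw (\<lambda>y. \<eta> * y) ?\<mu> ?\<mu>"
      using \<eta>0 \<eta>\<mu> by (intro bij_betw_byWitness[where f' = "\<lambda>y. y / \<eta>"]) (auto simp: power_mult_distrib power_divide)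
    then have "(\<Sum>y\<in>?\<mu>. \<iota> y) = (\<Sum>y\<in>?\<mu>. \<iota> (\<eta> * y))" by (rule sum.reindex_bij_betw[symmetric])
    also have "\<dots> = (\<Sum>y\<in>?\<mu>. \<zeta> * \<iota> y)"
      using mult[OF \<eta>\<mu>] pow[of 1] by (intro sum.cong refl) simp
    also have "\<dots> = \<zeta> * (\<Sum>y\<in>?\<mu>. \<iota> y)" by (rule sum_distrib_left[symmetric])
    finally have "(\<zeta> - 1) * (\<Sum>y\<in>?\<mu>. \<iota> y) = 0" by (simp only: left_diff_distrib mult_1) simp
    moreover have "\<zeta> \<noteq> 1" using \<zeta>[of 1] d by auto
    ultimately show ?thesis by simp
  qed
  ultimately show ?thesis using mult by (intro exI[of _ \<iota>]) auto
qed

lemma sum_powers_nat: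
  fixes b :: nat
  assumes "b > 0"
  shows "(b - 1) * (\<Sum>u<n. b ^ u) = b ^ n - 1"
proof -
  have "(b - 1) * (\<Sum>u<n. b ^ u) + 1 = b ^ n"
  proof (induction n)
    case (Suc n)
    have "(b - 1) * (\<Sum>u<Suc n. b ^ u) + 1 = (b - 1) * b ^ n + b ^ n"
      using Suc.IH by (simp only: sum.lessThan_Suc distrib_left)
    also have "\<dots> = ((b - 1) + 1) * b ^ n" by (simp only: distrib_right mult_1)
    finally show ?case using assms by simp
  qed simp
  then show ?thesis by simp
qed

lemma power_minus_one_dvd:
  fixes b :: nat
  assumes "b > 0" "g dvd n"
  shows "b ^ g - 1 dvd b ^ n - 1"
proof -
  obtain c where c: "n = g * c" using assms(2) by (elim dvdE)
  have "b ^ n - 1 = (b ^ g - 1) * (\<Sum>u<c. (b ^ g) ^ u)"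
    using sum_powers_nat[of "b ^ g" c] assms(1) by (simp add: c power_mult)
  then show ?thesis by simp
qed

section \<open>Characters as power residue symbols of a fixed polynomial\<close>

context frobenius begin

text \<open>The difference of \<open>\<beta>\<close> and a^(Q^t) is the Q^t-th power of a conjugate
  of \<open>\<beta>\<close> minus \<open>a\<close>. Collecting the t with the same residue w modulo
  \<open>k\<close> gives the exponent Q^w * (Q^r - 1) / (Q^k - 1); multiplied by \<open>s\<close> it
  becomes (Q^r - 1) / d times a number that does not depend on \<open>r\<close>.\<close>

lemma CP_value_kummer:
  assumes \<beta>: "\<beta> \<in> FL k" and k: "k > 0" and r: "k dvd r" and a: "a \<in> FL r"
    and s: "(Q ^ k - 1) dvd d * s" and d: "d > 0" "d dvd Q ^ r - 1"
  shows "poly (CP a r) \<beta> ^ s =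
    (\<Prod>w<k. (\<beta> ^ (Q ^ (k - w)) - a) ^ (Q ^ w * (d * s div (Q ^ k - 1)))) ^ ((Q ^ r - 1) div d)"
proof -
  \<comment> \<open>The w-fold inverse Frobenius image of \<open>\<beta>\<close>; for w = 0 it is
    \<open>\<beta>\<close> itself.\<close>
  define c where "c w = \<beta> ^ (Q ^ (k - w))" for w
  obtain n where n: "r = k * n" using r by auto
  have "poly (CP a r) \<beta> = (\<Prod>t<r. \<beta> - a ^ (Q ^ t))" by (simp add: CP_def poly_prod)
  also have "\<dots> = (\<Prod>t<r. (c (t mod k) - a) ^ (Q ^ t))"
  proof (intro prod.cong refl)
    fix t
    have "k dvd (k - t mod k) + t"
    proof -
      have "(k - t mod k) + t = k + k * (t div k)"
        using mod_less_divisor[OF k, of t] mult_div_mod_eq[of k t] by linarith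
      then show ?thesis by simp
    qed
    then have "\<beta> \<in> FL ((k - t mod k) + t)" using FL_mono \<beta> by blast
    then have "c (t mod k) ^ (Q ^ t) = \<beta>" by (simp add: c_def frob_frob FL_iff)
    then show "\<beta> - a ^ (Q ^ t) = (c (t mod k) - a) ^ (Q ^ t)" by (simp add: frob_diff)
  qed
  also have "\<dots> = (\<Prod>w<k. (c w - a) ^ (Q ^ w * (\<Sum>u<n. Q ^ (k * u))))"
    unfolding n
  proof (induction n)
    case (Suc n)
    have split: "(\<Prod>t<m + l. f t) = (\<Prod>t<m. f t) * (\<Prod>t<l. f (m + t))" for f :: "nat \<Rightarrow> 'e" and m l
      by (induction l) (auto simp: mult.assoc)
    have "(\<Prod>t<k * Suc n. (c (t mod k) - a) ^ (Q ^ t))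
        = (\<Prod>t<k * n. (c (t mod k) - a) ^ (Q ^ t)) * (\<Prod>t<k. (c ((k * n + t) mod k) - a) ^ (Q ^ (k * n + t)))"
      by (subst split[symmetric]) (simp add: add.commute)
    also have "(\<Prod>t<k. (c ((k * n + t) mod k) - a) ^ (Q ^ (k * n + t))) = (\<Prod>w<k. (c w - a) ^ (Q ^ w * Q ^ (k * n)))"
      by (intro prod.cong refl) (simp add: power_add mult.commute)
    finally show ?case
      unfolding Suc.IH by (simp add: distrib_left power_add flip: prod.distrib)
  qed auto
  finally have val: "poly (CP a r) \<beta> = (\<Prod>w<k. (c w - a) ^ (Q ^ w * (\<Sum>u<n. Q ^ (k * u))))" .
  define G where "G = (\<Sum>u<n. Q ^ (k * u))"
  define e where "e = d * s div (Q ^ k - 1)"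
  have e: "d * s = (Q ^ k - 1) * e" using s by (simp add: e_def)
  have G: "(Q ^ k - 1) * G = Q ^ r - 1"
    using sum_powers_nat[of "Q ^ k" n] Q_pow_pos[of k] by (simp add: G_def n power_mult)
  have "d * (G * s) = G * (d * s)" by simp
  also have "\<dots> = (Q ^ r - 1) * e" unfolding e G[symmetric] by simp
  also have "\<dots> = d * (((Q ^ r - 1) div d) * e)" by (simp only: mult.assoc[symmetric] dvd_mult_div_cancel[OF d(2)])
  finally have Gs: "G * s = ((Q ^ r - 1) div d) * e" using d(1) by simp
  have "poly (CP a r) \<beta> ^ s = (\<Prod>w<k. (c w - a) ^ (Q ^ w * (G * s)))"
    unfolding val G_def[symmetric] by (simp add: prod_power_distrib mult.assoc flip: power_mult)
  also have "\<dots> = (\<Prod>w<k. (c w - a) ^ (Q ^ w * e)) ^ ((Q ^ r - 1) div d)"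
    unfolding Gs prod_power_distrib by (intro prod.cong refl) (simp add: mult_ac flip: power_mult)
  finally show ?thesis by (simp only: c_def e_def)
qed

end

text \<open>One root \<open>\<beta> i\<close> for each irreducible factor. Injectivity on pairs says
  both that \<open>\<beta> i\<close> has degree exactly \<open>k i\<close> and that different
  indices give roots that are not conjugate, which makes the product \<open>RR\<close> of the
  minimal polynomials squarefree.\<close>

locale conjugates = frobenius Q ty for Q and ty :: "'e::alg_closed_field itself" +
  fixes I :: "'i set" and \<beta> :: "'i \<Rightarrow> 'e" and k :: "'i \<Rightarrow> nat"
  assumes finI: "finite I" and k_pos: "\<And>i. i \<in> I \<Longrightarrow> k i > 0"
    and \<beta>_FL: "\<And>i. i \<in> I \<Longrightarrow> \<beta> i \<in> FL (k i)"
    and distinct_conj: "inj_on (\<lambda>(i, t). \<beta> i ^ (Q ^ t)) (SIGMA i:I. {..<k i})"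
begin

definition RR :: "'e poly" where "RR = (\<Prod>i\<in>I. CP (\<beta> i) (k i))"

lemma RR_KX: "RR \<in> KX" unfolding RR_def by (intro KX_prod CP_KX \<beta>_FL)

lemma degree_RR: "degree RR = (\<Sum>i\<in>I. k i)" by (simp add: RR_def degree_prod_sum_eq)

lemma lead_coeff_RR: "lead_coeff RR = 1" by (simp only: RR_def lead_coeff_prod lead_coeff_CP prod.neutral_const)

lemma poly_RR: "i \<in> I \<Longrightarrow> poly RR (\<beta> i) = 0"
  using finI poly_CP[OF k_pos] by (auto simp: RR_def poly_prod)

lemma RR_dvd:
  assumes "r \<in> KX" "\<And>i. i \<in> I \<Longrightarrow> poly r (\<beta> i) = 0"
  shows "RR dvd r"
proof (cases "r = 0")
  case False
  have "(\<Prod>x\<in>(SIGMA i:I. {..<k i}). [:- (case x of (i, t) \<Rightarrow> \<beta> i ^ (Q ^ t)), 1:] ^ 1) dvd r"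
  proof (rule prod_linear_powers_dvd[OF _ distinct_conj False])
    fix x assume "x \<in> (SIGMA i:I. {..<k i})"
    then obtain i t where x: "x = (i, t)" "i \<in> I" by auto
    have "[:- \<beta> i, 1:] dvd r" using assms(2)[OF x(2)] by (simp add: poly_eq_0_iff_dvd)
    then show "[:- (case x of (i, t) \<Rightarrow> \<beta> i ^ (Q ^ t)), 1:] ^ 1 dvd r"
      using linear_power_dvd_frob[OF assms(1), of "\<beta> i" 1 t] by (simp add: x)
  qed (use finI in auto)
  also have "(\<Prod>x\<in>(SIGMA i:I. {..<k i}). [:- (case x of (i, t) \<Rightarrow> \<beta> i ^ (Q ^ t)), 1:] ^ 1) = RR"
    unfolding RR_def CP_def using finI by (subst prod.Sigma) (auto intro!: prod.cong)
  finally show ?thesis .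
qed simp

text \<open>The Chinese remainder theorem by counting: polynomials of degree below
  \<open>degree RR\<close> are determined by their values, and there are as many of them as tuples
  of values.\<close>

lemma interpolate:
  assumes "\<And>i. i \<in> I \<Longrightarrow> w i \<in> FL (k i)"
  shows "\<exists>g\<in>KX. \<forall>i\<in>I. poly g (\<beta> i) = w i"
proof -
  let ?f = "\<lambda>g. \<lambda>i\<in>I. poly g (\<beta> i)"
  let ?K = "KL (degree RR)"
  have inj: "inj_on ?f ?K"
  proof (rule inj_onI)
    fix g h assume gh: "g \<in> ?K" "h \<in> ?K" "?f g = ?f h"
    have "g - h \<in> ?K" using gh by (auto simp: KL_def KX_closed)
    moreover have "poly (g - h) (\<beta> i) = 0" if "i \<in> I" for i using fun_cong[OF gh(3), of i] that by simp
    then have "RR dvd g - h" using \<open>g - h \<in> ?K\<close> by (intro RR_dvd) (auto simp: KL_def)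
    ultimately have "g - h = 0" using dvd_imp_degree_le[of RR "g - h"] by (fastforce simp only: KL_iff not_le[symmetric])
    then show "g = h" by simp
  qed
  have sub: "?f ` ?K \<subseteq> (\<Pi>\<^sub>E i\<in>I. FL (k i))"
  proof (rule image_subsetI)
    fix g assume "g \<in> ?K"
    then have "g \<in> KX" by (simp add: KL_def)
    then show "?f g \<in> (\<Pi>\<^sub>E i\<in>I. FL (k i))" using poly_in_FL \<beta>_FL by (intro PiE_I) (simp_all add: restrict_def)
  qed
  have "card (\<Pi>\<^sub>E i\<in>I. FL (k i)) = (\<Prod>i\<in>I. Q ^ k i)"
    using finI card_FL[OF k_pos] by (simp add: card_PiE)
  also have "\<dots> = Q ^ degree RR" by (simp add: degree_RR power_sum)
  also have "\<dots> = card (?f ` ?K)" using inj KL_card(2) by (simp add: card_image)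
  finally have "?f ` ?K = (\<Pi>\<^sub>E i\<in>I. FL (k i))"
    using sub finI finite_FL k_pos by (intro card_subset_eq finite_PiE) auto
  moreover have "(\<lambda>i\<in>I. w i) \<in> (\<Pi>\<^sub>E i\<in>I. FL (k i))" using assms by auto
  ultimately obtain g where g: "g \<in> ?K" "?f g = (\<lambda>i\<in>I. w i)" by (metis (no_types, lifting) imageE)
  have "poly g (\<beta> i) = w i" if "i \<in> I" for i using fun_cong[OF g(2), of i] that by simp
  then show ?thesis using g(1) by (auto simp: KL_def)
qed

end

section \<open>Characters trivial on constants and linear polynomials\<close>

context conjugates begin

text \<open>The exponents \<open>s\<close> describe a character on tuples of values, with d-th roots
  of unity as values and nontrivial on every factor. They are positive, so the product of powers
  vanishes on a polynomial with some \<open>\<beta> i\<close> as a root, as a Dirichlet character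
  should.\<close>

lemma no_annihilating_exponents:
  fixes d q u :: nat and s :: "'i \<Rightarrow> nat"
  assumes I: "I \<noteq> {}" and Qq: "Q = q ^ 2" and q: "q = CHAR('e) ^ u" and d: "prime d"
    and s: "\<And>i. i \<in> I \<Longrightarrow> (Q ^ k i - 1) dvd d * s i" "\<And>i. i \<in> I \<Longrightarrow> \<not> (Q ^ k i - 1) dvd s i"
    and deg: "(\<Sum>i\<in>I. k i) \<le> q + 2"
    and triv1: "\<And>c. c \<in> FL 1 \<Longrightarrow> c \<noteq> 0 \<Longrightarrow> (\<Prod>i\<in>I. c ^ s i) = 1"
    and triv2: "\<And>a. a \<in> FL 1 \<Longrightarrow> (\<Prod>i\<in>I. (\<beta> i - a) ^ s i) = 1"
  shows False
proof -
  obtain i0 where i0: "i0 \<in> I" using I by auto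
  define N where "N i = Q ^ k i - 1" for i
  have N0: "N i > 0" if "i \<in> I" for i using Q_pow_gt_1[OF k_pos[OF that]] by (simp add: N_def)
  have d1: "d > 1" using d prime_gt_1_nat by blast
  have dN: "d dvd N i" if "i \<in> I" for i
  proof (rule ccontr)
    assume "\<not> d dvd N i"
    then have "coprime (N i) d" using d by (metis prime_imp_coprime coprime_commute)
    then show False using s[OF that] by (simp add: N_def coprime_dvd_mult_right_iff)
  qed
  have s0: "s i > 0" if "i \<in> I" for i using s(2)[OF that] by (intro gr0I notI) simp
  obtain \<gamma> where \<gamma>: "\<gamma> \<in> FL (k i0)" "\<gamma> \<noteq> 0" "\<And>x. x \<in> FL (k i0) \<Longrightarrow> x \<noteq> 0 \<Longrightarrow> \<exists>n. x = \<gamma> ^ n"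
    using FL_primitive[OF k_pos[OF i0]] by blast
  have \<gamma>1: "\<gamma> ^ n = 1 \<longleftrightarrow> N i0 dvd n" for n
    using primitive_power_eq_1[OF k_pos[OF i0] \<gamma>] by (simp add: N_def)
  obtain h where h: "N i0 = d * h" using dN[OF i0] by auto
  have h0: "h > 0" using N0[OF i0] h by (cases h) auto
  have "(\<gamma> ^ h) ^ j = 1 \<longleftrightarrow> d dvd j" for j
    unfolding power_mult[symmetric] \<gamma>1 h using h0 by (simp add: mult.commute)
  from root_of_unity_character[OF d1 this] obtain \<iota> :: "'e \<Rightarrow> complex" where
    \<iota>_conj: "\<iota> 0 = 0 \<and> \<iota> 1 = 1 \<and> (\<forall>x y. x ^ d = 1 \<longrightarrow> y ^ d = 1 \<longrightarrow> \<iota> (x * y) = \<iota> x * \<iota> y) \<and>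
      (\<forall>x. cmod (\<iota> x) \<le> 1) \<and> (\<forall>x. x ^ d = 1 \<longrightarrow> \<iota> x = 1 \<longrightarrow> x = 1) \<and> (\<Sum>y | y ^ d = 1. \<iota> y) = 0"
    by (elim exE)
  then have \<iota>: "\<iota> 0 = 0" "\<iota> 1 = 1"
    "\<And>x y. x ^ d = 1 \<Longrightarrow> y ^ d = 1 \<Longrightarrow> \<iota> (x * y) = \<iota> x * \<iota> y" "\<And>x. cmod (\<iota> x) \<le> 1"
    "\<And>x. x ^ d = 1 \<Longrightarrow> \<iota> x = 1 \<Longrightarrow> x = 1" "(\<Sum>y | y ^ d = 1. \<iota> y) = 0"
    by simp_all
  define v where "v g = (\<Prod>i\<in>I. poly g (\<beta> i) ^ s i)" for g
  define \<psi> where "\<psi> g = \<iota> (v g)" for g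
  have v01: "v g = 0 \<or> v g ^ d = 1" if "g \<in> KX" for g
  proof (cases "\<exists>i\<in>I. poly g (\<beta> i) = 0")
    case True
    then have "v g = 0" unfolding v_def using finI s0 by (auto simp: prod_zero_iff)
    then show ?thesis by simp
  next
    case False
    have "(poly g (\<beta> i) ^ s i) ^ d = 1" if i: "i \<in> I" for i
    proof -
      obtain b where b: "d * s i = N i * b" using s(1)[OF i] by (auto simp: N_def)
      have "(poly g (\<beta> i) ^ s i) ^ d = (poly g (\<beta> i) ^ N i) ^ b"
        using b by (simp add: mult.commute flip: power_mult)
      also have "poly g (\<beta> i) ^ N i = 1" unfolding N_def
        using FL_power_order[OF poly_in_FL[OF \<open>g \<in> KX\<close> \<beta>_FL[OF i]]] False i by auto
      finally show ?thesis by simp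
    qed
    then have "v g ^ d = 1" by (simp add: v_def prod_power_distrib)
    then show ?thesis ..
  qed
  \<comment> \<open>A witness of nontriviality: its value under the character is that of
    \<open>\<gamma> ^ s i0\<close>, which differs from 1 because the order of
    \<open>\<gamma>\<close> does not divide \<open>s i0\<close>.\<close>
  have "\<exists>g\<in>KX. \<forall>i\<in>I. poly g (\<beta> i) = (if i = i0 then \<gamma> else 1)"
    using \<gamma>(1) FL_closed(2) by (intro interpolate) auto
  then obtain g0 where g0: "g0 \<in> KX" "\<And>i. i \<in> I \<Longrightarrow> poly g0 (\<beta> i) = (if i = i0 then \<gamma> else 1)" by auto
  have vg0: "v g0 = \<gamma> ^ s i0"
  proof -
    have "v g0 = (\<Prod>i\<in>I. if i = i0 then \<gamma> ^ s i0 else 1)"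
      unfolding v_def by (intro prod.cong) (auto simp: g0)
    then show ?thesis using i0 finI by simp
  qed
  interpret frobenius_character Q ty \<psi> RR g0
  proof
    show "RR \<in> KX" by (rule RR_KX)
    show "lead_coeff RR = 1" by (rule lead_coeff_RR)
    show "degree RR > 0" unfolding degree_RR using i0 finI k_pos[OF i0]
      by (metis gr0I less_irrefl sum_eq_0_iff)
    show "\<psi> (g * h) = \<psi> g * \<psi> h" if "g \<in> KX" "h \<in> KX" for g h
    proof -
      have "v (g * h) = v g * v h" by (simp add: v_def power_mult_distrib prod.distrib)
      then show ?thesis using v01[OF that(1)] v01[OF that(2)] \<iota>(1,3) by (auto simp: \<psi>_def)
    qed
    show "\<psi> g = \<psi> h" if "g \<in> KX" "h \<in> KX" "RR dvd g - h" for g h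
    proof -
      have "poly g (\<beta> i) = poly h (\<beta> i)" if "i \<in> I" for i
      proof -
        obtain b where "g - h = RR * b" using \<open>RR dvd g - h\<close> by auto
        then have "poly (g - h) (\<beta> i) = 0" using poly_RR[OF that] by simp
        then show ?thesis by simp
      qed
      then show ?thesis by (simp add: \<psi>_def v_def)
    qed
    have "v 0 = 0" unfolding v_def using i0 s0[OF i0] finI by (subst prod_zero_iff) (auto simp: power_0_left)
    then show "\<psi> 0 = 0" using \<iota>(1) by (simp add: \<psi>_def)
    show "\<psi> 1 = 1" using \<iota>(2) by (simp add: \<psi>_def v_def)
    show "\<psi> [:c:] = 1" if "c \<in> FL 1" "c \<noteq> 0" for c
      using triv1[OF that] \<iota>(2) by (simp add: \<psi>_def v_def)
    show "g0 \<in> KX" by (rule g0)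
    show "\<psi> g0 \<noteq> 1"
    proof
      assume "\<psi> g0 = 1"
      then have "v g0 = 1" using v01[OF g0(1)] \<iota>(1,5) by (auto simp: \<psi>_def)
      then show False using vg0 \<gamma>1 s(2)[OF i0] by (simp add: N_def)
    qed
    show "RR dvd r" if r: "r \<in> KX" "RR dvd g0 * r" for r
    proof (rule RR_dvd[OF r(1)])
      fix i assume i: "i \<in> I"
      obtain b where "g0 * r = RR * b" using r(2) by auto
      then have "poly (g0 * r) (\<beta> i) = 0" using poly_RR[OF i] by simp
      then show "poly r (\<beta> i) = 0" using g0(2)[OF i] \<gamma>(2) by (auto split: if_splits)
    qed
  qed
  define e where "e i = d * s i div N i" for i
  have e: "d * s i = N i * e i" if "i \<in> I" for i using s(1)[OF that] by (simp add: e_def N_def)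
  \<comment> \<open>The pairs (i, w) run over all conjugates of all \<open>\<beta> i\<close>. These
    are the roots of the polynomial found in \<open>CP_value_kummer\<close>, with multiplicities
    \<open>m\<close>.\<close>
  define J where "J = (SIGMA i:I. {..<k i})"
  define c where "c = (\<lambda>(i, w). \<beta> i ^ (Q ^ (k i - w)))"
  define m where "m = (\<lambda>(i, w). Q ^ w * e i)"
  have J: "finite J" "(i0, 0) \<in> J" using finI i0 k_pos by (auto simp: J_def)
  have c_neq: "\<forall>x\<in>J. x \<noteq> (i0, 0) \<longrightarrow> c x \<noteq> c (i0, 0)"
  proof (intro ballI impI notI)
    fix x assume x: "x \<in> J" "x \<noteq> (i0, 0)"
    assume eq: "c x = c (i0, 0)"
    obtain i w where iw: "x = (i, w)" "i \<in> I" "w < k i" using x by (auto simp: J_def)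
    \<comment> \<open>For w = 0 the exponent k i - w falls outside the range of
      \<open>distinct_conj\<close>, but there the conjugate is \<open>\<beta> i\<close>
      itself.\<close>
    define t where "t = (if w = 0 then 0 else k i - w)"
    have "c x = \<beta> i ^ (Q ^ t)" using \<beta>_FL[OF iw(2)] by (auto simp: iw c_def t_def FL_iff)
    moreover have "c (i0, 0) = \<beta> i0 ^ (Q ^ 0)" using \<beta>_FL[OF i0] by (simp add: c_def FL_iff)
    ultimately have "(i, t) = (i0, 0)"
      using eq iw k_pos[OF i0] i0 by (intro inj_onD[OF distinct_conj]) (auto simp: t_def)
    then show False using iw x(2) by (auto simp: t_def split: if_splits)
  qed
  \<comment> \<open>This is the root that goes to infinity. If \<open>d\<close> divided its
    multiplicity \<open>e i0\<close>, then \<open>N i0\<close> would divide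
    \<open>s i0\<close>.\<close>
  have m0: "\<not> d dvd m (i0, 0)"
  proof
    assume "d dvd m (i0, 0)"
    then obtain b where b: "e i0 = d * b" by (auto simp: m_def)
    have "d * s i0 = d * (N i0 * b)" unfolding e[OF i0] b by (rule mult.left_commute)
    moreover have "0 < d" using d1 by simp
    ultimately have "s i0 = N i0 * b" using nat_mult_eq_cancel1 by blast
    then show False using s(2)[OF i0] by (simp add: N_def)
  qed
  \<comment> \<open>The total multiplicity is \<open>d\<close> times the sum of the
    \<open>s i\<close> divided by Q - 1. Triviality on a generator of the constants makes this
    quotient an integer.\<close>
  have msum: "d dvd (\<Sum>x\<in>J. m x)"
  proof -
    have Q1: "Q - 1 > 0" using Q_gt_1 by simp
    obtain \<gamma>' where \<gamma>': "\<gamma>' \<in> FL 1" "\<gamma>' \<noteq> 0" "\<And>x. x \<in> FL 1 \<Longrightarrow> x \<noteq> 0 \<Longrightarrow> \<exists>n. x = \<gamma>' ^ n"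
      using FL_primitive[of 1] by auto
    have "\<gamma>' ^ (\<Sum>i\<in>I. s i) = 1" using triv1[OF \<gamma>'(1,2)] by (simp add: power_sum)
    then have "(Q - 1) dvd (\<Sum>i\<in>I. s i)" using primitive_power_eq_1[OF _ \<gamma>'] by simp
    then obtain b where b: "(\<Sum>i\<in>I. s i) = (Q - 1) * b" by auto
    have geo: "(Q - 1) * (\<Sum>w<n. Q ^ w) = Q ^ n - 1" for n
      using sum_powers_nat[of Q n] Q_gt_1 by simp
    have "(Q - 1) * (\<Sum>x\<in>J. m x) = (Q - 1) * (\<Sum>i\<in>I. \<Sum>w<k i. Q ^ w * e i)"
      unfolding J_def m_def using finI by (subst sum.Sigma) auto
    also have "\<dots> = (\<Sum>i\<in>I. ((Q - 1) * (\<Sum>w<k i. Q ^ w)) * e i)"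
      by (simp add: sum_distrib_left sum_distrib_right mult.assoc)
    also have "\<dots> = (\<Sum>i\<in>I. d * s i)" unfolding geo by (intro sum.cong refl) (simp add: e N_def)
    also have "\<dots> = (Q - 1) * (d * b)" by (simp add: b mult_ac flip: sum_distrib_left)
    finally have "(\<Sum>x\<in>J. m x) = d * b" using Q1 by (simp only: nat_mult_eq_cancel1)
    then show ?thesis by simp
  qed
  from kummer_class_equidistribution[where c = c and m = m and ?x0.0 = "(i0, 0)", OF char d J c_neq m0 msum]
  obtain C M0 where CM: "\<forall>s M. M = CHAR('e) ^ s \<longrightarrow> M0 \<le> M \<longrightarrow> d dvd M - 1 \<longrightarrow> card {a::'e. a ^ (M * M) = a} = M * M \<longrightarrow>
     (\<forall>x\<in>J. c x ^ (M * M) = c x) \<longrightarrow> (\<forall>y. y ^ d = 1 \<longrightarrow>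
     \<bar>real (card {a. a ^ (M * M) = a \<and> (\<Prod>x\<in>J. (c x - a) ^ m x) ^ ((M * M - 1) div d) = y}) - real (M * M) / real d\<bar> \<le> C * real M)"
    by (elim exE)
  have q1: "q > 1" using Q_gt_1 Qq by (cases q) (auto simp: power2_eq_square intro: gr0I)
  \<comment> \<open>The product puts all conjugates into \<open>FL r\<close>. The factor 2 makes M =
    q^r a power of Q^(k i0), so that \<open>d\<close> divides M - 1 and not only M^2 - 1.\<close>
  define r0 where "r0 = 2 * (\<Prod>i\<in>I. k i)"
  have r0: "r0 > 0" using k_pos by (simp add: r0_def prod_pos)
  have bound: "cmod (\<Sum>a\<in>FL r. \<psi> (CP a r)) \<le> (real d * C) * real q ^ r" if r: "r0 dvd r" "max 1 M0 \<le> r" for r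
  proof -
    define M where "M = q ^ r"
    define L where "L = M * M"
    have LQ: "L = Q ^ r" by (simp add: L_def M_def Qq power2_eq_square power_mult_distrib)
    have r_pos: "r > 0" using r(2) by simp
    have kr: "k i dvd r" if "i \<in> I" for i
    proof -
      have "k i dvd (\<Prod>i\<in>I. k i)" using that finI by (rule dvd_prodI[rotated])
      then have "k i dvd r0" unfolding r0_def by (rule dvd_mult)
      then show ?thesis using r(1) by (rule dvd_trans)
    qed
    have N_dvd: "N i dvd Q ^ (k i * b) - 1" for i b
      unfolding N_def using Q_gt_1 by (intro power_minus_one_dvd) simp_all
    have Ms: "M = CHAR('e) ^ (u * r)" by (simp add: M_def q power_mult)
    have M0: "M0 \<le> M"
    proof -
      have "r < 2 ^ r" by (rule less_exp)
      also have "(2::nat) ^ r \<le> q ^ r" using q1 by (intro power_mono) auto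
      finally show ?thesis using r(2) by (simp add: M_def)
    qed
    have dM: "d dvd M - 1"
    proof -
      have "k i0 dvd (\<Prod>i\<in>I. k i)" using i0 finI by (rule dvd_prodI[rotated])
      then have "2 * k i0 dvd r0" unfolding r0_def by (rule mult_dvd_mono[OF dvd_refl])
      then have "2 * k i0 dvd r" using r(1) by (rule dvd_trans)
      then obtain b where b: "r = 2 * (k i0 * b)" by (elim dvdE) (simp only: mult.assoc)
      have "M = Q ^ (k i0 * b)" by (simp add: M_def b Qq power_mult)
      then show ?thesis using N_dvd[of i0 b] dN[OF i0] by auto
    qed
    have FLr: "{a::'e. a ^ (M * M) = a} = FL r" by (simp add: FL_def LQ[symmetric] L_def)
    then have cardL: "card {a::'e. a ^ (M * M) = a} = M * M" using card_FL[OF r_pos] LQ by (simp add: L_def)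
    have cF: "\<forall>x\<in>J. c x ^ (M * M) = c x"
    proof
      fix x assume "x \<in> J"
      then obtain i w where iw: "x = (i, w)" "i \<in> I" by (auto simp: J_def)
      have "\<beta> i \<in> FL r" using FL_mono[OF kr[OF iw(2)]] \<beta>_FL[OF iw(2)] by auto
      then have "c x \<in> FL r" by (simp add: c_def iw FL_power)
      then show "c x ^ (M * M) = c x" using FLr by blast
    qed
    define U where "U a = (\<Prod>x\<in>J. (c x - a) ^ m x) ^ ((L - 1) div d)" for a
    have dL: "d dvd Q ^ r - 1"
    proof -
      obtain b where "r = k i0 * b" using kr[OF i0] by auto
      then show ?thesis using N_dvd[of i0 b] dN[OF i0] by auto
    qed
    have vU: "v (CP a r) = U a" if a: "a \<in> FL r" for a
    proof -
      have "v (CP a r) = (\<Prod>i\<in>I. (\<Prod>w<k i. (\<beta> i ^ (Q ^ (k i - w)) - a) ^ (Q ^ w * e i)) ^ ((L - 1) div d))"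
        unfolding v_def e_def N_def LQ
        using CP_value_kummer[OF \<beta>_FL k_pos kr a s(1)] d1 dL by (intro prod.cong refl) auto
      also have "\<dots> = (\<Prod>i\<in>I. \<Prod>w<k i. (\<beta> i ^ (Q ^ (k i - w)) - a) ^ (Q ^ w * e i)) ^ ((L - 1) div d)"
        by (rule prod_power_distrib[symmetric])
      also have "\<dots> = U a" unfolding U_def J_def c_def m_def using finI
        by (subst prod.Sigma) (auto intro!: arg_cong[where f = "\<lambda>x. x ^ _"] prod.cong)
      finally show ?thesis .
    qed
    let ?\<mu> = "{y::'e. y ^ d = 1}"
    have fin\<mu>: "finite ?\<mu>" "card ?\<mu> \<le> d" using card_roots_of_unity_le[of d] d1 by auto
    define n where "n y = real (card {a \<in> FL r. U a = y})" for y
    have nC: "\<bar>n y - real L / real d\<bar> \<le> C * real M" if "y \<in> ?\<mu>" for y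
    proof -
      have "{a \<in> FL r. U a = y} = {a. a ^ (M * M) = a \<and> (\<Prod>x\<in>J. (c x - a) ^ m x) ^ ((M * M - 1) div d) = y}"
        using FLr unfolding U_def L_def by auto
      then show ?thesis using CM[rule_format, OF Ms M0 dM cardL, of y] cF that by (simp add: n_def L_def)
    qed
    have "(\<Sum>a\<in>FL r. \<psi> (CP a r)) = (\<Sum>a\<in>FL r. \<iota> (U a))"
      by (intro sum.cong refl) (simp add: \<psi>_def vU)
    also have "\<dots> = (\<Sum>y\<in>insert 0 ?\<mu>. \<Sum>a\<in>{a \<in> FL r. U a = y}. \<iota> (U a))"
    proof (rule sum.group[symmetric])
      show "U ` FL r \<subseteq> insert 0 ?\<mu>" using v01[OF CP_KX] vU by force
    qed (use finite_FL[OF r_pos] fin\<mu> in auto)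
    also have "\<dots> = (\<Sum>y\<in>insert 0 ?\<mu>. of_real (n y) * \<iota> y)" by (intro sum.cong refl) (simp add: n_def)
    also have "\<dots> = (\<Sum>y\<in>?\<mu>. of_real (n y) * \<iota> y)"
      using fin\<mu> \<iota>(1) d1 by (subst sum.insert) (auto simp: power_0_left)
    \<comment> \<open>Subtracting the common mean L / d leaves only the equidistribution errors,
      since the values of \<open>\<iota>\<close> sum to 0.\<close>
    also have "\<dots> = (\<Sum>y\<in>?\<mu>. of_real (n y - real L / real d) * \<iota> y) + of_real (real L / real d) * (\<Sum>y\<in>?\<mu>. \<iota> y)"
      unfolding sum_distrib_left sum.distrib[symmetric] by (intro sum.cong refl) (simp add: algebra_simps)
    also have "\<dots> = (\<Sum>y\<in>?\<mu>. of_real (n y - real L / real d) * \<iota> y)" using \<iota>(6) by simp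
    finally have "cmod (\<Sum>a\<in>FL r. \<psi> (CP a r)) = cmod (\<Sum>y\<in>?\<mu>. of_real (n y - real L / real d) * \<iota> y)" by simp
    also have "\<dots> \<le> (\<Sum>y\<in>?\<mu>. C * real M)"
    proof (rule sum_norm_le)
      fix y assume y: "y \<in> ?\<mu>"
      have "cmod (of_real (n y - real L / real d) * \<iota> y) = \<bar>n y - real L / real d\<bar> * cmod (\<iota> y)"
        by (simp add: norm_mult del: of_real_diff of_real_divide)
      also have "\<dots> \<le> (C * real M) * 1"
        using nC[OF y] \<iota>(4)[of y] by (intro mult_mono) auto
      finally show "cmod (of_real (n y - real L / real d) * \<iota> y) \<le> C * real M" by simp
    qed
    also have "\<dots> = real (card ?\<mu>) * (C * real M)" by simp
    also have "\<dots> \<le> real d * (C * real M)"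
    proof (rule mult_right_mono)
      show "real (card ?\<mu>) \<le> real d" using fin\<mu>(2) by simp
      have "1 \<in> ?\<mu>" by simp
      then show "0 \<le> C * real M" using nC[of 1] abs_ge_zero order_trans by blast
    qed
    finally show ?thesis by (simp add: M_def mult.assoc)
  qed
  have "cmod ((\<Sum>a\<in>FL 1. \<psi> (CP a 1)) + 1) \<le> (real (degree RR) - 2) * real q"
  proof (rule character_sum_bound[OF _ r0])
    show "cmod (\<Sum>a\<in>FL r. \<psi> (CP a r)) \<le> (real d * C) * real q ^ r" if "r0 dvd r" "max 1 M0 \<le> r" for r
      using bound that .
  qed (use q1 in simp)
  also have "(\<Sum>a\<in>FL 1. \<psi> (CP a 1)) = (\<Sum>a\<in>FL 1. 1)"
    by (intro sum.cong refl) (simp add: \<psi>_def v_def CP_def triv2 \<iota>(2))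
  also have "cmod ((\<Sum>a\<in>FL 1. 1) + 1) = real Q + 1"
  proof -
    have "(\<Sum>a\<in>FL 1. 1 :: complex) + 1 = of_real (real Q + 1)" using card_FL[of 1] by simp
    then show ?thesis by (simp only: norm_of_real)
  qed
  also have "(real (degree RR) - 2) * real q \<le> real q * real q"
  proof (rule mult_right_mono)
    have "real (degree RR) \<le> real (q + 2)" using deg unfolding degree_RR by (simp only: of_nat_le_iff)
    then show "real (degree RR) - 2 \<le> real q" by simp
  qed simp
  also have "real q * real q = real Q" by (simp add: Qq power2_eq_square)
  finally show False by simp
qed

end

section \<open>Generators of the unit group\<close>

text \<open>A maximal proper subgroup \<open>K\<close> above \<open>H\<close> has a quotient of
  prime order, generated by any \<open>w\<close> outside \<open>K\<close>. The value of
  \<open>\<phi>\<close> is the exponent of \<open>w\<close> modulo \<open>K\<close>, hence an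
  integer that matters modulo \<open>d\<close> only.\<close>

lemma (in comm_group) proper_subgroup_character:
  assumes fin: "finite (carrier G)" and H: "subgroup H G" "H \<noteq> carrier G"
  shows "\<exists>(d::nat) \<phi> :: 'a \<Rightarrow> int. prime d \<and> (\<forall>x\<in>carrier G. \<forall>y\<in>carrier G. [\<phi> (x \<otimes> y) = \<phi> x + \<phi> y] (mod int d)) \<and>
    (\<forall>h\<in>H. [\<phi> h = 0] (mod int d)) \<and> (\<exists>x\<in>carrier G. \<not> [\<phi> x = 0] (mod int d))"
proof -
  let ?S = "{K. subgroup K G \<and> K \<noteq> carrier G}"
  have finS: "finite ?S" by (rule finite_subset[of _ "Pow (carrier G)"]) (use fin subgroup.subset in auto)
  have HS: "H \<in> ?S" using H by simp
  from finite_has_maximal2[OF finS HS] obtain K where K: "K \<in> ?S" "H \<subseteq> K" and max: "\<forall>K'\<in>?S. K \<subseteq> K' \<longrightarrow> K = K'"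
    by (elim bexE conjE)
  have subK: "subgroup K G" using K by simp
  interpret K: subgroup K G by (rule subK)
  obtain w where w: "w \<in> carrier G" "w \<notin> K" using K(1) K.subset by blast
  \<comment> \<open>Adjoining \<open>x\<close> to \<open>K\<close> gives a strictly larger subgroup,
    which is everything by maximality.\<close>
  have span: "\<exists>\<kappa>\<in>K. \<exists>i::int. y = \<kappa> \<otimes> x [^] i" if x: "x \<in> carrier G" "x \<notin> K" and y: "y \<in> carrier G" for x y
  proof -
    define L where "L = {\<kappa> \<otimes> x [^] i | \<kappa> i. \<kappa> \<in> K \<and> (i::int) \<in> UNIV}"
    have "subgroup L G"
    proof (rule subgroupI)
      show "L \<subseteq> carrier G" using x K.subset by (auto simp: L_def)
      show "L \<noteq> {}" using K.one_closed unfolding L_def by blast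
    next
      fix a assume "a \<in> L"
      then obtain \<kappa> i where a: "a = \<kappa> \<otimes> x [^] (i::int)" "\<kappa> \<in> K" by (auto simp: L_def)
      have "inv a = inv \<kappa> \<otimes> x [^] (- i)" using a x by (simp add: inv_mult int_pow_neg)
      then show "inv a \<in> L" using K.m_inv_closed[OF a(2)] unfolding L_def by blast
    next
      fix a b assume "a \<in> L" "b \<in> L"
      then obtain \<kappa> i \<kappa>' i' where a: "a = \<kappa> \<otimes> x [^] (i::int)" "\<kappa> \<in> K" "b = \<kappa>' \<otimes> x [^] (i'::int)" "\<kappa>' \<in> K"
        by (auto simp: L_def)
      have "a \<otimes> b = (\<kappa> \<otimes> \<kappa>') \<otimes> x [^] (i + i')"
        using a x by (simp add: int_pow_mult m_ac)
      then show "a \<otimes> b \<in> L" using K.m_closed[OF a(2,4)] unfolding L_def by blast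
    qed
    moreover have "K \<subseteq> L"
    proof
      fix \<kappa> assume \<kappa>: "\<kappa> \<in> K"
      then have "\<kappa> = \<kappa> \<otimes> x [^] (0::int)" by simp
      then show "\<kappa> \<in> L" unfolding L_def using \<kappa> by blast
    qed
    moreover have "x \<in> L"
    proof -
      have "x = \<one> \<otimes> x [^] (1::int)" using x by simp
      then show ?thesis unfolding L_def using K.one_closed by blast
    qed
    ultimately have "L = carrier G" using max x(2) by blast
    then show ?thesis using y unfolding L_def by blast
  qed
  define d where "d = (LEAST n::nat. n > 0 \<and> w [^] n \<in> K)"
  have "w [^] Coset.order G \<in> K" using pow_order_eq_1[OF w(1)] K.one_closed by simp
  moreover have "Coset.order G > 0" using fin by (simp add: order_gt_0_iff_finite)
  ultimately have d: "d > 0" "w [^] d \<in> K" and least: "\<And>n. n > 0 \<Longrightarrow> w [^] n \<in> K \<Longrightarrow> d \<le> n"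
    unfolding d_def using LeastI[of "\<lambda>n. n > 0 \<and> w [^] n \<in> K" "Coset.order G"] Least_le[of "\<lambda>n. n > 0 \<and> w [^] n \<in> K"] by auto
  have powK: "w [^] (z::int) \<in> K \<longleftrightarrow> int d dvd z" for z
  proof -
    have wd: "w [^] (int d * (z div int d)) \<in> K"
    proof -
      have "w [^] (int d * (z div int d)) = (w [^] d) [^] (z div int d)"
        using int_pow_pow[OF w(1), of "int d" "z div int d"] by (simp only: int_pow_int)
      then show ?thesis using subgroup_int_pow_closed[OF subK d(2)] by simp
    qed
    have "w [^] z = w [^] (int d * (z div int d)) \<otimes> w [^] (z mod int d)"
      using w(1) by (simp flip: int_pow_mult)
    moreover have "A \<otimes> B \<in> K \<longleftrightarrow> B \<in> K" if "A \<in> K" "B \<in> carrier G" for A B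
    proof
      assume "A \<otimes> B \<in> K"
      then have "inv A \<otimes> (A \<otimes> B) \<in> K" using that K.m_closed K.m_inv_closed by blast
      moreover have "inv A \<otimes> (A \<otimes> B) = B" using that K.mem_carrier[OF that(1)] by (simp add: m_assoc[symmetric])
      ultimately show "B \<in> K" by simp
    qed (use that in \<open>simp add: K.m_closed\<close>)
    ultimately have "w [^] z \<in> K \<longleftrightarrow> w [^] (z mod int d) \<in> K" using wd w(1) int_pow_closed by (simp only:)
    also have "w [^] (z mod int d) = w [^] nat (z mod int d)"
      using d(1) by (simp add: int_pow_def2)
    also have "w [^] nat (z mod int d) \<in> K \<longleftrightarrow> nat (z mod int d) = 0"
    proof
      assume a: "w [^] nat (z mod int d) \<in> K"
      have "nat (z mod int d) < d" using d(1) by (simp add: nat_less_iff)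
      then show "nat (z mod int d) = 0" using least[OF _ a] by linarith
    qed (use K.one_closed in simp)
    also have "\<dots> \<longleftrightarrow> int d dvd z"
    proof -
      have "z mod int d \<ge> 0" using d(1) by simp
      then show ?thesis by (auto simp: dvd_eq_mod_eq_0)
    qed
    finally show ?thesis .
  qed
  have d1: "d > 1"
  proof -
    have "d \<noteq> 1" using d(2) w by auto
    then show ?thesis using d(1) by simp
  qed
  \<comment> \<open>For a divisor \<open>r\<close> strictly between 1 and \<open>d\<close>, the
    power of \<open>w\<close> to \<open>r\<close> lies outside \<open>K\<close>, so
    \<open>span\<close> recovers \<open>w\<close> from it. Then some 1 - r * i is a multiple of
    \<open>d\<close>, thus of \<open>r\<close>, which forces r = 1.\<close>
  have "prime d"
    unfolding prime_nat_iff
  proof (intro conjI allI impI)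
    show "1 < d" by (rule d1)
  next
    fix r assume r: "r dvd d"
    show "r = 1 \<or> r = d"
    proof (rule ccontr)
      assume "\<not> (r = 1 \<or> r = d)"
      then have r': "r \<noteq> 1" "r < d" "r > 0" using r d(1) dvd_imp_le[OF r] by (auto intro!: gr0I)
      then have "w [^] r \<notin> K" using least[of r] by auto
      then obtain \<kappa> i where ki: "\<kappa> \<in> K" "w = \<kappa> \<otimes> (w [^] r) [^] (i::int)" using span[of "w [^] r" w] w(1) by auto
      have "(w [^] r) [^] i = w [^] (int r * i)" using int_pow_pow[OF w(1), of "int r" i] by (simp only: int_pow_int)
      then have "w = \<kappa> \<otimes> w [^] (int r * i)" using ki(2) by simp
      then have "\<kappa> = w \<otimes> inv (w [^] (int r * i))"
        using inv_solve_right[of \<kappa> w "w [^] (int r * i)"] K.mem_carrier[OF ki(1)] w(1) by simp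
      then have "w [^] (1 - int r * i) = \<kappa>" using w(1) by (simp add: int_pow_diff)
      then have "int d dvd 1 - int r * i" using powK ki(1) by blast
      then have "int r dvd 1 - int r * i" using dvd_trans[of "int r" "int d"] r by simp
      then have "int r dvd 1" using dvd_add[of "int r" "1 - int r * i" "int r * i"] by simp
      then show False using r'(1) by simp
    qed
  qed
  define \<phi> where "\<phi> y = (SOME i::int. \<exists>\<kappa>\<in>K. y = \<kappa> \<otimes> w [^] i)" for y
  have \<phi>: "\<exists>\<kappa>\<in>K. y = \<kappa> \<otimes> w [^] \<phi> y" if "y \<in> carrier G" for y
  proof -
    have "\<exists>i::int. \<exists>\<kappa>\<in>K. y = \<kappa> \<otimes> w [^] i" using span[OF w that] by blast
    then show ?thesis unfolding \<phi>_def by (rule someI_ex)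
  qed
  have \<phi>_unique: "[\<phi> y = i] (mod int d)" if "\<kappa> \<in> K" "y = \<kappa> \<otimes> w [^] i" for y \<kappa> i
  proof -
    have yc: "y \<in> carrier G" using that w(1) by simp
    obtain \<kappa>' where k': "\<kappa>' \<in> K" "y = \<kappa>' \<otimes> w [^] \<phi> y" using \<phi>[OF yc] by auto
    have "w [^] (\<phi> y - i) = inv \<kappa>' \<otimes> \<kappa>"
    proof -
      have "\<kappa>' \<otimes> w [^] \<phi> y = \<kappa> \<otimes> w [^] i" using k' that by simp
      then have "w [^] \<phi> y = inv \<kappa>' \<otimes> (\<kappa> \<otimes> w [^] i)"
        using inv_solve_left[of "w [^] \<phi> y" \<kappa>' "\<kappa> \<otimes> w [^] i"] K.mem_carrier[OF k'(1)] K.mem_carrier[OF that(1)] w(1)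
        by simp
      then show ?thesis using k'(1) that(1) w(1) by (simp add: int_pow_diff m_assoc)
    qed
    then have "w [^] (\<phi> y - i) \<in> K" using k'(1) that(1) by (simp add: K.m_closed K.m_inv_closed)
    then show ?thesis by (simp add: powK cong_iff_dvd_diff)
  qed
  have "[\<phi> (x \<otimes> y) = \<phi> x + \<phi> y] (mod int d)" if xy: "x \<in> carrier G" "y \<in> carrier G" for x y
  proof -
    obtain \<kappa> \<kappa>' where k: "\<kappa> \<in> K" "x = \<kappa> \<otimes> w [^] \<phi> x" "\<kappa>' \<in> K" "y = \<kappa>' \<otimes> w [^] \<phi> y"
      using \<phi>[OF xy(1)] \<phi>[OF xy(2)] by blast
    have "x \<otimes> y = (\<kappa> \<otimes> w [^] \<phi> x) \<otimes> (\<kappa>' \<otimes> w [^] \<phi> y)" using k(2,4) by simp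
    also have "\<dots> = (\<kappa> \<otimes> \<kappa>') \<otimes> w [^] (\<phi> x + \<phi> y)"
      using k(1,3) w(1) by (simp add: int_pow_mult m_ac)
    finally show ?thesis by (rule \<phi>_unique[OF K.m_closed[OF k(1,3)]])
  qed
  moreover have "[\<phi> h = 0] (mod int d)" if "h \<in> H" for h
    using that K(2) by (intro \<phi>_unique[of h]) auto
  moreover have "\<not> [\<phi> w = 0] (mod int d)"
  proof
    assume "[\<phi> w = 0] (mod int d)"
    moreover have "[\<phi> w = 1] (mod int d)" using w(1) K.one_closed by (intro \<phi>_unique[of \<one>]) auto
    ultimately have "[1 = 0] (mod int d)" using cong_trans cong_sym by blast
    then show False using d1 by (simp add: cong_iff_dvd_diff)
  qed
  ultimately show ?thesis using \<open>prime d\<close> w(1) by blast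
qed

section \<open>The product of the multiplicative groups\<close>

context frobenius begin

definition UG :: "nat \<Rightarrow> 'e monoid" where
  "UG j = \<lparr>carrier = FL j - {0}, monoid.mult = (*), one = 1\<rparr>"

lemma UG_simps [simp]: "carrier (UG j) = FL j - {0}" "x \<otimes>\<^bsub>UG j\<^esub> y = x * y" "\<one>\<^bsub>UG j\<^esub> = 1"
  by (simp_all add: UG_def)

lemma comm_group_UG: "comm_group (UG j)"
proof (rule comm_groupI)
  fix x assume "x \<in> carrier (UG j)"
  then show "\<exists>y\<in>carrier (UG j). y \<otimes>\<^bsub>UG j\<^esub> x = \<one>\<^bsub>UG j\<^esub>"
    by (intro bexI[of _ "inverse x"]) (simp_all add: FL_closed)
qed (auto simp: FL_closed)

end

context conjugates begin

abbreviation WG where "WG \<equiv> product_group I (\<lambda>i. UG (k i))"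

lemma comm_group_WG: "comm_group WG"
proof (rule group.group_comm_groupI)
  show "group WG" using comm_group_UG by (intro product_group) (auto simp: comm_group_def)
qed (auto simp: fun_eq_iff mult.commute)

text \<open>A proper \<open>H\<close> would be annihilated by a character of prime order. The
  factors of \<open>WG\<close> are cyclic, so the character is determined by its values on their
  generators and can be rewritten as a product of powers \<open>w i ^ s i\<close> inside the
  closure; \<open>no_annihilating_exponents\<close> excludes this.\<close>

lemma subgroup_eq_WG:
  assumes H: "subgroup H WG" and k2: "\<And>i. i \<in> I \<Longrightarrow> k i \<ge> 2"
    and Qq: "Q = q ^ 2" and q: "q = CHAR('e) ^ u" and deg: "(\<Sum>i\<in>I. k i) \<le> q + 2"
    and const: "\<And>c. c \<in> FL 1 \<Longrightarrow> c \<noteq> 0 \<Longrightarrow> (\<lambda>i\<in>I. c) \<in> H"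
    and lin: "\<And>a. a \<in> FL 1 \<Longrightarrow> (\<lambda>i\<in>I. \<beta> i - a) \<in> H"
  shows "H = carrier WG"
proof (rule ccontr)
  assume neq: "H \<noteq> carrier WG"
  interpret W: comm_group WG by (rule comm_group_WG)
  have "finite (carrier WG)" using finI finite_FL k_pos by (auto intro!: finite_PiE)
  from W.proper_subgroup_character[OF this H neq] obtain d :: nat and \<phi> :: "('i \<Rightarrow> 'e) \<Rightarrow> int" where
    d: "prime d" and \<phi>_mult: "\<And>x y. x \<in> carrier WG \<Longrightarrow> y \<in> carrier WG \<Longrightarrow> [\<phi> (x \<otimes>\<^bsub>WG\<^esub> y) = \<phi> x + \<phi> y] (mod int d)"
    and \<phi>_H: "\<And>h. h \<in> H \<Longrightarrow> [\<phi> h = 0] (mod int d)" and \<phi>_nt: "\<exists>x\<in>carrier WG. \<not> [\<phi> x = 0] (mod int d)"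
    by blast
  have d1: "d > 1" using d prime_gt_1_nat by blast
  define N where "N i = Q ^ k i - 1" for i
  have "\<exists>g. \<forall>i\<in>I. g i \<in> FL (k i) \<and> g i \<noteq> 0 \<and> (\<forall>x\<in>FL (k i). x \<noteq> 0 \<longrightarrow> (\<exists>n. x = g i ^ n))"
    using FL_primitive[OF k_pos] by (intro bchoice) metis
  then obtain \<gamma> where \<gamma>: "\<And>i. i \<in> I \<Longrightarrow> \<gamma> i \<in> FL (k i)" "\<And>i. i \<in> I \<Longrightarrow> \<gamma> i \<noteq> 0"
    "\<And>i x. i \<in> I \<Longrightarrow> x \<in> FL (k i) \<Longrightarrow> x \<noteq> 0 \<Longrightarrow> \<exists>n. x = \<gamma> i ^ n" by metis
  have \<gamma>1: "\<gamma> i ^ n = 1 \<longleftrightarrow> N i dvd n" if "i \<in> I" for i n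
    unfolding N_def using primitive_power_eq_1[OF k_pos[OF that] \<gamma>(1,2)[OF that] \<gamma>(3)[OF that]] .
  define sg where "sg i z = (\<lambda>j\<in>I. if j = i then z else 1)" for i and z :: 'e
  have sg_c: "sg i z \<in> carrier WG" if "z \<in> FL (k i)" "z \<noteq> 0" for i z
    using that FL_closed(2) by (auto simp: sg_def)
  have \<phi>_one: "[\<phi> \<one>\<^bsub>WG\<^esub> = 0] (mod int d)"
    by (rule \<phi>_H) (rule subgroup.one_closed[OF H])
  have \<phi>_sg: "[\<phi> (sg i (\<gamma> i ^ n)) = int n * \<phi> (sg i (\<gamma> i))] (mod int d)" if i: "i \<in> I" for i n
  proof (induction n)
    case 0
    have e: "sg i (\<gamma> i ^ 0) = \<one>\<^bsub>WG\<^esub>" by (auto simp: sg_def fun_eq_iff)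
    show ?case unfolding e using \<phi>_one by (simp only: of_nat_0 mult_zero_left)
  next
    case (Suc n)
    have "sg i (\<gamma> i ^ Suc n) = sg i (\<gamma> i) \<otimes>\<^bsub>WG\<^esub> sg i (\<gamma> i ^ n)" by (auto simp: sg_def fun_eq_iff)
    then have "[\<phi> (sg i (\<gamma> i ^ Suc n)) = \<phi> (sg i (\<gamma> i)) + \<phi> (sg i (\<gamma> i ^ n))] (mod int d)"
      using \<phi>_mult[OF sg_c sg_c] \<gamma>(1,2)[OF i] by (simp add: FL_power)
    also have "[\<phi> (sg i (\<gamma> i)) + \<phi> (sg i (\<gamma> i ^ n)) = \<phi> (sg i (\<gamma> i)) + int n * \<phi> (sg i (\<gamma> i))] (mod int d)"
      by (intro cong_add cong_refl Suc)
    finally show ?case by (simp add: algebra_simps)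
  qed
  have \<phi>_prod: "[\<phi> w = (\<Sum>i\<in>I. \<phi> (sg i (w i)))] (mod int d)" if w: "w \<in> carrier WG" for w
  proof -
    have wi: "w i \<in> FL (k i)" "w i \<noteq> 0" if "i \<in> I" for i using w that by auto
    define wr where "wr A = (\<lambda>j\<in>I. if j \<in> A then w j else 1)" for A
    have wr_c: "wr A \<in> carrier WG" for A using wi FL_closed(2) by (auto simp: wr_def)
    have claim: "[\<phi> (wr A) = (\<Sum>i\<in>A. \<phi> (sg i (w i)))] (mod int d)" if "A \<subseteq> I" for A
      using finite_subset[OF that finI] that
    proof (induction A rule: finite_induct)
      case empty
      have e: "wr {} = \<one>\<^bsub>WG\<^esub>" by (auto simp: fun_eq_iff wr_def)
      show ?case unfolding e using \<phi>_one by (simp only: sum.empty)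
    next
      case (insert i A)
      have i: "i \<in> I" using insert by simp
      have e: "wr (insert i A) = sg i (w i) \<otimes>\<^bsub>WG\<^esub> wr A"
        using insert by (auto simp: sg_def fun_eq_iff wr_def)
      have "[\<phi> (wr (insert i A)) = \<phi> (sg i (w i)) + \<phi> (wr A)] (mod int d)"
        unfolding e by (rule \<phi>_mult[OF sg_c[OF wi[OF i]] wr_c])
      also have "[\<phi> (sg i (w i)) + \<phi> (wr A) = \<phi> (sg i (w i)) + (\<Sum>i\<in>A. \<phi> (sg i (w i)))] (mod int d)"
        using insert by (intro cong_add cong_refl) auto
      finally show ?case using insert by simp
    qed
    have e: "wr I = w" using w by (auto simp: fun_eq_iff PiE_def extensional_def wr_def)
    show ?thesis using claim[OF subset_refl] unfolding e .
  qed
  define t where "t i = nat (\<phi> (sg i (\<gamma> i)) mod int d)" for i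
  have t: "[int (t i) = \<phi> (sg i (\<gamma> i))] (mod int d)" for i
    using d1 by (simp add: t_def cong_def)
  \<comment> \<open>Because of this, \<open>\<eta> ^ t i\<close> below has order dividing
    \<open>N i\<close>, so it lies in \<open>FL (k i)\<close> and is a power of the generator
    there.\<close>
  have tN: "d dvd N i * t i" if i: "i \<in> I" for i
  proof -
    have "[int (N i) * \<phi> (sg i (\<gamma> i)) = \<phi> (sg i (\<gamma> i ^ N i))] (mod int d)" using \<phi>_sg[OF i] by (rule cong_sym)
    also have "\<gamma> i ^ N i = \<gamma> i ^ 0" using \<gamma>1[OF i] by simp
    also have "[\<phi> (sg i (\<gamma> i ^ 0)) = int 0 * \<phi> (sg i (\<gamma> i))] (mod int d)" using \<phi>_sg[OF i] .
    finally have "[int (N i) * \<phi> (sg i (\<gamma> i)) = 0] (mod int d)" by simp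
    moreover have "[int (N i) * int (t i) = int (N i) * \<phi> (sg i (\<gamma> i))] (mod int d)" by (intro cong_mult cong_refl t)
    ultimately have "[int (N i) * int (t i) = 0] (mod int d)" using cong_trans by blast
    then have "int d dvd int (N i * t i)" by (simp add: cong_0_iff)
    then show ?thesis by (simp only: int_dvd_int_iff)
  qed
  have \<phi>_val: "[\<phi> w = int (\<Sum>i\<in>I. n i * t i)] (mod int d)" if w: "w \<in> carrier WG" and n: "\<And>i. i \<in> I \<Longrightarrow> w i = \<gamma> i ^ n i" for w n
  proof -
    have "[(\<Sum>i\<in>I. \<phi> (sg i (w i))) = (\<Sum>i\<in>I. int (n i) * int (t i))] (mod int d)"
    proof (rule cong_sum)
      fix i assume i: "i \<in> I"
      have "[\<phi> (sg i (w i)) = int (n i) * \<phi> (sg i (\<gamma> i))] (mod int d)" using \<phi>_sg[OF i] n[OF i] by simp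
      also have "[int (n i) * \<phi> (sg i (\<gamma> i)) = int (n i) * int (t i)] (mod int d)" by (intro cong_mult cong_refl cong_sym[OF t])
      finally show "[\<phi> (sg i (w i)) = int (n i) * int (t i)] (mod int d)" .
    qed
    then show ?thesis using cong_trans[OF \<phi>_prod[OF w]] by simp
  qed
  have dlog: "\<exists>n. \<forall>i\<in>I. w i = \<gamma> i ^ n i" if "w \<in> carrier WG" for w
    using that \<gamma>(3) by (intro bchoice ballI) auto
  obtain i1 where i1: "i1 \<in> I" "\<not> d dvd t i1"
  proof -
    obtain x where x: "x \<in> carrier WG" "\<not> [\<phi> x = 0] (mod int d)" using \<phi>_nt by auto
    obtain n where n: "\<And>i. i \<in> I \<Longrightarrow> x i = \<gamma> i ^ n i" using dlog[OF x(1)] by auto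
    have "\<exists>i\<in>I. \<not> d dvd t i"
    proof (rule ccontr)
      assume "\<not> (\<exists>i\<in>I. \<not> d dvd t i)"
      then have "d dvd (\<Sum>i\<in>I. n i * t i)" by (intro dvd_sum) auto
      then have "[int (\<Sum>i\<in>I. n i * t i) = 0] (mod int d)" by (simp only: cong_0_iff int_dvd_int_iff)
      then show False using \<phi>_val[OF x(1) n] x(2) cong_trans by blast
    qed
    then show ?thesis using that by blast
  qed
  have "d dvd N i1" using tN[OF i1(1)] i1(2) d by (simp add: prime_dvd_mult_iff)
  then obtain h where h: "N i1 = d * h" by auto
  have "N i1 > 0" using Q_pow_gt_1[OF k_pos[OF i1(1)]] by (simp add: N_def)
  then have h0: "h > 0" using h by (cases h) auto
  \<comment> \<open>A primitive d-th root of unity, which turns the additive values modulo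
    \<open>d\<close> into field elements. It exists because the prime \<open>d\<close> divides
    \<open>N i1 * t i1\<close> but not \<open>t i1\<close>.\<close>
  define \<eta> where "\<eta> = \<gamma> i1 ^ h"
  have \<eta>: "\<eta> ^ j = 1 \<longleftrightarrow> d dvd j" for j
    unfolding \<eta>_def power_mult[symmetric] \<gamma>1[OF i1(1)] h using h0 by (simp add: mult.commute)
  have \<eta>0: "\<eta> \<noteq> 0" using \<gamma>(2)[OF i1(1)] by (simp add: \<eta>_def)
  have "\<exists>s. \<forall>i\<in>I. \<eta> ^ t i = \<gamma> i ^ s i"
  proof (intro bchoice ballI)
    fix i assume i: "i \<in> I"
    have "(\<eta> ^ t i) ^ N i = 1" using tN[OF i] \<eta> by (simp add: mult.commute flip: power_mult)
    moreover have "(\<eta> ^ t i) ^ (Q ^ k i) = \<eta> ^ t i * (\<eta> ^ t i) ^ N i"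
    proof -
      have "Suc (N i) = Q ^ k i" using Q_pow_pos[of "k i"] by (simp only: N_def Suc_diff_1)
      then show ?thesis by (simp only: power_Suc[symmetric])
    qed
    ultimately have "\<eta> ^ t i \<in> FL (k i)" by (simp only: FL_iff mult_1_right)
    then show "\<exists>n. \<eta> ^ t i = \<gamma> i ^ n" using \<gamma>(3)[OF i] \<eta>0 by simp
  qed
  then obtain s where s: "\<And>i. i \<in> I \<Longrightarrow> \<eta> ^ t i = \<gamma> i ^ s i" by auto
  have sN: "N i dvd d * s i" if i: "i \<in> I" for i
  proof -
    have "\<gamma> i ^ (d * s i) = (\<gamma> i ^ s i) ^ d" by (simp add: mult.commute flip: power_mult)
    also have "\<dots> = 1" unfolding s[OF i, symmetric] using \<eta>[of "t i * d"] by (simp add: power_mult)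
    finally show ?thesis using \<gamma>1[OF i] by simp
  qed
  have ann: "(\<Prod>i\<in>I. w i ^ s i) = 1" if "w \<in> H" for w
  proof -
    have w: "w \<in> carrier WG" using that subgroup.subset[OF H] by blast
    obtain n where n: "\<And>i. i \<in> I \<Longrightarrow> w i = \<gamma> i ^ n i" using dlog[OF w] by auto
    have "(\<Prod>i\<in>I. w i ^ s i) = (\<Prod>i\<in>I. \<eta> ^ (n i * t i))"
    proof (rule prod.cong[OF refl])
      fix i assume i: "i \<in> I"
      have "w i ^ s i = (\<gamma> i ^ s i) ^ n i" by (simp add: n[OF i] mult.commute flip: power_mult)
      then show "w i ^ s i = \<eta> ^ (n i * t i)" by (simp add: s[OF i, symmetric] mult.commute flip: power_mult)
    qed
    also have "\<dots> = \<eta> ^ (\<Sum>i\<in>I. n i * t i)" by (rule power_sum[symmetric])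
    also have "\<dots> = 1"
    proof -
      have "[int (\<Sum>i\<in>I. n i * t i) = 0] (mod int d)"
        using cong_trans[OF cong_sym[OF \<phi>_val[OF w n]] \<phi>_H[OF that]] .
      then show ?thesis unfolding \<eta> by (simp only: cong_0_iff int_dvd_int_iff)
    qed
    finally show ?thesis .
  qed
  \<comment> \<open>Factors on which the character is trivial are dropped; this only lowers the
    degree, so the bound q + 2 survives.\<close>
  define I' where "I' = {i\<in>I. \<not> N i dvd s i}"
  have ann': "(\<Prod>i\<in>I'. w i ^ s i) = 1" if "w \<in> H" for w
  proof -
    have "(\<Prod>i\<in>I. w i ^ s i) = (\<Prod>i\<in>I'. w i ^ s i)"
    proof (rule prod.mono_neutral_right[OF finI])
      show "\<forall>i\<in>I - I'. w i ^ s i = 1"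
      proof
        fix i assume i: "i \<in> I - I'"
        then obtain b where b: "s i = N i * b" by (auto simp: I'_def)
        have "w i \<in> FL (k i)" "w i \<noteq> 0" using that subgroup.subset[OF H] i by auto
        then have "w i ^ N i = 1" unfolding N_def by (rule FL_power_order)
        then show "w i ^ s i = 1" by (simp add: b power_mult)
      qed
    qed (auto simp: I'_def)
    then show ?thesis using ann[OF that] by simp
  qed
  interpret I': conjugates Q ty I' \<beta> k
  proof
    show "inj_on (\<lambda>(i, t). \<beta> i ^ (Q ^ t)) (SIGMA i:I'. {..<k i})"
      by (rule inj_on_subset[OF distinct_conj]) (auto simp: I'_def)
  qed (use finI k_pos \<beta>_FL in \<open>auto simp: I'_def\<close>)
  show False
  proof (rule I'.no_annihilating_exponents[OF _ Qq q d])
    have "\<gamma> i1 ^ s i1 \<noteq> 1" using s[OF i1(1)] \<eta> i1(2) by metis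
    then have "i1 \<in> I'" using i1(1) \<gamma>1[OF i1(1)] by (simp add: I'_def)
    then show "I' \<noteq> {}" by auto
    show "Q ^ k i - 1 dvd d * s i" "\<not> Q ^ k i - 1 dvd s i" if "i \<in> I'" for i
      using that sN[of i] by (simp_all add: I'_def N_def)
    have "(\<Sum>i\<in>I'. k i) \<le> (\<Sum>i\<in>I. k i)" using finI by (intro sum_mono2) (auto simp: I'_def)
    then show "(\<Sum>i\<in>I'. k i) \<le> q + 2" using deg by simp
    have sub: "I' \<subseteq> I" by (auto simp: I'_def)
    show "(\<Prod>i\<in>I'. c ^ s i) = 1" if "c \<in> FL 1" "c \<noteq> 0" for c
    proof -
      have "(\<Prod>i\<in>I'. c ^ s i) = (\<Prod>i\<in>I'. (\<lambda>i\<in>I. c) i ^ s i)" using sub by (intro prod.cong) auto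
      then show ?thesis using ann'[OF const[OF that]] by simp
    qed
    show "(\<Prod>i\<in>I'. (\<beta> i - a) ^ s i) = 1" if "a \<in> FL 1" for a
    proof -
      have "(\<Prod>i\<in>I'. (\<beta> i - a) ^ s i) = (\<Prod>i\<in>I'. (\<lambda>i\<in>I. \<beta> i - a) i ^ s i)" using sub by (intro prod.cong) auto
      then show ?thesis using ann'[OF lin[OF that]] by simp
    qed
  qed
qed

end

section \<open>Irreducible polynomials over finite fields\<close>

abbreviation acp :: "'a::field poly \<Rightarrow> 'a alg_closure poly" where "acp \<equiv> map_poly to_ac"

lemma coeff_acp [simp]: "coeff (acp p) i = to_ac (coeff p i)"
  by (simp add: coeff_map_poly)

lemma acp_mult: "acp (p * r) = acp p * acp r"
  by (simp add: poly_eq_iff coeff_mult to_ac_sum)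

lemma acp_diff: "acp (p - r) = acp p - acp r"
  by (simp add: poly_eq_iff)

lemma acp_1 [simp]: "acp 1 = 1"
  by (simp add: poly_eq_iff coeff_1)

lemma acp_prod: "acp (prod f A) = (\<Prod>x\<in>A. acp (f x))"
  by (induction A rule: infinite_finite_induct) (auto simp: acp_mult)

lemma acp_power: "acp (p ^ n) = acp p ^ n"
  by (induction n) (auto simp: acp_mult)

lemma degree_acp [simp]: "degree (acp p) = degree p"
  by (rule degree_map_poly) auto

lemma acp_eq_0_iff [simp]: "acp p = 0 \<longleftrightarrow> p = 0"
  by (simp add: poly_eq_iff)

lemma finite_field_power_card:
  fixes x :: "'a::{field,finite}"
  shows "x ^ card (UNIV :: 'a set) = x"
proof (cases "x = 0")
  case False
  have "bij_betw (\<lambda>y. x * y) (- {0}) (- {0 :: 'a})"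
    using False by (intro bij_betw_byWitness[where f' = "\<lambda>y. y / x"]) auto
  then have "(\<Prod>y\<in>-{0::'a}. y) = (\<Prod>y\<in>-{0}. x * y)" by (rule prod.reindex_bij_betw[symmetric])
  also have "\<dots> = x ^ card (- {0::'a}) * (\<Prod>y\<in>-{0}. y)" by (simp add: prod.distrib)
  finally have "x ^ card (- {0::'a}) = 1" by (simp add: prod_zero_iff)
  moreover have "card (UNIV :: 'a set) = Suc (card (- {0::'a}))"
    by (simp add: Compl_eq_Diff_UNIV card_Diff_singleton card_gt_0_iff)
  ultimately show ?thesis by simp
qed (simp add: power_0_left)

lemma prime_CHAR_finite_field: "prime CHAR('a::{field,finite})"
  by (intro prime_CHAR_semidom finite_imp_CHAR_pos) auto

lemma CHAR_dvd_card_finite_field: "CHAR('a::{field,finite}) dvd card (UNIV :: 'a set)"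
proof -
  have "bij_betw (\<lambda>y. y + 1) UNIV (UNIV :: 'a set)"
    by (intro bij_betw_byWitness[where f' = "\<lambda>y. y - 1"]) auto
  then have "(\<Sum>y\<in>UNIV. y) = (\<Sum>y\<in>UNIV. y + (1::'a))" by (rule sum.reindex_bij_betw[symmetric])
  then have "of_nat (card (UNIV :: 'a set)) = (0 :: 'a)" by (simp add: sum.distrib)
  then show ?thesis by (simp add: of_nat_eq_0_iff_char_dvd)
qed

lemma primepow_card_imp_CHAR_power:
  assumes "primepow q" "card (UNIV :: 'a::{field,finite} set) = q ^ n"
  shows "\<exists>u>0. q = CHAR('a) ^ u"
proof -
  obtain p u where p: "prime p" "u > 0" "q = p ^ u" using assms(1) by (auto simp: primepow_def)
  have "CHAR('a) dvd p ^ (u * n)"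
    using CHAR_dvd_card_finite_field[where 'a = 'a] assms(2) p(3) by (simp add: power_mult)
  then have "CHAR('a) dvd p" using prime_CHAR_finite_field[where 'a = 'a] prime_dvd_power by blast
  then have "CHAR('a) = p" using primes_dvd_imp_eq[OF prime_CHAR_finite_field[where 'a = 'a] p(1)] by simp
  then show ?thesis using p by auto
qed

locale finite_field_closure =
  fixes Q :: nat and ty :: "'a::{field,finite} itself"
  assumes Q_card: "Q = card (UNIV :: 'a set)" and Q_char: "\<exists>s>0. Q = CHAR('a) ^ s"

sublocale finite_field_closure \<subseteq> frobenius Q "TYPE('a alg_closure)"
  by unfold_locales (use prime_CHAR_finite_field Q_char in auto)

context finite_field_closure begin

lemma FL_1: "FL 1 = range (to_ac :: 'a \<Rightarrow> _)"
proof -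
  have sub: "range (to_ac :: 'a \<Rightarrow> _) \<subseteq> FL 1"
  proof (rule image_subsetI)
    fix y :: 'a
    have "y ^ Q = y" unfolding Q_card by (rule finite_field_power_card)
    then show "to_ac y \<in> FL 1" by (simp add: FL_iff flip: to_ac_power)
  qed
  have "card (range (to_ac :: 'a \<Rightarrow> _)) = card (FL 1)"
    using card_image[OF inj_to_ac] card_FL[of 1] Q_card by simp
  then show ?thesis using card_subset_eq[OF _ sub] finite_FL[of 1] by simp
qed

lemma acp_KX: "acp (p :: 'a poly) \<in> KX"
proof -
  have "to_ac (coeff p i) \<in> FL 1" for i unfolding FL_1 by simp
  then show ?thesis by (simp add: KX_def)
qed

lemma KX_acp: "g \<in> KX \<Longrightarrow> \<exists>p :: 'a poly. g = acp p"
proof -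
  assume g: "g \<in> KX"
  have "coeff g i \<in> range (to_ac :: 'a \<Rightarrow> _)" for i using g unfolding KX_def FL_1[symmetric] by simp
  then have "g = acp (map_poly of_ac g)"
    by (intro poly_eqI) (simp add: coeff_map_poly to_ac_of_ac)
  then show ?thesis by blast
qed

text \<open>A polynomial of least degree vanishing at \<open>\<beta>\<close> divides all others that
  do, in particular \<open>P\<close>, and irreducibility makes it an associate of
  \<open>P\<close>.\<close>

lemma irreducible_dvd_iff_root:
  fixes P :: "'a poly"
  assumes P: "irreducible P" "poly (acp P) \<beta> = 0"
  shows "P dvd g \<longleftrightarrow> poly (acp g) \<beta> = 0"
proof
  assume "P dvd g"
  then show "poly (acp g) \<beta> = 0" using P(2) by (auto simp: acp_mult elim!: dvdE)
next
  assume g: "poly (acp g) \<beta> = 0"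
  let ?S = "\<lambda>n. \<exists>\<mu> :: 'a poly. \<mu> \<noteq> 0 \<and> poly (acp \<mu>) \<beta> = 0 \<and> degree \<mu> = n"
  have P0: "P \<noteq> 0" using P(1) by (simp add: Factorial_Ring.irreducible_def)
  have "?S (degree P)" using P(2) P0 by auto
  then have "?S (LEAST n. ?S n)" by (rule LeastI)
  then obtain \<mu> :: "'a poly" where \<mu>: "\<mu> \<noteq> 0" "poly (acp \<mu>) \<beta> = 0" "degree \<mu> = (LEAST n. ?S n)" by auto
  have dvd: "\<mu> dvd h" if h: "poly (acp h) \<beta> = 0" for h
  proof -
    have "acp h = acp \<mu> * acp (h div \<mu>) + acp (h mod \<mu>)"
      using acp_mult[of \<mu> "h div \<mu>"] acp_diff[of h "\<mu> * (h div \<mu>)"] by (simp add: minus_mult_div_eq_mod)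
    then have r: "poly (acp (h mod \<mu>)) \<beta> = 0" using h \<mu>(2) by simp
    have "h mod \<mu> = 0"
    proof (rule ccontr)
      assume nz: "h mod \<mu> \<noteq> 0"
      then have "degree \<mu> \<le> degree (h mod \<mu>)" unfolding \<mu>(3) using r by (intro Least_le) auto
      then show False using degree_mod_less[OF \<mu>(1), of h] nz by simp
    qed
    then show ?thesis by (simp add: dvd_eq_mod_eq_0)
  qed
  obtain c where c: "P = \<mu> * c" using dvd[OF P(2)] by auto
  have "\<not> is_unit \<mu>"
  proof
    assume "is_unit \<mu>"
    then obtain b where "1 = \<mu> * b" by (elim dvdE)
    then have "acp 1 = acp \<mu> * acp b" using acp_mult[of \<mu> b] by argo
    then have "poly (acp 1) \<beta> = poly (acp \<mu>) \<beta> * poly (acp b) \<beta>" using poly_mult[of "acp \<mu>" "acp b" \<beta>] by argo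
    then show False using \<mu>(2) by simp
  qed
  then have "is_unit c" using P(1) c by (auto simp: Factorial_Ring.irreducible_def)
  then have "P dvd \<mu>" unfolding c by (metis dvd_mult_unit_iff dvd_refl mult.commute mult_unit_dvd_iff)
  then show "P dvd g" using dvd[OF g] dvd_trans by blast
qed

text \<open>The period is at most the degree because conjugates are distinct roots of
  \<open>P\<close>. Conversely, \<open>CP \<beta> (period \<beta>)\<close> descends to the ground
  field and vanishes at \<open>\<beta>\<close>, so \<open>P\<close> divides it.\<close>

lemma irreducible_conjugates:
  fixes P :: "'a poly"
  assumes P: "irreducible P" "poly (acp P) \<beta> = 0"
  shows "\<beta> \<in> FL (degree P)" "inj_on (\<lambda>t. \<beta> ^ (Q ^ t)) {..<degree P}"
proof -
  have P0: "P \<noteq> 0" using P(1) by (simp add: Factorial_Ring.irreducible_def)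
  have ex: "\<exists>i>0. \<beta> \<in> FL i" using root_in_FL[OF acp_KX _ P(2)] P0 by simp
  note per = period_pos[OF ex] period_FL[OF ex] period_inj[OF ex]
  have "(\<lambda>t. \<beta> ^ (Q ^ t)) ` {..<period \<beta>} \<subseteq> {x. poly (acp P) x = 0}"
    using P(2) Q_pow_pos by (auto simp: poly_frob[OF acp_KX] power_0_left)
  then have "card ((\<lambda>t. \<beta> ^ (Q ^ t)) ` {..<period \<beta>}) \<le> card {x. poly (acp P) x = 0}"
    using P0 by (intro card_mono poly_roots_finite) auto
  also have "\<dots> \<le> degree P" using card_poly_roots_bound[of "acp P"] P0 by simp
  finally have le: "period \<beta> \<le> degree P" using per(3) by (simp add: card_image)
  obtain M :: "'a poly" where M: "CP \<beta> (period \<beta>) = acp M" using KX_acp[OF CP_KX[OF per(2)]] by auto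
  have "poly (acp M) \<beta> = 0" unfolding M[symmetric] by (rule poly_CP[OF per(1)])
  then have "P dvd M" using irreducible_dvd_iff_root[OF P] by simp
  moreover have "M \<noteq> 0" using M CP_nz by (metis acp_eq_0_iff)
  ultimately have "degree P \<le> degree M" by (rule dvd_imp_degree_le)
  also have "degree M = period \<beta>" using degree_acp[of M] unfolding M[symmetric] degree_CP by simp
  finally have "period \<beta> = degree P" using le by simp
  then show "\<beta> \<in> FL (degree P)" "inj_on (\<lambda>t. \<beta> ^ (Q ^ t)) {..<degree P}" using per by simp_all
qed

lemma irreducible_factors_prod_dvd:
  fixes P :: "'i \<Rightarrow> 'a poly"
  assumes "finite I" "\<And>i. i \<in> I \<Longrightarrow> irreducible (P i)" "\<And>i. i \<in> I \<Longrightarrow> poly (acp (P i)) (\<beta> i) = 0"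
    and "\<And>i j. i \<in> I \<Longrightarrow> j \<in> I \<Longrightarrow> i \<noteq> j \<Longrightarrow> poly (acp (P i)) (\<beta> j) \<noteq> 0"
    and "\<And>i. i \<in> I \<Longrightarrow> P i dvd g"
  shows "(\<Prod>i\<in>I. P i) dvd g"
  using assms
proof (induction I rule: finite_induct)
  case (insert j I)
  have "(\<Prod>i\<in>I. P i) dvd g" using insert by auto
  then obtain c where c: "g = (\<Prod>i\<in>I. P i) * c" by auto
  have "poly (acp g) (\<beta> j) = 0" using irreducible_dvd_iff_root[of "P j" "\<beta> j" g] insert by auto
  then have "(\<Prod>i\<in>I. poly (acp (P i)) (\<beta> j)) * poly (acp c) (\<beta> j) = 0"
    by (simp add: c acp_mult acp_prod poly_prod)
  moreover have "poly (acp (P i)) (\<beta> j) \<noteq> 0" if "i \<in> I" for i using insert that by auto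
  then have "(\<Prod>i\<in>I. poly (acp (P i)) (\<beta> j)) \<noteq> 0" using insert(1) by (simp add: prod_zero_iff)
  ultimately have "poly (acp c) (\<beta> j) = 0" by simp
  then have "P j dvd c" using irreducible_dvd_iff_root[of "P j" "\<beta> j" c] insert by auto
  then show ?case unfolding c using insert(1,2) by (simp add: mult.commute[of "P j"] mult_dvd_mono)
qed simp

end

section \<open>The relation lattice\<close>

text \<open>The polynomial collecting the nonnegative exponents; \<open>expt_poly N lam al (- e)\<close> collects the
  negative ones, so that the relation of \<open>e\<close> can be stated without inverses.\<close>
definition expt_poly :: "nat \<Rightarrow> 'a::field \<Rightarrow> (nat \<Rightarrow> 'a) \<Rightarrow> (nat \<Rightarrow> int) \<Rightarrow> 'a poly" where
  "expt_poly N lam al e = [:lam:] ^ nat (e 0) * (\<Prod>i\<in>{1..N}. [:al i, 1:] ^ nat (e i))"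

lemma type_ring_simps: "carrier (type_ring :: 'b::comm_ring_1 ring) = UNIV" "x \<otimes>\<^bsub>type_ring\<^esub> y = x * y"
  "\<one>\<^bsub>type_ring\<^esub> = (1 :: 'b)" "\<zero>\<^bsub>type_ring\<^esub> = (0 :: 'b)" "x \<oplus>\<^bsub>type_ring\<^esub> y = x + y"
  by (simp_all add: ring_of_type_algebra_def)

lemma poly_class_eq_iff: "poly_class m p = poly_class m r \<longleftrightarrow> m dvd p - r"
proof -
  interpret R: cring "type_ring :: 'a poly ring" by (rule cring_from_type_algebra)
  have id: "ideal (PIdl\<^bsub>type_ring\<^esub> m) type_ring" by (rule R.cgenideal_ideal) (simp add: type_ring_simps)
  have "\<ominus>\<^bsub>type_ring\<^esub> r = - r" by (rule R.minus_equality) (simp_all add: type_ring_simps)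
  then have "p \<ominus>\<^bsub>type_ring\<^esub> r = p - r" by (simp add: a_minus_def type_ring_simps)
  then have "poly_class m p = poly_class m r \<longleftrightarrow> p - r \<in> PIdl\<^bsub>type_ring\<^esub> m"
    using R.quotient_eq_iff_same_a_r_cos[OF id, of p r] by (simp add: poly_class_def type_ring_simps)
  also have "\<dots> \<longleftrightarrow> m dvd p - r" by (auto simp: cgenideal_def type_ring_simps dvd_def mult.commute)
  finally show ?thesis .
qed

lemma poly_quot_cring: "cring (poly_quot m)" and poly_class_hom: "poly_class m \<in> ring_hom type_ring (poly_quot m)"
proof -
  interpret R: cring "type_ring :: 'a poly ring" by (rule cring_from_type_algebra)
  interpret I: ideal "PIdl\<^bsub>type_ring\<^esub> m" type_ring by (rule R.cgenideal_ideal) (simp add: type_ring_simps)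
  show "cring (poly_quot m)" unfolding poly_quot_def by (rule I.quotient_is_cring) (rule R.is_cring)
  have "poly_class m = (+>\<^bsub>type_ring\<^esub>) (PIdl\<^bsub>type_ring\<^esub> m)" by (simp add: fun_eq_iff poly_class_def)
  then show "poly_class m \<in> ring_hom type_ring (poly_quot m)" unfolding poly_quot_def using I.rcos_ring_hom by simp
qed

lemma poly_class_mult: "poly_class m (p * r) = poly_class m p \<otimes>\<^bsub>poly_quot m\<^esub> poly_class m r"
  and poly_class_one: "poly_class m 1 = \<one>\<^bsub>poly_quot m\<^esub>"
  and poly_class_closed: "poly_class m p \<in> carrier (poly_quot m)"
  using ring_hom_mult[OF poly_class_hom, of p r m] ring_hom_one[OF poly_class_hom, of m] ring_hom_closed[OF poly_class_hom, of p m]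
  by (simp_all add: type_ring_simps)

lemma poly_class_Units:
  assumes "m dvd p * r - 1"
  shows "poly_class m p \<in> Units (poly_quot m)"
proof -
  interpret Q: cring "poly_quot m" by (rule poly_quot_cring)
  have "poly_class m p \<otimes>\<^bsub>poly_quot m\<^esub> poly_class m r = \<one>\<^bsub>poly_quot m\<^esub>"
    using assms by (simp add: poly_class_eq_iff flip: poly_class_mult poly_class_one)
  moreover from this have "poly_class m r \<otimes>\<^bsub>poly_quot m\<^esub> poly_class m p = \<one>\<^bsub>poly_quot m\<^esub>"
    using Q.m_comm[OF poly_class_closed[of m r] poly_class_closed[of m p]] by simp
  ultimately show ?thesis unfolding Units_def using poly_class_closed by blast
qed

lemma (in comm_group) int_pow_mult_nat_uminus:
  "x \<in> carrier G \<Longrightarrow> x [^] (z::int) \<otimes> x [^] nat (- z) = x [^] nat z"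
proof (cases "z \<ge> 0")
  case False
  assume x: "x \<in> carrier G"
  have "x [^] nat (- z) = x [^] (- z)" using False by (intro pow_nat) simp
  moreover have "x [^] z \<otimes> x [^] (- z) = \<one>" using x by (simp flip: int_pow_mult)
  ultimately show ?thesis using False by simp
qed simp

text \<open>Multiplying the relation by the class of the negative part clears all inverses, and this
  class can be cancelled because all factors are units modulo \<open>m\<close>.\<close>

lemma rel_lattice_iff:
  assumes lam: "m dvd [:lam:] * r0 - 1" and al: "\<And>i. i \<in> {1..N} \<Longrightarrow> \<exists>r. m dvd [:al i, 1:] * r - 1"
  shows "e \<in> rel_lattice N lam al m \<longleftrightarrow> e \<in> carrier (Zpow N) \<and> m dvd expt_poly N lam al e - expt_poly N lam al (\<lambda>i. - e i)"
proof -
  interpret Q: cring "poly_quot m" by (rule poly_quot_cring)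
  define U where "U = units_of (poly_quot m)"
  interpret U: comm_group U unfolding U_def by (rule Q.units_comm_group)
  have U_mult: "x \<otimes>\<^bsub>U\<^esub> y = x \<otimes>\<^bsub>poly_quot m\<^esub> y" and U_one: "\<one>\<^bsub>U\<^esub> = \<one>\<^bsub>poly_quot m\<^esub>"
    and U_car: "carrier U = Units (poly_quot m)" for x y
    by (simp_all add: U_def units_of_def)
  have l: "poly_class m [:lam:] \<in> carrier U" unfolding U_car using lam by (rule poly_class_Units)
  have a: "poly_class m [:al i, 1:] \<in> carrier U" if "i \<in> {1..N}" for i
    unfolding U_car using al[OF that] poly_class_Units by blast
  have pow: "poly_class m p [^]\<^bsub>U\<^esub> n = poly_class m (p ^ n)" for p and n :: nat
  proof (induction n)
    case 0
    show ?case by (simp add: U_one poly_class_one)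
  next
    case (Suc n)
    then show ?case by (simp add: U_mult mult.commute flip: poly_class_mult)
  qed
  have fin: "(\<Otimes>\<^bsub>U\<^esub>i\<in>A. poly_class m (f i)) = poly_class m (\<Prod>i\<in>A. f i)"
    if "finite A" "\<And>i. i \<in> A \<Longrightarrow> poly_class m (f i) \<in> carrier U" for A :: "nat set" and f
    using that
  proof (induction A rule: finite_induct)
    case empty
    show ?case by (simp add: U_one poly_class_one)
  next
    case (insert x A)
    then show ?case by (subst U.finprod_insert) (auto simp: U_mult poly_class_mult)
  qed
  define E where "E = (\<lambda>e :: nat \<Rightarrow> int. poly_class m [:lam:] [^]\<^bsub>U\<^esub> nat (e 0) \<otimes>\<^bsub>U\<^esub> (\<Otimes>\<^bsub>U\<^esub>i\<in>{1..N}. poly_class m [:al i, 1:] [^]\<^bsub>U\<^esub> nat (e i)))"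
  have E_poly: "E e = poly_class m (expt_poly N lam al e)" for e
  proof -
    have "(\<Otimes>\<^bsub>U\<^esub>i\<in>{1..N}. poly_class m [:al i, 1:] [^]\<^bsub>U\<^esub> nat (e i)) = (\<Otimes>\<^bsub>U\<^esub>i\<in>{1..N}. poly_class m ([:al i, 1:] ^ nat (e i)))"
      by (simp only: pow)
    also have "\<dots> = poly_class m (\<Prod>i\<in>{1..N}. [:al i, 1:] ^ nat (e i))"
      using a by (intro fin) (auto simp flip: pow)
    finally show ?thesis by (simp only: E_def pow U_mult expt_poly_def poly_class_mult)
  qed
  have E_car: "E e \<in> carrier U" for e unfolding E_def using l a by (auto intro!: U.m_closed U.finprod_closed)
  define V where "V = poly_class m [:lam:] [^]\<^bsub>U\<^esub> e 0 \<otimes>\<^bsub>U\<^esub> (\<Otimes>\<^bsub>U\<^esub>i\<in>{1..N}. poly_class m [:al i, 1:] [^]\<^bsub>U\<^esub> e i)"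
  have V_car: "V \<in> carrier U" unfolding V_def using l a by (auto intro!: U.m_closed U.finprod_closed)
  have "V \<otimes>\<^bsub>U\<^esub> E (\<lambda>i. - e i) = E e"
  proof -
    have *: "(\<Otimes>\<^bsub>U\<^esub>i\<in>{1..N}. poly_class m [:al i, 1:] [^]\<^bsub>U\<^esub> e i) \<otimes>\<^bsub>U\<^esub> (\<Otimes>\<^bsub>U\<^esub>i\<in>{1..N}. poly_class m [:al i, 1:] [^]\<^bsub>U\<^esub> nat (- e i))
      = (\<Otimes>\<^bsub>U\<^esub>i\<in>{1..N}. poly_class m [:al i, 1:] [^]\<^bsub>U\<^esub> nat (e i))"
    proof -
      have "(\<Otimes>\<^bsub>U\<^esub>i\<in>{1..N}. poly_class m [:al i, 1:] [^]\<^bsub>U\<^esub> nat (e i))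
        = (\<Otimes>\<^bsub>U\<^esub>i\<in>{1..N}. poly_class m [:al i, 1:] [^]\<^bsub>U\<^esub> e i \<otimes>\<^bsub>U\<^esub> poly_class m [:al i, 1:] [^]\<^bsub>U\<^esub> nat (- e i))"
      proof (rule U.finprod_cong'[OF refl])
        show "poly_class m [:al i, 1:] [^]\<^bsub>U\<^esub> nat (e i)
            = poly_class m [:al i, 1:] [^]\<^bsub>U\<^esub> e i \<otimes>\<^bsub>U\<^esub> poly_class m [:al i, 1:] [^]\<^bsub>U\<^esub> nat (- e i)"
          if "i \<in> {1..N}" for i
          by (rule U.int_pow_mult_nat_uminus[OF a[OF that], symmetric])
      qed (use a in \<open>auto intro!: U.m_closed U.int_pow_closed U.nat_pow_closed\<close>)
      also have "\<dots> = (\<Otimes>\<^bsub>U\<^esub>i\<in>{1..N}. poly_class m [:al i, 1:] [^]\<^bsub>U\<^esub> e i) \<otimes>\<^bsub>U\<^esub> (\<Otimes>\<^bsub>U\<^esub>i\<in>{1..N}. poly_class m [:al i, 1:] [^]\<^bsub>U\<^esub> nat (- e i))"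
        using a by (intro U.finprod_multf) (auto intro!: U.int_pow_closed U.nat_pow_closed)
      finally show ?thesis by (rule sym)
    qed
    have c: "(\<Otimes>\<^bsub>U\<^esub>i\<in>{1..N}. poly_class m [:al i, 1:] [^]\<^bsub>U\<^esub> e i) \<in> carrier U"
      "(\<Otimes>\<^bsub>U\<^esub>i\<in>{1..N}. poly_class m [:al i, 1:] [^]\<^bsub>U\<^esub> nat (- e i)) \<in> carrier U"
      "poly_class m [:lam:] [^]\<^bsub>U\<^esub> e 0 \<in> carrier U" "poly_class m [:lam:] [^]\<^bsub>U\<^esub> nat (- e 0) \<in> carrier U"
      using l a by (auto intro!: U.finprod_closed)
    have comm: "A \<otimes>\<^bsub>U\<^esub> B \<otimes>\<^bsub>U\<^esub> (C \<otimes>\<^bsub>U\<^esub> D) = (A \<otimes>\<^bsub>U\<^esub> C) \<otimes>\<^bsub>U\<^esub> (B \<otimes>\<^bsub>U\<^esub> D)"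
      if "A \<in> carrier U" "B \<in> carrier U" "C \<in> carrier U" "D \<in> carrier U" for A B C D
      using that by (simp add: U.m_ac)
    show ?thesis unfolding V_def E_def comm[OF c(3,1,4,2)] * U.int_pow_mult_nat_uminus[OF l] ..
  qed
  then have "V = \<one>\<^bsub>U\<^esub> \<longleftrightarrow> E e = E (\<lambda>i. - e i)"
    using U.right_cancel[OF E_car[of "\<lambda>i. - e i"] V_car U.one_closed] U.l_one[OF E_car[of "\<lambda>i. - e i"]] by auto
  moreover have "e \<in> rel_lattice N lam al m \<longleftrightarrow> e \<in> carrier (Zpow N) \<and> V = \<one>\<^bsub>U\<^esub>"
    by (simp only: rel_lattice_def mem_Collect_eq V_def U_def)
  ultimately show ?thesis unfolding E_poly poly_class_eq_iff by simp
qed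

lemma gcd_power_minus_one:
  fixes b x y :: nat
  assumes "b > 0" "x > 0"
  shows "gcd (b ^ x - 1) (b ^ y - 1) = b ^ gcd x y - 1"
proof (rule dvd_antisym)
  have ge: "1 \<le> b ^ n" for n using assms(1) by (simp add: Suc_le_eq)
  let ?d = "gcd (b ^ x - 1) (b ^ y - 1)"
  have cx: "[b ^ x = 1] (mod ?d)" using cong_altdef_nat[OF ge[of x], of ?d] by simp
  have cy: "[b ^ y = 1] (mod ?d)" using cong_altdef_nat[OF ge[of y], of ?d] by simp
  obtain u v where uv: "x * u = y * v + gcd x y" using bezout_nat[of x y] assms(2) by auto
  have "[(b ^ y) ^ v = 1 ^ v] (mod ?d)" by (rule cong_pow[OF cy])
  then have "[(b ^ y) ^ v * b ^ gcd x y = 1 ^ v * b ^ gcd x y] (mod ?d)" by (rule cong_mult) (rule cong_refl)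
  moreover have "(b ^ y) ^ v * b ^ gcd x y = (b ^ x) ^ u" by (simp add: uv flip: power_mult power_add)
  ultimately have "[(b ^ x) ^ u = b ^ gcd x y] (mod ?d)" by simp
  moreover have "[(b ^ x) ^ u = 1 ^ u] (mod ?d)" by (rule cong_pow[OF cx])
  ultimately have "[b ^ gcd x y = 1] (mod ?d)" by (metis cong_sym cong_trans power_one)
  then show "?d dvd b ^ gcd x y - 1" using cong_altdef_nat[OF ge[of "gcd x y"], of ?d] by simp
  show "b ^ gcd x y - 1 dvd ?d" using assms(1) by (intro gcd_greatest power_minus_one_dvd) simp_all
qed

lemma Zpow_simps: "carrier (Zpow N) = ({0..N} \<rightarrow>\<^sub>E UNIV)" "x \<otimes>\<^bsub>Zpow N\<^esub> y = (\<lambda>i\<in>{0..N}. x i + y i)"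
  "\<one>\<^bsub>Zpow N\<^esub> = (\<lambda>i\<in>{0..N}. 0)"
  by (simp_all add: Zpow_def)

lemma comm_group_Zpow: "comm_group (Zpow N)"
proof (rule group.group_comm_groupI)
  show "group (Zpow N)" unfolding Zpow_def by (rule product_group) simp
qed (auto simp: Zpow_simps fun_eq_iff)

lemma subgroup_Zpow_scale:
  assumes S: "subgroup S (Zpow N)" and x: "x \<in> S"
  shows "(\<lambda>i\<in>{0..N}. z * x i) \<in> S"
proof -
  interpret Z: comm_group "Zpow N" by (rule comm_group_Zpow)
  have nat: "(\<lambda>i\<in>{0..N}. int n * x i) \<in> S" for n
  proof (induction n)
    case 0
    have "(\<lambda>i\<in>{0..N}. int 0 * x i) = \<one>\<^bsub>Zpow N\<^esub>" by (simp add: Zpow_simps)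
    then show ?case using subgroup.one_closed[OF S] by simp
  next
    case (Suc n)
    have "(\<lambda>i\<in>{0..N}. int (Suc n) * x i) = (\<lambda>i\<in>{0..N}. int n * x i) \<otimes>\<^bsub>Zpow N\<^esub> x"
      by (auto simp: Zpow_simps fun_eq_iff algebra_simps)
    then show ?case by (simp only: subgroup.m_closed[OF S Suc x])
  qed
  show ?thesis
  proof (cases "z \<ge> 0")
    case True
    then show ?thesis using nat[of "nat z"] by simp
  next
    case False
    define y where "y = (\<lambda>i\<in>{0..N}. int (nat (- z)) * x i)"
    have "y \<in> S" unfolding y_def by (rule nat)
    then have "inv\<^bsub>Zpow N\<^esub> y \<in> S" by (rule subgroup.m_inv_closed[OF S])
    moreover have "inv\<^bsub>Zpow N\<^esub> y = (\<lambda>i\<in>{0..N}. z * x i)"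
      using False by (intro Z.inv_equality) (auto simp: Zpow_simps y_def fun_eq_iff)
    ultimately show ?thesis by simp
  qed
qed

text \<open>Index 0 is reserved for the distinguished factor, whose degree becomes k in
  \<open>quotient_iso\<close>; numbering it with the others lets the values at all roots be treated
  alike.\<close>

locale smooth_relations = finite_field_closure Q ty for Q and ty :: "'a::{field,finite} itself" +
  fixes l :: nat and P :: "nat \<Rightarrow> 'a poly" and a :: "nat \<Rightarrow> nat" and m :: "'a poly" and lam :: 'a and al :: "nat \<Rightarrow> 'a"
    and \<beta> :: "nat \<Rightarrow> 'a alg_closure"
  assumes irr: "\<And>i. i \<in> {0..l} \<Longrightarrow> irreducible (P i)" and root: "\<And>i. i \<in> {0..l} \<Longrightarrow> poly (acp (P i)) (\<beta> i) = 0"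
    and cop: "\<And>i j. i \<in> {0..l} \<Longrightarrow> j \<in> {0..l} \<Longrightarrow> i \<noteq> j \<Longrightarrow> coprime (P i) (P j)"
    and deg2: "\<And>i. i \<in> {0..l} \<Longrightarrow> degree (P i) \<ge> 2"
    and m: "m = (\<Prod>i\<in>{0..l}. P i ^ a i)" and a1: "\<And>i. i \<in> {0..l} \<Longrightarrow> a i \<ge> 1"
    and lam0: "lam \<noteq> 0" and lam_gen: "\<And>x. x \<noteq> 0 \<Longrightarrow> \<exists>z. x = lam powi z"
    and al_surj: "al ` {1..Q} = UNIV"
begin

lemma irreducible_no_root:
  assumes i: "i \<in> {0..l}" and x: "x \<in> FL 1"
  shows "poly (acp (P i)) x \<noteq> 0"
proof
  assume r: "poly (acp (P i)) x = 0"
  note inj = irreducible_conjugates(2)[OF irr[OF i] r]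
  have "x ^ (Q ^ 0) = x ^ (Q ^ 1)" using x by (simp add: FL_iff)
  then have "(0::nat) = 1" using inj_onD[OF inj, of 0 1] deg2[OF i] by simp
  then show False by simp
qed

lemma cross_root: "i \<in> {0..l} \<Longrightarrow> j \<in> {0..l} \<Longrightarrow> i \<noteq> j \<Longrightarrow> poly (acp (P i)) (\<beta> j) \<noteq> 0"
proof
  assume ij: "i \<in> {0..l}" "j \<in> {0..l}" "i \<noteq> j" "poly (acp (P i)) (\<beta> j) = 0"
  have "P j dvd P i" using irreducible_dvd_iff_root[OF irr[OF ij(2)] root[OF ij(2)]] ij(4) by simp
  then have "is_unit (P j)" using cop[OF ij(1-3)] by (meson coprime_common_divisor dvd_refl)
  then show False using irr[OF ij(2)] by (simp add: Factorial_Ring.irreducible_def)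
qed

end

sublocale smooth_relations \<subseteq> conjugates Q "TYPE('a alg_closure)" "{0..l}" \<beta> "\<lambda>i. degree (P i)"
proof unfold_locales
  show "degree (P i) > 0" if "i \<in> {0..l}" for i using deg2[OF that] by simp
  show "\<beta> i \<in> FL (degree (P i))" if "i \<in> {0..l}" for i by (rule irreducible_conjugates(1)[OF irr[OF that] root[OF that]])
  show "inj_on (\<lambda>(i, t). \<beta> i ^ Q ^ t) (SIGMA i:{0..l}. {..<degree (P i)})"
  proof (rule inj_onI)
    fix x y assume xy: "x \<in> (SIGMA i:{0..l}. {..<degree (P i)})" "y \<in> (SIGMA i:{0..l}. {..<degree (P i)})"
      "(case x of (i, t) \<Rightarrow> \<beta> i ^ Q ^ t) = (case y of (i, t) \<Rightarrow> \<beta> i ^ Q ^ t)"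
    obtain i s j t where e: "x = (i, s)" "y = (j, t)" by (cases x, cases y)
    have ij: "i \<in> {0..l}" "j \<in> {0..l}" "s < degree (P i)" "t < degree (P j)" "\<beta> i ^ Q ^ s = \<beta> j ^ Q ^ t"
      using xy e by auto
    have "i = j"
    proof (rule ccontr)
      assume "i \<noteq> j"
      have "poly (acp (P i)) (\<beta> j) ^ Q ^ t = poly (acp (P i)) (\<beta> i) ^ Q ^ s"
        using ij(5) by (simp only: poly_frob[OF acp_KX, symmetric])
      also have "\<dots> = 0" using root[OF ij(1)] Q_pow_pos[of s] by (simp add: power_0_left)
      finally show False using cross_root[OF ij(1,2) \<open>i \<noteq> j\<close>] by simp
    qed
    moreover have "s = t"
      using inj_onD[OF irreducible_conjugates(2)[OF irr[OF ij(1)] root[OF ij(1)]], of s t] ij calculation by simp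
    ultimately show "x = y" by (simp add: e)
  qed
qed simp

section \<open>Values of exponent vectors at the roots\<close>

context smooth_relations begin

definition val :: "nat \<Rightarrow> (nat \<Rightarrow> int) \<Rightarrow> 'a alg_closure" where
  "val i e = to_ac lam powi e 0 * (\<Prod>j\<in>{1..Q}. (\<beta> i + to_ac (al j)) powi e j)"

lemma \<beta>_plus_nz: "i \<in> {0..l} \<Longrightarrow> \<beta> i + to_ac (x :: 'a) \<noteq> 0"
proof
  assume i: "i \<in> {0..l}" and "\<beta> i + to_ac x = 0"
  then have b: "\<beta> i = to_ac (- x)" by (simp add: eq_neg_iff_add_eq_0)
  have "\<beta> i \<in> FL 1" unfolding FL_1 b by (rule rangeI)
  then show False using irreducible_no_root[OF i] root[OF i] by blast
qed

lemma FL_powi: "x \<in> FL n \<Longrightarrow> x powi z \<in> FL n"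
  by (simp add: power_int_def FL_power FL_closed)

lemma to_ac_FL: "to_ac (x :: 'a) \<in> FL n"
  using FL_mono[of 1 n] FL_1 by auto

lemma val_FL: "i \<in> {0..l} \<Longrightarrow> val i e \<in> FL (degree (P i))"
proof -
  assume i: "i \<in> {0..l}"
  have prod: "(\<Prod>j\<in>A. g j) \<in> FL n" if "\<And>j. j \<in> A \<Longrightarrow> g j \<in> FL n" for A :: "nat set" and g n
    using that by (induction A rule: infinite_finite_induct) (auto simp: FL_closed)
  show ?thesis unfolding val_def
    by (intro FL_closed prod FL_powi to_ac_FL \<beta>_FL i)
qed

lemma val_nz: "i \<in> {0..l} \<Longrightarrow> val i e \<noteq> 0"
  using \<beta>_plus_nz lam0 by (simp add: val_def prod_zero_iff power_int_eq_0_iff)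

lemma val_mult: "i \<in> {0..l} \<Longrightarrow> val i (e \<otimes>\<^bsub>Zpow Q\<^esub> e') = val i e * val i e'"
  using \<beta>_plus_nz lam0 by (simp add: val_def Zpow_simps power_int_add prod.distrib mult_ac)

lemma val_scale: "val i (\<lambda>j\<in>{0..Q}. z * e j) = val i e powi z"
proof -
  have prod: "(\<Prod>j\<in>A. g j) powi z = (\<Prod>j\<in>A. g j powi z)" for A :: "nat set" and g :: "nat \<Rightarrow> 'a alg_closure"
    by (induction A rule: infinite_finite_induct) (auto simp: power_int_mult_distrib)
  show ?thesis unfolding val_def
    by (simp add: power_int_mult_distrib prod mult.commute[of z] power_int_mult)
qed

lemma poly_expt: "poly (acp (expt_poly Q lam al e)) b = to_ac lam ^ nat (e 0) * (\<Prod>j\<in>{1..Q}. (b + to_ac (al j)) ^ nat (e j))"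
proof -
  have "acp [:lam:] = [:to_ac lam:]" "acp [:x, 1:] = [:to_ac x, 1:]" for x :: 'a
    by (simp_all add: poly_eq_iff coeff_pCons split: nat.split)
  then show ?thesis by (simp add: expt_poly_def acp_mult acp_power acp_prod poly_prod add.commute)
qed

lemma val_expt:
  assumes i: "i \<in> {0..l}"
  shows "val i e = 1 \<longleftrightarrow> poly (acp (expt_poly Q lam al e)) (\<beta> i) = poly (acp (expt_poly Q lam al (\<lambda>j. - e j))) (\<beta> i)"
proof -
  have pi: "x powi z = x ^ nat z / x ^ nat (- z)" for x :: "'a alg_closure" and z
    by (cases "z \<ge> 0") (auto simp: power_int_def field_simps power_inverse)
  have "poly (acp (expt_poly Q lam al (\<lambda>j. - e j))) (\<beta> i) \<noteq> 0"
    unfolding poly_expt using \<beta>_plus_nz[OF i] lam0 by (simp add: prod_zero_iff)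
  moreover have "val i e = poly (acp (expt_poly Q lam al e)) (\<beta> i) / poly (acp (expt_poly Q lam al (\<lambda>j. - e j))) (\<beta> i)"
    unfolding val_def poly_expt pi by (simp add: prod_dividef)
  ultimately show ?thesis by (simp add: divide_eq_1_iff)
qed

lemma rel_iff: "e \<in> rel_lattice Q lam al m \<longleftrightarrow> e \<in> carrier (Zpow Q) \<and> m dvd expt_poly Q lam al e - expt_poly Q lam al (\<lambda>i. - e i)"
proof (rule rel_lattice_iff)
  show "m dvd [:lam:] * [:inverse lam:] - 1" using lam0 by (simp add: one_pCons)
  fix j assume "j \<in> {1..Q}"
  define x where "x = - al j"
  have "poly m x \<noteq> 0"
  proof
    assume "poly m x = 0"
    then have "to_ac (poly m x) = 0" by simp
    then obtain i where i: "i \<in> {0..l}" "poly (P i) x = 0" using \<open>poly m x = 0\<close> by (auto simp: m poly_prod prod_zero_iff)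
    then have "[:- x, 1:] dvd P i" by (simp add: poly_eq_0_iff_dvd)
    then obtain g where g: "P i = [:- x, 1:] * g" by (elim dvdE)
    have "acp [:- x, 1:] = [:- to_ac x, 1:]" by (simp add: poly_eq_iff coeff_pCons split: nat.split)
    then have "poly (acp (P i)) (to_ac x) = 0" unfolding g acp_mult by simp
    moreover have "to_ac x \<in> FL 1" unfolding FL_1 by simp
    ultimately show False using irreducible_no_root[OF i(1)] by blast
  qed
  \<comment> \<open>The inverse of a linear factor comes from m = c + (x + al j) * g, where the
    constant \<open>c\<close> is the nonzero value of \<open>m\<close> at - al j.\<close>
  define c where "c = poly m x"
  have c0: "c \<noteq> 0" using \<open>poly m x \<noteq> 0\<close> by (simp add: c_def)
  have "[:- x, 1:] dvd m - [:c:]" unfolding poly_eq_0_iff_dvd[symmetric] by (simp add: c_def)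
  then obtain g where g: "m - [:c:] = [:al j, 1:] * g" by (auto simp: x_def elim!: dvdE)
  have "[:al j, 1:] * smult (- inverse c) g - 1 = smult (- inverse c) m"
  proof -
    have "[:al j, 1:] * smult (- inverse c) g = smult (- inverse c) (m - [:c:])" unfolding g by simp
    also have "\<dots> = smult (- inverse c) m + 1" using c0 by (simp add: smult_diff_right one_pCons)
    finally show ?thesis by simp
  qed
  then have "m dvd [:al j, 1:] * smult (- inverse c) g - 1" by (simp add: dvd_smult)
  then show "\<exists>r. m dvd [:al j, 1:] * r - 1" by blast
qed

lemma rel_imp_val: "e \<in> rel_lattice Q lam al m \<Longrightarrow> i \<in> {0..l} \<Longrightarrow> val i e = 1"
proof -
  assume e: "e \<in> rel_lattice Q lam al m" and i: "i \<in> {0..l}"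
  have "P i dvd P i ^ a i" using a1[OF i] by (simp add: dvd_power)
  also have "P i ^ a i dvd m" unfolding m using i by (intro dvd_prodI) auto
  also have "m dvd expt_poly Q lam al e - expt_poly Q lam al (\<lambda>i. - e i)" using e rel_iff by simp
  finally have "poly (acp (expt_poly Q lam al e - expt_poly Q lam al (\<lambda>i. - e i))) (\<beta> i) = 0"
    using irreducible_dvd_iff_root[OF irr[OF i] root[OF i]] by simp
  then show ?thesis unfolding val_expt[OF i] acp_diff by simp
qed

text \<open>The values at the roots only see the radical of \<open>m\<close>. A power of the characteristic lifts the
  congruence to \<open>m\<close>, and it is harmless since it is coprime to \<open>q ^ (2 * k) - 1\<close>.\<close>
lemma val_imp_rel:
  assumes e: "\<And>i. i \<in> {0..l} \<Longrightarrow> val i e = 1" and t: "\<And>i. i \<in> {0..l} \<Longrightarrow> a i \<le> CHAR('a) ^ t"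
  shows "(\<lambda>j\<in>{0..Q}. int (CHAR('a) ^ t) * e j) \<in> rel_lattice Q lam al m"
proof -
  define s where "s = CHAR('a) ^ t"
  define A where "A = expt_poly Q lam al e"
  define B where "B = expt_poly Q lam al (\<lambda>j. - e j)"
  define e' where "e' = (\<lambda>j\<in>{0..Q}. int s * e j)"
  have nat: "nat (int s * z) = s * nat z" "nat (- (int s * z)) = s * nat (- z)" for z
    by (simp_all add: nat_mult_distrib flip: mult_minus_right)
  have A': "expt_poly Q lam al e' = A ^ s"
    unfolding A_def expt_poly_def e'_def power_mult_distrib prod_power_distrib power_mult[symmetric]
    by (simp add: nat mult.commute)
  have B': "expt_poly Q lam al (\<lambda>j. - e' j) = B ^ s"
    unfolding B_def expt_poly_def e'_def power_mult_distrib prod_power_distrib power_mult[symmetric]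
    by (simp add: nat mult.commute)
  have "(\<Prod>i\<in>{0..l}. P i) dvd A - B"
  proof (rule irreducible_factors_prod_dvd[OF _ irr root cross_root])
    fix i assume i: "i \<in> {0..l}"
    have "poly (acp (A - B)) (\<beta> i) = 0" using e[OF i] val_expt[OF i] by (simp add: acp_diff A_def B_def)
    then show "P i dvd A - B" using irreducible_dvd_iff_root[OF irr[OF i] root[OF i]] by simp
  qed auto
  then have "(\<Prod>i\<in>{0..l}. P i) ^ s dvd (A - B) ^ s" by (rule dvd_power_same)
  moreover have "m dvd (\<Prod>i\<in>{0..l}. P i) ^ s"
    unfolding m prod_power_distrib using t by (intro prod_dvd_prod le_imp_power_dvd) (auto simp: s_def)
  ultimately have "m dvd (A - B) ^ s" by (rule dvd_trans[rotated])
  moreover have "(A - B) ^ s = A ^ s - B ^ s"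
  proof -
    have "prime CHAR('a poly)" using prime_CHAR_finite_field[where 'a = 'a] by simp
    moreover have "s = CHAR('a poly) ^ t" by (simp add: s_def)
    ultimately have "(A - B + B) ^ s = (A - B) ^ s + B ^ s" by (rule freshmans_dream')
    then show ?thesis by simp
  qed
  moreover have "e' \<in> carrier (Zpow Q)" by (simp add: Zpow_simps e'_def)
  ultimately have "e' \<in> rel_lattice Q lam al m" using rel_iff A' B' by simp
  then show ?thesis by (simp add: e'_def s_def)
qed

definition V where "V e = (\<lambda>i\<in>{0..l}. val i e)"

lemma V_hom: "V \<in> hom (Zpow Q) WG"
proof (rule homI)
  show "V e \<in> carrier WG" for e using val_FL val_nz by (auto simp: V_def)
  show "V (x \<otimes>\<^bsub>Zpow Q\<^esub> y) = V x \<otimes>\<^bsub>WG\<^esub> V y" for x y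
    by (auto simp: V_def val_mult fun_eq_iff)
qed

text \<open>Multiples of unit vectors already map to what \<open>subgroup_eq_WG\<close> asks for:
  coordinate 0 yields the constants, and the coordinate with \<open>al j\<close> equal to - b yields
  the tuple of the \<open>\<beta> i - b\<close>.\<close>

lemma V_surj:
  assumes Qq: "Q = q ^ 2" and q: "q = CHAR('a) ^ u" and deg: "(\<Sum>i\<in>{0..l}. degree (P i)) \<le> q + 2"
  shows "V ` carrier (Zpow Q) = carrier WG"
proof (rule subgroup_eq_WG[OF _ deg2 Qq _ deg])
  interpret W: comm_group WG by (rule comm_group_WG)
  interpret Z: comm_group "Zpow Q" by (rule comm_group_Zpow)
  interpret h: group_hom "Zpow Q" WG V using V_hom by unfold_locales
  show "subgroup (V ` carrier (Zpow Q)) WG" by (rule h.img_is_subgroup)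
  show "q = CHAR('a alg_closure) ^ u" using q by simp
  have unit: "V (scaled_unit Q z j) = (\<lambda>i\<in>{0..l}. if j = 0 then to_ac lam powi z else (\<beta> i + to_ac (al j)) powi z)"
    if "j \<in> {0..Q}" for j z
  proof -
    have "val i (scaled_unit Q z j) = (if j = 0 then to_ac lam powi z else (\<beta> i + to_ac (al j)) powi z)" for i
    proof -
      have "(\<Prod>x\<in>{1..Q}. (\<beta> i + to_ac (al x)) powi scaled_unit Q z j x) = (\<Prod>x\<in>{1..Q}. if x = j then (\<beta> i + to_ac (al x)) powi z else 1)"
        by (intro prod.cong) (auto simp: scaled_unit_def)
      also have "\<dots> = (if j = 0 then 1 else (\<beta> i + to_ac (al j)) powi z)"
        using that by (simp add: prod.delta)
      finally show ?thesis by (simp add: val_def) (simp add: scaled_unit_def)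
    qed
    then show ?thesis by (simp add: V_def fun_eq_iff)
  qed
  have su: "scaled_unit Q z j \<in> carrier (Zpow Q)" for z j by (simp add: scaled_unit_def Zpow_simps)
  show "(\<lambda>i\<in>{0..l}. c) \<in> V ` carrier (Zpow Q)" if c: "c \<in> FL 1" "c \<noteq> 0" for c
  proof -
    obtain x :: 'a where x: "c = to_ac x" using c(1) unfolding FL_1 by auto
    then obtain z where z: "x = lam powi z" using lam_gen[of x] c(2) by auto
    have "to_ac (lam powi z) = to_ac lam powi z" by (simp add: power_int_def)
    then have "V (scaled_unit Q z 0) = (\<lambda>i\<in>{0..l}. c)" using unit[of 0 z] by (simp add: x z)
    then show ?thesis using su by (metis image_eqI)
  qed
  show "(\<lambda>i\<in>{0..l}. \<beta> i - b) \<in> V ` carrier (Zpow Q)" if b: "b \<in> FL 1" for b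
  proof -
    obtain x :: 'a where x: "b = to_ac x" using b unfolding FL_1 by auto
    obtain j where j: "j \<in> {1..Q}" "al j = - x" using al_surj by (metis UNIV_I imageE)
    have "V (scaled_unit Q 1 j) = (\<lambda>i\<in>{0..l}. \<beta> i - b)" using unit[of j 1] j by (simp add: x)
    then show ?thesis using su by (metis image_eqI)
  qed
qed

end

lemma (in frobenius) primitive_power_cong:
  assumes "i > 0" "\<gamma> \<in> FL i" "\<gamma> \<noteq> 0" "\<And>x. x \<in> FL i \<Longrightarrow> x \<noteq> 0 \<Longrightarrow> \<exists>n. x = \<gamma> ^ n"
  shows "\<gamma> ^ x = \<gamma> ^ y \<longleftrightarrow> [x = y] (mod Q ^ i - 1)"
proof -
  have *: "\<gamma> ^ x = \<gamma> ^ y \<longleftrightarrow> [y = x] (mod Q ^ i - 1)" if "x \<le> y" for x y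
  proof -
    have "\<gamma> ^ y = \<gamma> ^ x * \<gamma> ^ (y - x)" using that by (simp flip: power_add)
    then have "\<gamma> ^ x = \<gamma> ^ y \<longleftrightarrow> \<gamma> ^ (y - x) = 1" using assms(3) by auto
    also have "\<dots> \<longleftrightarrow> [y = x] (mod Q ^ i - 1)"
      using primitive_power_eq_1[OF assms(1-3) assms(4), of "y - x"] cong_altdef_nat[OF that, of "Q ^ i - 1"]
      by simp
    finally show ?thesis .
  qed
  show ?thesis
  proof (cases "x \<le> y")
    case True
    show ?thesis unfolding *[OF True] by (rule cong_sym_eq)
  next
    case False
    then have "y \<le> x" by simp
    from *[OF this] show ?thesis by (simp only: eq_commute[of "\<gamma> ^ x"])
  qed
qed

section \<open>The quotient by the extended lattice\<close>

context smooth_relations begin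

text \<open>In a cyclic group of order \<open>N i\<close> the n-th powers are the elements whose
  logarithm is divisible by gcd(n, N i). So the kernel of \<open>\<Phi>\<close> consists of the
  vectors all of whose values are n-th powers. By surjectivity of \<open>V\<close>, such a vector is
  \<open>n\<close> times a vector plus one whose values are all 1.\<close>

lemma quotient_iso:
  assumes Qq: "Q = q ^ 2" and q: "q = CHAR('a) ^ u" and deg: "(\<Sum>i\<in>{0..l}. degree (P i)) \<le> q + 2"
  defines "k \<equiv> degree (P 0)"
  shows "Zpow Q Mod rel_lattice_star Q (int (Q ^ k - 1)) lam al m \<cong>
    integer_mod_group (Q ^ k - 1) \<times>\<times> product_group {1..l} (\<lambda>i. integer_mod_group (Q ^ gcd k (degree (P i)) - 1))"
proof -
  define n where "n = Q ^ k - 1"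
  define N where "N i = Q ^ degree (P i) - 1" for i
  define nn where "nn i = Q ^ gcd k (degree (P i)) - 1" for i
  have kpos: "k > 0" using deg2[of 0] by (simp add: k_def)
  have n0: "n > 0" using Q_pow_gt_1[OF kpos] by (simp add: n_def)
  have nn0: "nn 0 = n" by (simp add: nn_def n_def k_def)
  have nn: "nn i = gcd n (N i)" for i
    using gcd_power_minus_one[of Q k "degree (P i)"] Q_gt_1 kpos by (simp add: nn_def n_def N_def)
  have nnpos: "nn i > 0" for i using n0 by (simp add: nn)
  have dpos: "degree (P i) > 0" if "i \<in> {0..l}" for i using deg2[OF that] by simp
  have "\<exists>g. \<forall>i\<in>{0..l}. g i \<in> FL (degree (P i)) \<and> g i \<noteq> 0 \<and> (\<forall>x\<in>FL (degree (P i)). x \<noteq> 0 \<longrightarrow> (\<exists>n. x = g i ^ n))"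
    using FL_primitive[OF dpos] by (intro bchoice) metis
  then obtain \<gamma> where \<gamma>: "\<And>i. i \<in> {0..l} \<Longrightarrow> \<gamma> i \<in> FL (degree (P i))" "\<And>i. i \<in> {0..l} \<Longrightarrow> \<gamma> i \<noteq> 0"
    "\<And>i x. i \<in> {0..l} \<Longrightarrow> x \<in> FL (degree (P i)) \<Longrightarrow> x \<noteq> 0 \<Longrightarrow> \<exists>n. x = \<gamma> i ^ n" by blast
  have \<gamma>_cong: "\<gamma> i ^ x = \<gamma> i ^ y \<longleftrightarrow> [x = y] (mod N i)" if "i \<in> {0..l}" for i x y
    unfolding N_def using primitive_power_cong[OF dpos[OF that] \<gamma>(1,2)[OF that] \<gamma>(3)[OF that]] .
  \<comment> \<open>An arbitrary discrete logarithm; it is determined modulo \<open>N i\<close>,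
    hence modulo the divisor \<open>nn i\<close>.\<close>
  define dl where "dl i x = (SOME j. x = \<gamma> i ^ j)" for i x
  have dl: "\<gamma> i ^ dl i x = x" if "i \<in> {0..l}" "x \<in> FL (degree (P i))" "x \<noteq> 0" for i x
    unfolding dl_def using someI_ex[OF \<gamma>(3)[OF that]] by (rule sym)
  have dlv: "\<gamma> i ^ dl i (val i e) = val i e" if "i \<in> {0..l}" for i e
    using dl[OF that val_FL[OF that] val_nz[OF that]] .
  have dl_unique: "[dl i (val i e) = j] (mod nn i)" if i: "i \<in> {0..l}" and v: "val i e = \<gamma> i ^ j" for i e j
  proof -
    have "[dl i (val i e) = j] (mod N i)" using dlv[OF i, of e] v \<gamma>_cong[OF i] by simp
    then show ?thesis by (rule cong_dvd_modulus_nat) (simp add: nn)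
  qed
  define ix where "ix i e = int (dl i (val i e)) mod int (nn i)" for i e
  have ix_eq: "ix i e = int j mod int (nn i)" if "i \<in> {0..l}" "val i e = \<gamma> i ^ j" for i e j
    using dl_unique[OF that] by (simp add: ix_def cong_def flip: zmod_int)
  have ix_mult: "ix i (x \<otimes>\<^bsub>Zpow Q\<^esub> y) = (ix i x + ix i y) mod int (nn i)" if i: "i \<in> {0..l}" for i x y
  proof -
    have "val i (x \<otimes>\<^bsub>Zpow Q\<^esub> y) = \<gamma> i ^ (dl i (val i x) + dl i (val i y))"
      by (simp add: val_mult[OF i] power_add dlv[OF i])
    from ix_eq[OF i this] show ?thesis by (simp add: ix_def mod_simps)
  qed
  have ix_range: "0 \<le> ix i e" "ix i e < int (nn i)" for i e using nnpos[of i] by (simp_all add: ix_def)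
  have ix_0: "ix i e = 0 \<longleftrightarrow> nn i dvd dl i (val i e)" for i e
    by (simp add: ix_def dvd_eq_mod_eq_0 flip: zmod_int)
  define T where "T = integer_mod_group (nn 0) \<times>\<times> product_group {1..l} (\<lambda>i. integer_mod_group (nn i))"
  define \<Phi> where "\<Phi> e = (ix 0 e, \<lambda>i\<in>{1..l}. ix i e)" for e
  have car: "carrier (integer_mod_group (nn i)) = {0..<int (nn i)}" for i
    using nnpos[of i] by (simp add: carrier_integer_mod_group)
  have carT: "(x, g) \<in> carrier T \<longleftrightarrow> 0 \<le> x \<and> x < int (nn 0) \<and> g \<in> extensional {1..l} \<and>
      (\<forall>i\<in>{1..l}. 0 \<le> g i \<and> g i < int (nn i))" for x g
    by (auto simp: T_def DirProd_def car PiE_iff)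
  interpret Z: comm_group "Zpow Q" by (rule comm_group_Zpow)
  interpret T: group T
    unfolding T_def by (intro DirProd_group product_group group_integer_mod_group)
  have hom: "\<Phi> \<in> hom (Zpow Q) T"
  proof (rule homI)
    show "\<Phi> e \<in> carrier T" for e unfolding \<Phi>_def carT using ix_range by simp
    show "\<Phi> (x \<otimes>\<^bsub>Zpow Q\<^esub> y) = \<Phi> x \<otimes>\<^bsub>T\<^esub> \<Phi> y" for x y
      unfolding \<Phi>_def T_def by (auto simp: ix_mult fun_eq_iff)
  qed
  interpret h: group_hom "Zpow Q" T \<Phi> using hom by unfold_locales
  have pre: "\<exists>e\<in>carrier (Zpow Q). \<Phi> e = y" if y: "y \<in> carrier T" for y
  proof -
    obtain x f where xf: "y = (x, f)" by (cases y)
    define c where "c i = (if i = 0 then x else f i)" for i :: nat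
    have c: "0 \<le> c i" "c i < int (nn i)" if "i \<in> {0..l}" for i
      using y that unfolding xf carT c_def by auto
    have "(\<lambda>i\<in>{0..l}. \<gamma> i ^ nat (c i)) \<in> carrier WG" using \<gamma> by (auto simp: FL_power)
    then obtain e where e: "e \<in> carrier (Zpow Q)" "V e = (\<lambda>i\<in>{0..l}. \<gamma> i ^ nat (c i))"
      using V_surj[OF Qq q deg] by (metis (no_types, lifting) imageE)
    have "ix i e = c i" if i: "i \<in> {0..l}" for i
    proof -
      have "val i e = \<gamma> i ^ nat (c i)" using fun_cong[OF e(2), of i] i by (simp add: V_def)
      from ix_eq[OF i this] show ?thesis using c[OF i] by simp
    qed
    moreover have "f \<in> extensional {1..l}" using y unfolding xf carT by simp
    ultimately have "\<Phi> e = y" unfolding \<Phi>_def xf by (auto simp: c_def fun_eq_iff extensional_def)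
    then show ?thesis using e(1) by blast
  qed
  have surj: "\<Phi> ` carrier (Zpow Q) = carrier T"
  proof
    show "carrier T \<subseteq> \<Phi> ` carrier (Zpow Q)" using pre by (metis imageI subsetI)
  qed (use h.hom_closed in blast)
  have ker: "e \<in> kernel (Zpow Q) T \<Phi> \<longleftrightarrow> e \<in> carrier (Zpow Q) \<and> (\<forall>i\<in>{0..l}. nn i dvd dl i (val i e))" for e
  proof -
    have "\<Phi> e = \<one>\<^bsub>T\<^esub> \<longleftrightarrow> (\<forall>i\<in>{0..l}. ix i e = 0)"
    proof
      assume "\<Phi> e = \<one>\<^bsub>T\<^esub>"
      then have a: "ix 0 e = 0" "(\<lambda>i\<in>{1..l}. ix i e) = (\<lambda>i\<in>{1..l}. 0)" by (simp_all add: \<Phi>_def T_def)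
      show "\<forall>i\<in>{0..l}. ix i e = 0"
      proof
        fix i assume "i \<in> {0..l}"
        then show "ix i e = 0" using a(1) fun_cong[OF a(2), of i] by (cases "i = 0") auto
      qed
    qed (auto simp: \<Phi>_def T_def fun_eq_iff)
    then show ?thesis by (auto simp: kernel_def ix_0)
  qed
  define S where "S = rel_lattice_star Q (int n) lam al m"
  have gens: "rel_lattice Q lam al m \<union> scaled_unit Q (int n) ` {1..Q} \<subseteq> carrier (Zpow Q)"
    unfolding rel_lattice_def by (auto simp: scaled_unit_def Zpow_simps)
  have subS: "subgroup S (Zpow Q)" unfolding S_def rel_lattice_star_def by (rule Z.generate_is_subgroup[OF gens])
  have unitS: "scaled_unit Q (int n) j \<in> S" if "j \<in> {1..Q}" for j
    unfolding S_def rel_lattice_star_def using that by (auto intro: generate.incl)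
  have relS: "rel_lattice Q lam al m \<subseteq> S"
    unfolding S_def rel_lattice_star_def by (auto intro: generate.incl)
  have unit_val: "val i (scaled_unit Q z j) = (\<beta> i + to_ac (al j)) powi z" if "j \<in> {1..Q}" for i j z
  proof -
    have "(\<Prod>x\<in>{1..Q}. (\<beta> i + to_ac (al x)) powi scaled_unit Q z j x) = (\<Prod>x\<in>{1..Q}. if x = j then (\<beta> i + to_ac (al x)) powi z else 1)"
      by (intro prod.cong) (auto simp: scaled_unit_def)
    then show ?thesis using that by (simp add: val_def prod.delta) (simp add: scaled_unit_def)
  qed
  have "S \<subseteq> kernel (Zpow Q) T \<Phi>"
    unfolding S_def rel_lattice_star_def
  proof (rule Z.generate_subgroup_incl[OF _ h.subgroup_kernel], rule Un_least)
    show "rel_lattice Q lam al m \<subseteq> kernel (Zpow Q) T \<Phi>"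
    proof
      fix e assume e: "e \<in> rel_lattice Q lam al m"
      have "nn i dvd dl i (val i e)" if i: "i \<in> {0..l}" for i
        using dl_unique[OF i, of e 0] rel_imp_val[OF e i] by (simp add: cong_0_iff)
      then show "e \<in> kernel (Zpow Q) T \<Phi>" using ker gens e by blast
    qed
    show "scaled_unit Q (int n) ` {1..Q} \<subseteq> kernel (Zpow Q) T \<Phi>"
    proof (rule image_subsetI)
      fix j assume j: "j \<in> {1..Q}"
      have "nn i dvd dl i (val i (scaled_unit Q (int n) j))" if i: "i \<in> {0..l}" for i
      proof -
        have v: "val i (scaled_unit Q (int n) j) = (\<beta> i + to_ac (al j)) ^ n" using unit_val[OF j] by simp
        have "\<beta> i + to_ac (al j) \<in> FL (degree (P i))" by (intro FL_closed \<beta>_FL[OF i] to_ac_FL)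
        then obtain b where "\<beta> i + to_ac (al j) = \<gamma> i ^ b" using \<gamma>(3)[OF i] \<beta>_plus_nz[OF i] by blast
        then have "val i (scaled_unit Q (int n) j) = \<gamma> i ^ (b * n)" using v by (simp add: power_mult)
        from dl_unique[OF i this] have "nn i dvd dl i (val i (scaled_unit Q (int n) j)) \<longleftrightarrow> nn i dvd b * n"
          by (rule cong_dvd_iff)
        then show ?thesis by (simp add: nn)
      qed
      then show "scaled_unit Q (int n) j \<in> kernel (Zpow Q) T \<Phi>" using ker gens j by blast
    qed
  qed
  moreover have "kernel (Zpow Q) T \<Phi> \<subseteq> S"
  proof
    fix e assume "e \<in> kernel (Zpow Q) T \<Phi>"
    then have e: "e \<in> carrier (Zpow Q)" "\<And>i. i \<in> {0..l} \<Longrightarrow> nn i dvd dl i (val i e)" using ker by auto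
    \<comment> \<open>By Bezout, \<open>nn i\<close> is a multiple of \<open>n\<close> modulo
      \<open>N i\<close>, so every logarithm divisible by \<open>nn i\<close> is one too.\<close>
    have "\<exists>b. \<forall>i\<in>{0..l}. val i e = (\<gamma> i ^ b i) ^ n"
    proof (intro bchoice ballI)
      fix i assume i: "i \<in> {0..l}"
      obtain x y where xy: "n * x = N i * y + nn i" using bezout_nat[of n "N i"] n0 nn by auto
      obtain c where c: "dl i (val i e) = nn i * c" using e(2)[OF i] by auto
      have "n * (x * c) = N i * y * c + nn i * c" using xy by (metis add_mult_distrib mult.assoc)
      then have "[n * (x * c) = dl i (val i e)] (mod N i)" unfolding c by (simp add: cong_def mult.assoc)
      then have "\<gamma> i ^ (n * (x * c)) = val i e" using \<gamma>_cong[OF i] dlv[OF i] by metis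
      then show "\<exists>b. val i e = (\<gamma> i ^ b) ^ n" by (intro exI[of _ "x * c"]) (simp add: mult.commute flip: power_mult)
    qed
    then obtain b where b: "\<And>i. i \<in> {0..l} \<Longrightarrow> val i e = (\<gamma> i ^ b i) ^ n" by auto
    have "(\<lambda>i\<in>{0..l}. \<gamma> i ^ b i) \<in> carrier WG" using \<gamma> by (auto simp: FL_power)
    then obtain e' where e': "e' \<in> carrier (Zpow Q)" "V e' = (\<lambda>i\<in>{0..l}. \<gamma> i ^ b i)"
      using V_surj[OF Qq q deg] by (metis (no_types, lifting) imageE)
    have ve': "val i e' = \<gamma> i ^ b i" if "i \<in> {0..l}" for i using fun_cong[OF e'(2), of i] that by (simp add: V_def)
    \<comment> \<open>Only \<open>a i \<le> CHAR('a) ^ t\<close> matters; the sum achieves it since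
      a i <= t < 2^t.\<close>
    define t where "t = (\<Sum>i\<in>{0..l}. a i)"
    define s where "s = CHAR('a) ^ t"
    have CHAR2: "CHAR('a) \<ge> 2" using prime_CHAR_finite_field[where 'a = 'a] by (rule prime_ge_2_nat)
    have at: "a i \<le> CHAR('a) ^ t" if "i \<in> {0..l}" for i
    proof -
      have "a i \<le> t" unfolding t_def using that by (intro member_le_sum) auto
      also have "t < 2 ^ t" by (rule less_exp)
      also have "(2::nat) ^ t \<le> CHAR('a) ^ t" using CHAR2 by (intro power_mono) auto
      finally show ?thesis by simp
    qed
    have "coprime s n"
    proof -
      obtain v where v: "v > 0" "Q = CHAR('a) ^ v" using Q_char by auto
      have "CHAR('a) dvd Q ^ k" using v kpos by (simp add: dvd_power flip: power_mult)
      moreover have "\<not> CHAR('a) dvd 1" using CHAR2 by simp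
      ultimately have "\<not> CHAR('a) dvd n"
        using dvd_diff_nat[of "CHAR('a)" "Q ^ k" n] Q_pow_pos[of k] by (auto simp: n_def)
      then have "coprime CHAR('a) n" using prime_CHAR_finite_field[where 'a = 'a] prime_imp_coprime by blast
      then show ?thesis unfolding s_def by simp
    qed
    then obtain x y where xy: "x * int s + y * int n = 1"
      using bezout_int[of "int s" "int n"] by auto
    \<comment> \<open>By x * s + y * n = 1 the vector splits as e = s * z + n * w. The values of
      \<open>z\<close> are 1, so s * z is a relation by \<open>val_imp_rel\<close>; \<open>w\<close>
      below collects the rest.\<close>
    define z where "z = (\<lambda>j\<in>{0..Q}. x * (e j - int n * e' j))"
    have valz: "val i z = 1" if i: "i \<in> {0..l}" for i
    proof -
      define d where "d = (\<lambda>j\<in>{0..Q}. e j - int n * e' j)"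
      have "d \<otimes>\<^bsub>Zpow Q\<^esub> (\<lambda>j\<in>{0..Q}. int n * e' j) = e"
        using e(1) by (auto simp: Zpow_simps d_def fun_eq_iff PiE_iff extensional_def)
      then have "val i d * (val i e' powi int n) = val i e"
        using val_mult[OF i, of d "\<lambda>j\<in>{0..Q}. int n * e' j"] by (simp only: val_scale)
      then have "val i d * val i e = 1 * val i e" using b[OF i] ve'[OF i] by simp
      then have "val i d = 1" by (rule iffD1[OF mult_right_cancel[OF val_nz[OF i, of e]]])
      moreover have "z = (\<lambda>j\<in>{0..Q}. x * d j)" by (auto simp: z_def d_def fun_eq_iff)
      ultimately show ?thesis by (simp only: val_scale power_int_1_left)
    qed
    have zS: "(\<lambda>j\<in>{0..Q}. int s * z j) \<in> S"
      using val_imp_rel[OF valz at] relS unfolding s_def by blast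
    define w where "w = (\<lambda>j\<in>{0..Q}. x * int s * e' j + y * e j)"
    define wr where "wr A = (\<lambda>j\<in>{0..Q}. if j \<in> A then int n * w j else 0)" for A
    have "wr A \<in> S" if "A \<subseteq> {1..Q}" for A
      using finite_subset[OF that finite_atLeastAtMost] that
    proof (induction A rule: finite_induct)
      case empty
      have "wr {} = \<one>\<^bsub>Zpow Q\<^esub>" by (simp add: wr_def Zpow_simps)
      then show ?case by (simp only: subgroup.one_closed[OF subS])
    next
      case (insert j A)
      have "wr (insert j A) = (\<lambda>i\<in>{0..Q}. w j * scaled_unit Q (int n) j i) \<otimes>\<^bsub>Zpow Q\<^esub> wr A"
        using insert by (auto simp: wr_def Zpow_simps scaled_unit_def fun_eq_iff)
      moreover have "(\<lambda>i\<in>{0..Q}. w j * scaled_unit Q (int n) j i) \<in> S"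
        using insert by (intro subgroup_Zpow_scale[OF subS] unitS) auto
      ultimately show ?case using subgroup.m_closed[OF subS] insert by simp
    qed
    then have w1: "wr {1..Q} \<in> S" by simp
    \<comment> \<open>The part in coordinate 0 is itself a relation: \<open>lam\<close> is a nonzero
      element of the ground field, which lies in \<open>FL k\<close>, so its n-th power is
      1.\<close>
    have "(\<lambda>j\<in>{0..Q}. if j = 0 then int n * w 0 else 0) \<in> rel_lattice Q lam al m"
    proof -
      define g where "g = (\<lambda>j\<in>{0..Q}. if j = 0 then int n * w 0 else 0)"
      have "lam ^ n = 1"
      proof -
        have "to_ac lam \<in> FL k" by (rule to_ac_FL)
        then have "to_ac lam ^ n = 1" unfolding n_def using lam0 by (intro FL_power_order) auto
        then have "to_ac (lam ^ n) = to_ac 1" by simp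
        then show ?thesis by (simp only: to_ac_eq_iff)
      qed
      then have one: "lam ^ nat (int n * c) = 1" for c
        by (cases "c \<ge> 0") (simp_all add: nat_mult_distrib power_mult mult_nonneg_nonpos)
      have "expt_poly Q lam al g = 1" "expt_poly Q lam al (\<lambda>j. - g j) = 1"
        using one[of "w 0"] one[of "- w 0"] by (simp_all add: expt_poly_def g_def one_pCons poly_const_pow)
      then show ?thesis unfolding rel_iff g_def[symmetric] by (simp add: g_def Zpow_simps)
    qed
    then have w0: "(\<lambda>j\<in>{0..Q}. if j = 0 then int n * w 0 else 0) \<in> S" using relS by blast
    have "e = (\<lambda>j\<in>{0..Q}. int s * z j) \<otimes>\<^bsub>Zpow Q\<^esub> (wr {1..Q} \<otimes>\<^bsub>Zpow Q\<^esub> (\<lambda>j\<in>{0..Q}. if j = 0 then int n * w 0 else 0))"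
    proof
      fix j
      show "e j = ((\<lambda>j\<in>{0..Q}. int s * z j) \<otimes>\<^bsub>Zpow Q\<^esub> (wr {1..Q} \<otimes>\<^bsub>Zpow Q\<^esub> (\<lambda>j\<in>{0..Q}. if j = 0 then int n * w 0 else 0))) j"
      proof (cases "j \<in> {0..Q}")
        case True
        have "e j = (x * int s + y * int n) * e j" by (simp add: xy)
        also have "\<dots> = int s * z j + int n * w j" using True by (simp add: z_def w_def algebra_simps)
        finally show ?thesis using True by (auto simp: Zpow_simps wr_def)
      next
        case False
        then show ?thesis using e(1) by (auto simp: Zpow_simps PiE_iff extensional_def)
      qed
    qed
    then show "e \<in> S" using subgroup.m_closed[OF subS zS subgroup.m_closed[OF subS w1 w0]] by simp
  qed
  ultimately have "S = kernel (Zpow Q) T \<Phi>" by blast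
  then have "Zpow Q Mod S \<cong> T" using h.FactGroup_iso[OF surj] by simp
  moreover have T': "T = integer_mod_group n \<times>\<times> product_group {1..l} (\<lambda>i. integer_mod_group (nn i))"
    unfolding T_def nn0 ..
  ultimately show ?thesis unfolding S_def T' n_def nn_def by blast
qed

end

theorem theorem2:
  fixes q k l :: nat
    and h0 h1 f :: "'a::{field, finite} poly"
    and fs :: "nat \<Rightarrow> 'a poly"
    and a :: "nat \<Rightarrow> nat"
    and lam :: 'a
    and al :: "nat \<Rightarrow> 'a"
  assumes "primepow q"
    and "card (UNIV :: 'a set) = q ^ 2"
    and "1 < k" and "k < q"
    and "Rings.coprime h0 h1"
    and "h1 \<noteq> 0"
    and "Polynomial.degree h0 < q + Polynomial.degree h1"
    and "Polynomial.monom 1 q * h1 - h0 = f * (\<Prod>i\<in>{1..l}. fs i ^ a i)"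
    and "\<And>i. i \<in> {1..l} \<Longrightarrow> a i \<ge> 1"
    and "Factorial_Ring.irreducible f"
    and "\<And>i. i \<in> {1..l} \<Longrightarrow> Factorial_Ring.irreducible (fs i)"
    and "\<And>i. i \<in> {1..l} \<Longrightarrow> Rings.coprime f (fs i)"
    and "\<And>i j. i \<in> {1..l} \<Longrightarrow> j \<in> {1..l} \<Longrightarrow> i \<noteq> j \<Longrightarrow> Rings.coprime (fs i) (fs j)"
    and "Polynomial.degree f = k"
    and "\<And>i. i \<in> {1..l} \<Longrightarrow> Polynomial.degree (fs i) \<ge> 2"
    and "Polynomial.degree h1 \<le> 2"
    and "lam \<in> carrier (units_of type_ring)"
    and "generate (units_of type_ring) {lam} = carrier (units_of type_ring)"
    and "bij_betw al {1..q ^ 2} UNIV"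
    and "al 1 = 0"
  shows "Zpow (q ^ 2) Mod
           rel_lattice_star (q ^ 2) (int q ^ (2 * k) - 1) lam al (Polynomial.monom 1 q * h1 - h0)
         \<cong> integer_mod_group (q ^ (2 * k) - 1) \<times>\<times>
            product_group {1..l}
              (\<lambda>i. integer_mod_group (q ^ (2 * gcd k (Polynomial.degree (fs i))) - 1))"
proof -
  define m where "m = Polynomial.monom 1 q * h1 - h0"
  \<comment> \<open>\<open>f\<close> becomes factor number 0, with exponent 1.\<close>
  define P where "P i = (if i = 0 then f else fs i)" for i
  define a' where "a' i = (if i = 0 then 1 else a i)" for i
  obtain u where u: "u > 0" "q = CHAR('a) ^ u"
    using primepow_card_imp_CHAR_power[OF assms(1,2)] by auto
  have irr: "Factorial_Ring.irreducible (P i)" if "i \<in> {0..l}" for i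
    using assms(10,11) that by (auto simp: P_def)
  have deg2: "degree (P i) \<ge> 2" if "i \<in> {0..l}" for i
    using assms(3,14,15) that by (auto simp: P_def)
  have "\<exists>\<beta>. poly (acp (P i)) \<beta> = 0" if "i \<in> {0..l}" for i
    using alg_closed_imp_poly_has_root[of "acp (P i)"] deg2[OF that] by simp
  then have "\<exists>\<beta>. \<forall>i\<in>{0..l}. poly (acp (P i)) (\<beta> i) = 0" by (intro bchoice) blast
  then obtain \<beta> where \<beta>: "\<And>i. i \<in> {0..l} \<Longrightarrow> poly (acp (P i)) (\<beta> i) = 0" by blast
  have m_prod: "m = (\<Prod>i\<in>{0..l}. P i ^ a' i)"
  proof -
    have "(\<Prod>i\<in>{0..l}. P i ^ a' i) = P 0 ^ a' 0 * (\<Prod>i\<in>{Suc 0..l}. P i ^ a' i)"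
      by (rule prod.atLeast_Suc_atMost) simp
    also have "(\<Prod>i\<in>{Suc 0..l}. P i ^ a' i) = (\<Prod>i\<in>{1..l}. fs i ^ a i)"
      by (intro prod.cong) (auto simp: P_def a'_def)
    finally show ?thesis using assms(8) by (simp add: m_def P_def a'_def)
  qed
  have units: "carrier (units_of (type_ring :: 'a ring)) = - {0}"
  proof -
    have "x \<in> Units (type_ring :: 'a ring) \<longleftrightarrow> x \<noteq> 0" for x :: 'a
      unfolding Units_def type_ring_simps by (auto intro!: exI[of _ "inverse x"])
    then show ?thesis by (auto simp: units_of_def)
  qed
  have lam0: "lam \<noteq> 0" using assms(17) units by auto
  have lam_gen: "\<exists>z. x = lam powi z" if "x \<noteq> 0" for x
  proof -
    interpret R: cring "type_ring :: 'a ring" by (rule cring_from_type_algebra)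
    interpret U: comm_group "units_of (type_ring :: 'a ring)" by (rule R.units_comm_group)
    have mult: "x \<otimes>\<^bsub>units_of type_ring\<^esub> y = x * y" and unit_one: "\<one>\<^bsub>units_of type_ring\<^esub> = (1 :: 'a)" for x y :: 'a
      by (simp_all add: units_of_def type_ring_simps)
    have "x \<in> generate (units_of type_ring) {lam}" using that assms(18) units by simp
    then show ?thesis
    proof (induction rule: generate.induct)
      case one
      show ?case by (rule exI[of _ 0]) (simp add: unit_one)
    next
      case (incl h)
      then show ?case by (intro exI[of _ 1]) simp
    next
      case (inv h)
      have "inv\<^bsub>units_of type_ring\<^esub> lam = inverse lam"
        using lam0 by (intro U.inv_equality) (auto simp: mult unit_one units)
      then show ?case using inv by (intro exI[of _ "-1"]) (simp add: power_int_minus)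
    next
      case (eng h1 h2)
      then obtain z z' where "h1 = lam powi z" "h2 = lam powi z'" by auto
      then show ?case using lam0 by (intro exI[of _ "z + z'"]) (simp add: mult power_int_add)
    qed
  qed
  have cop: "Rings.coprime (P i) (P j)" if "i \<in> {0..l}" "j \<in> {0..l}" "i \<noteq> j" for i j
    using assms(12)[of i] assms(12)[of j] assms(13)[of i j] that by (auto simp: P_def coprime_commute)
  interpret smooth_relations "q ^ 2" "TYPE('a)" l P a' m lam al \<beta>
  proof
    show "q ^ 2 = card (UNIV :: 'a set)" using assms(2) by simp
    show "\<exists>s>0. q ^ 2 = CHAR('a) ^ s"
      using u by (intro exI[of _ "u * 2"]) (simp add: power_mult)
    show "al ` {1..q ^ 2} = UNIV" using assms(19) by (simp add: bij_betw_def)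
    show "a' i \<ge> 1" if "i \<in> {0..l}" for i using assms(9) that by (auto simp: a'_def)
  qed (use irr \<beta> deg2 m_prod lam0 lam_gen cop in blast)+
  \<comment> \<open>The left side is the degree of the radical of \<open>m\<close>, and
    \<open>m\<close> has degree at most q + deg h1.\<close>
  have deg: "(\<Sum>i\<in>{0..l}. degree (P i)) \<le> q + 2"
  proof -
    have P0: "P i \<noteq> 0" if "i \<in> {0..l}" for i using deg2[OF that] by auto
    have "(\<Prod>i\<in>{0..l}. P i) dvd m" unfolding m_prod
    proof (rule prod_dvd_prod)
      show "P i dvd P i ^ a' i" if "i \<in> {0..l}" for i using a1[OF that] by (intro dvd_power) simp
    qed
    moreover have "m \<noteq> 0" unfolding m_prod using P0 by (simp add: prod_zero_iff)
    ultimately have "degree (\<Prod>i\<in>{0..l}. P i) \<le> degree m" by (rule dvd_imp_degree_le)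
    moreover have "degree (\<Prod>i\<in>{0..l}. P i) = (\<Sum>i\<in>{0..l}. degree (P i))" using P0 by (intro degree_prod_sum_eq)
    moreover have "degree m \<le> q + degree h1" unfolding m_def
    proof (rule degree_diff_le)
      show "degree (Polynomial.monom 1 q * h1) \<le> q + degree h1"
        using degree_mult_le[of "Polynomial.monom 1 q" h1] by (simp add: degree_monom_eq)
    qed (use assms(7) in simp)
    ultimately show ?thesis using assms(16) by linarith
  qed
  have "q > 0" using assms(4) by simp
  then have "int q ^ (2 * k) - 1 = int ((q ^ 2) ^ k - 1)" by (simp add: of_nat_diff power_mult)
  \<comment> \<open>The two families can differ at index 0 only, which lies outside the index
    set.\<close>
  moreover have "product_group {1..l} (\<lambda>i. integer_mod_group (q ^ (2 * gcd k (degree (fs i))) - 1))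
      = product_group {1..l} (\<lambda>i. integer_mod_group ((q ^ 2) ^ gcd k (degree (P i)) - 1))"
    unfolding product_group_def by (auto simp: P_def power_mult fun_eq_iff restrict_def intro!: PiE_cong)
  moreover have "degree (P 0) = k" using assms(14) by (simp add: P_def)
  ultimately show ?thesis
    using quotient_iso[OF refl u(2) deg] by (simp add: m_def power_mult)
qed

end
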